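(* Let $k$ be a finite field with $|k|=q$ and let $Q$ be an acyclic quiver with vertex set $\{1,\dots,n\}$ whose underlying graph is bipartite (i.e. the graph admits an orientation for which every vertex is a sink or a source) and whose associated $n\times n$ matrix $B$ is of full rank. Let $\Lambda$ be an antisymmetric integer $n\times n$ matrix with $\Lambda(-B)=I_n$. Let $\mathcal{A}$ be the category of finite-dimensional representations of $Q$ over $k$, $\mathcal{H}^{*}(\mathcal{A})$ its dual Ringel-Hall algebra, and $\Psi:\mathcal{H}^{*}(\mathcal{A})\to\mathcal{T}$ the algebra homomorphism $\delta_V\mapsto X_V$. Then $$\Psi(\mathcal{H}^{*}(\mathcal{A}))\subseteq\mathcal{A}_{|k|}(Q),$$ where $\mathcal{A}_{|k|}(Q)$ is the (coefficient-free) quantum cluster algebra with initial data $(\Lambda,B)$.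
   Context: Matrices. $B=(b_{ij})$ is the $n\times n$ matrix with $b_{ij}=|\{\text{arrows } i\to j\}|-|\{\text{arrows } j\to i\}|$. $R=(r_{ij})$ is the $n\times n$ matrix with $r_{ij}=|\{\text{arrows } j\to i\}|$; $R^{tr}$ is its transpose, so $B=R^{tr}-R$. $I_n$ is the identity matrix. Put $\Lambda(c,d)=c^{T}\Lambda d$ for $c,d\in\mathbb{Z}^n$. Quantum torus. $q=|k|$ with a fixed square root $q^{1/2}$. $\mathcal{T}$ is the $\mathbb{Z}[q^{\pm1/2}]$-algebra with $\mathbb{Z}[q^{\pm1/2}]$-basis $\{X^{c}: c\in\mathbb{Z}^n\}$ and multiplication $X^{c}X^{d}=q^{\Lambda(c,d)/2}X^{c+d}$. It is an Ore domain with skew-field of fractions $\mathcal{F}$. Let $e_1,\dots,e_n$ be the standard basis of $\mathbb{Z}^n$. Quantum cluster algebra. A toric frame with antisymmetric form $\Lambda_M$ is given by elements $M(e_1),\dots,M(e_n)\in\mathcal{F}\setminus\{0\}$ and extended to $M:\mathbb{Z}^n\to\mathcal{F}\setminus\{0\}$ satisfying $M(c)M(d)=q^{\Lambda_M(c,d)/2}M(c+d)$ and $M(0)=1$. The initial seed is $(M,B)$ with $M(c)=X^{c}$, $\Lambda_M=\Lambda$. The mutation of a seed $(M,B)$ in direction $p\in\{1,\dots,n\}$ is the seed $(M',B')$, where $M'(e_i)=M(e_i)$ for $i\neq p$, $$M'(e_p)=M\Big(\sum_i[b_{ip}]_+e_i-e_p\Big)+M\Big(\sum_i[-b_{ip}]_+e_i-e_p\Big),\qquad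 [b]_+=\max(b,0),$$ $\Lambda_{M'}=E^{T}\Lambda_M E$ with $E=(e_{ij})$, $e_{ij}=\delta_{ij}$ if $j\ne p$, $e_{pp}=-1$, $e_{ip}=\max(0,-b_{ip})$ if $i\neq p$; and $b'_{ij}=-b_{ij}$ if $i=p$ or $j=p$, $b'_{ij}=b_{ij}+\mathrm{sgn}(b_{ip})[b_{ip}b_{pj}]_+$ otherwise. The cluster variables are all elements $M'(e_i)$, $1\le i\le n$, for seeds $(M',B')$ obtained from the initial seed by finite sequences of mutations. $\mathcal{A}_{|k|}(Q)$ is the $\mathbb{Z}[q^{\pm1/2}]$-subalgebra of $\mathcal{F}$ generated by all cluster variables. Characters. For a finite-dimensional $kQ$-module $M$ with dimension vector $\underline{m}\in\mathbb{Z}^n$, $$X_{M}=\sum_{\underline{e}}|\mathrm{Gr}_{\underline{e}}M|\,q^{-\frac12\langle\underline{e},\underline{m}-\underline{e}\rangle}X^{-B\underline{e}-(I_n-R^{tr})\underline{m}}\in\mathcal{T},$$ where $\mathrm{Gr}_{\underline{e}}M$ is the (finite) set of submodules of $M$ of dimension vector $\underline{e}$ and $\langle M,N\rangle=\dim_k\mathrm{Hom}(M,N)-\dim_k\mathrm{Ext}^1(M,N)$ is the Euler form, which depends only on dimension vectors. Dual Ringel-Hall algebra. $\mathcal{H}^{*}(\mathcal{A})$ is the free $\mathbb{Z}[q^{\pm1/2}]$-module with basis $\delta_V$ indexed by isomorphism classes $[V]$ of objects of $\mathcal{A}$, with the associative multiplication $$\delta_{M}\ast\delta_{N}=q^{\frac12\Lambda((I_n-R^{tr})\underline{m},(I_n-R^{tr})\underline{n})+\langle\underline{m},\underline{n}\rangle}\sum_{[E]}h^{MN}_{E}\delta_E,\qquad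 h^{MN}_E=\frac{|\mathrm{Ext}^1_{kQ}(M,N)_E|}{|\mathrm{Hom}_{kQ}(M,N)|},$$ where $\underline{m},\underline{n}$ are the dimension vectors of $M,N$ and $\mathrm{Ext}^1_{kQ}(M,N)_E\subseteq\mathrm{Ext}^1_{kQ}(M,N)$ is the subset of classes of short exact sequences $0\to N\to E'\to M\to0$ with $E'\cong E$. The $\mathbb{Z}[q^{\pm1/2}]$-linear map $\Psi:\mathcal{H}^{*}(\mathcal{A})\to\mathcal{T}$, $\Psi(\delta_V)=X_V$, is an algebra homomorphism. *)

theory Defs
  imports
    "HOL-Analysis.Cartesian_Space"
    "HOL-Algebra.Generated_Rings"
    "HOL-Library.Poly_Mapping"
    "HOL-Library.Function_Algebras"
    "Graph_Theory.Digraph"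
begin

section \<open>Quivers and their matrices\<close>

text \<open>
  A quiver is a \<^typ>\<open>('n, 'a) pre_digraph\<close>; arrows with the same endpoints are allowed. The vertex
  set \<open>{1,\<dots>,n}\<close> is the finite index type \<^typ>\<open>'n\<close>, so vectors in \<open>\<int>\<^sup>n\<close> have type \<^typ>\<open>int ^ 'n\<close>.
\<close>

definition arrow_count :: "('n, 'a) pre_digraph \<Rightarrow> 'n \<Rightarrow> 'n \<Rightarrow> nat" where
  "arrow_count Q i j = card {a \<in> arcs Q. tail Q a = i \<and> head Q a = j}"

definition B_mat :: "('n::finite, 'a) pre_digraph \<Rightarrow> int ^ 'n ^ 'n" where
  "B_mat Q = (\<chi> i j. int (arrow_count Q i j) - int (arrow_count Q j i))"

definition R_mat :: "('n::finite, 'a) pre_digraph \<Rightarrow> int ^ 'n ^ 'n" where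
  "R_mat Q = (\<chi> i j. int (arrow_count Q j i))"

definition full_rank :: "int ^ 'n::finite ^ 'n \<Rightarrow> bool" where
  "full_rank B \<longleftrightarrow> rank (\<chi> i j. rat_of_int (B $ i $ j)) = CARD('n)"

text \<open>Bipartiteness is a property of the underlying graph, so \<open>Q'\<close> may reverse any set of arrows.\<close>

definition bipartite_quiver :: "('n, 'a) pre_digraph \<Rightarrow> bool" where
  "bipartite_quiver Q \<longleftrightarrow> (\<exists>Q' :: ('n, 'a) pre_digraph.
     verts Q' = verts Q \<and> arcs Q' = arcs Q \<and>
     (\<forall>a\<in>arcs Q. {tail Q' a, head Q' a} = {tail Q a, head Q a}) \<and>
     (\<forall>x\<in>verts Q'. (\<forall>a\<in>arcs Q'. tail Q' a \<noteq> x) \<or> (\<forall>a\<in>arcs Q'. head Q' a \<noteq> x)))"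

definition form :: "int ^ 'n::finite ^ 'n \<Rightarrow> int ^ 'n \<Rightarrow> int ^ 'n \<Rightarrow> int" where
  "form L c d = (\<Sum>i\<in>UNIV. \<Sum>j\<in>UNIV. c $ i * L $ i $ j * d $ j)"


section \<open>Finite-dimensional representations\<close>

text \<open>
  The vector spaces of a representation are finite-dimensional subspaces of \<open>nat \<Rightarrow> 'k\<close>; up to
  isomorphism these are all finite-dimensional representations, and isomorphism classes form a set.
\<close>

definition vscale :: "'k::field \<Rightarrow> (nat \<Rightarrow> 'k) \<Rightarrow> nat \<Rightarrow> 'k" where
  "vscale c x = (\<lambda>j. c * x j)"

lemma vector_space_vscale: "vector_space vscale"
  by unfold_locales (auto simp: vscale_def fun_eq_iff algebra_simps)

definition fd_space :: "(nat \<Rightarrow> 'k::field) set \<Rightarrow> bool" where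
  "fd_space V \<longleftrightarrow> (\<exists>S. finite S \<and> V = module.span vscale S)"

definition linear_between ::
    "(nat \<Rightarrow> 'k::field) set \<Rightarrow> (nat \<Rightarrow> 'k) set \<Rightarrow> ((nat \<Rightarrow> 'k) \<Rightarrow> nat \<Rightarrow> 'k) \<Rightarrow> bool" where
  "linear_between V W f \<longleftrightarrow> f ` V \<subseteq> W \<and>
     (\<forall>x\<in>V. \<forall>y\<in>V. f (x + y) = f x + f y) \<and> (\<forall>c. \<forall>x\<in>V. f (vscale c x) = vscale c (f x))"

record ('n, 'a, 'k) qrep =
  vsp :: "'n \<Rightarrow> (nat \<Rightarrow> 'k) set"
  vmap :: "'a \<Rightarrow> (nat \<Rightarrow> 'k) \<Rightarrow> nat \<Rightarrow> 'k"

definition reps :: "('n, 'a) pre_digraph \<Rightarrow> ('n, 'a, 'k::field) qrep set" where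
  "reps Q = {M. (\<forall>i. fd_space (vsp M i)) \<and>
     (\<forall>a\<in>arcs Q. linear_between (vsp M (tail Q a)) (vsp M (head Q a)) (vmap M a))}"

definition sdim :: "('n::finite \<Rightarrow> (nat \<Rightarrow> 'k::field) set) \<Rightarrow> int ^ 'n" where
  "sdim U = (\<chi> i. int (vector_space.dim vscale (U i)))"

definition dimv :: "('n::finite, 'a, 'k::field) qrep \<Rightarrow> int ^ 'n" where
  "dimv M = sdim (vsp M)"

text \<open>Each component of a morphism is extended by \<open>0\<close> outside its domain, so that the homomorphisms
  between two representations are counted correctly and form a subspace of a function space.\<close>

definition Hom :: "('n, 'a) pre_digraph \<Rightarrow> ('n, 'a, 'k::field) qrep \<Rightarrow> ('n, 'a, 'k) qrep
    \<Rightarrow> ('n \<Rightarrow> (nat \<Rightarrow> 'k) \<Rightarrow> nat \<Rightarrow> 'k) set" where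
  "Hom Q M N = {\<phi>. (\<forall>i. linear_between (vsp M i) (vsp N i) (\<phi> i) \<and> (\<forall>x. x \<notin> vsp M i \<longrightarrow> \<phi> i x = 0)) \<and>
     (\<forall>a\<in>arcs Q. \<forall>x\<in>vsp M (tail Q a). \<phi> (head Q a) (vmap M a x) = vmap N a (\<phi> (tail Q a) x))}"

definition Iso :: "('n, 'a) pre_digraph \<Rightarrow> ('n, 'a, 'k::field) qrep \<Rightarrow> ('n, 'a, 'k) qrep
    \<Rightarrow> ('n \<Rightarrow> (nat \<Rightarrow> 'k) \<Rightarrow> nat \<Rightarrow> 'k) set" where
  "Iso Q M N = {\<phi> \<in> Hom Q M N. \<forall>i. bij_betw (\<phi> i) (vsp M i) (vsp N i)}"

definition isoclasses :: "('n, 'a) pre_digraph \<Rightarrow> ('n, 'a, 'k::field) qrep set set" where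
  "isoclasses Q = reps Q // {(M, N). M \<in> reps Q \<and> N \<in> reps Q \<and> Iso Q M N \<noteq> {}}"

definition submodules ::
    "('n, 'a) pre_digraph \<Rightarrow> ('n, 'a, 'k::field) qrep \<Rightarrow> ('n \<Rightarrow> (nat \<Rightarrow> 'k) set) set" where
  "submodules Q M = {U. (\<forall>i. module.subspace vscale (U i) \<and> U i \<subseteq> vsp M i) \<and>
     (\<forall>a\<in>arcs Q. vmap M a ` U (tail Q a) \<subseteq> U (head Q a))}"

definition Gr :: "('n::finite, 'a) pre_digraph \<Rightarrow> ('n, 'a, 'k::field) qrep \<Rightarrow> int ^ 'n
    \<Rightarrow> ('n \<Rightarrow> (nat \<Rightarrow> 'k) set) set" where
  "Gr Q M e = {U \<in> submodules Q M. sdim U = e}"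


section \<open>Extensions and the Euler form\<close>

text \<open>A triple \<open>(E, f, g)\<close> is the short exact sequence \<open>0 \<rightarrow> N \<rightarrow> E \<rightarrow> M \<rightarrow> 0\<close> with maps \<open>f\<close> and \<open>g\<close>.\<close>

type_synonym ('n, 'a, 'k) ses =
  "('n, 'a, 'k) qrep \<times> ('n \<Rightarrow> (nat \<Rightarrow> 'k) \<Rightarrow> nat \<Rightarrow> 'k) \<times> ('n \<Rightarrow> (nat \<Rightarrow> 'k) \<Rightarrow> nat \<Rightarrow> 'k)"

definition short_exact :: "('n, 'a) pre_digraph \<Rightarrow> ('n, 'a, 'k::field) qrep \<Rightarrow> ('n, 'a, 'k) qrep
    \<Rightarrow> ('n, 'a, 'k) ses set" where
  "short_exact Q M N = {(E, f, g). E \<in> reps Q \<and> f \<in> Hom Q N E \<and> g \<in> Hom Q E M \<and>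
     (\<forall>i. inj_on (f i) (vsp N i) \<and> g i ` vsp E i = vsp M i \<and>
          f i ` vsp N i = {x \<in> vsp E i. g i x = 0})}"

definition ses_equiv :: "('n, 'a) pre_digraph \<Rightarrow> ('n, 'a, 'k::field) qrep \<Rightarrow> ('n, 'a, 'k) qrep
    \<Rightarrow> (('n, 'a, 'k) ses \<times> ('n, 'a, 'k) ses) set" where
  "ses_equiv Q M N = {((E, f, g), (E', f', g')).
     (E, f, g) \<in> short_exact Q M N \<and> (E', f', g') \<in> short_exact Q M N \<and>
     (\<exists>\<phi>\<in>Iso Q E E'. \<forall>i. (\<forall>x\<in>vsp N i. \<phi> i (f i x) = f' i x) \<and> (\<forall>x\<in>vsp E i. g' i (\<phi> i x) = g i x))}"

definition Ext1 :: "('n, 'a) pre_digraph \<Rightarrow> ('n, 'a, 'k::field) qrep \<Rightarrow> ('n, 'a, 'k) qrep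
    \<Rightarrow> ('n, 'a, 'k) ses set set" where
  "Ext1 Q M N = short_exact Q M N // ses_equiv Q M N"

definition Ext1_mid :: "('n, 'a) pre_digraph \<Rightarrow> ('n, 'a, 'k::field) qrep \<Rightarrow> ('n, 'a, 'k) qrep
    \<Rightarrow> ('n, 'a, 'k) qrep \<Rightarrow> ('n, 'a, 'k) ses set set" where
  "Ext1_mid Q M N E = {\<xi> \<in> Ext1 Q M N. \<exists>(E', f, g)\<in>\<xi>. Iso Q E' E \<noteq> {}}"

definition hom_scale :: "'k::field \<Rightarrow> ('n \<Rightarrow> (nat \<Rightarrow> 'k) \<Rightarrow> nat \<Rightarrow> 'k) \<Rightarrow> 'n \<Rightarrow> (nat \<Rightarrow> 'k) \<Rightarrow> nat \<Rightarrow> 'k" where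
  "hom_scale c \<phi> = (\<lambda>i x. vscale c (\<phi> i x))"

lemma vector_space_hom_scale: "vector_space hom_scale"
  by unfold_locales (auto simp: hom_scale_def vscale_def fun_eq_iff algebra_simps)

definition hom_dim :: "('n, 'a) pre_digraph \<Rightarrow> ('n, 'a, 'k::field) qrep \<Rightarrow> ('n, 'a, 'k) qrep \<Rightarrow> nat" where
  "hom_dim Q M N = vector_space.dim hom_scale (Hom Q M N)"

text \<open>Over the finite field \<open>'k\<close>, the dimension of a finite vector space is the exponent of its
  cardinality; this avoids spelling out the Baer sum and the scalar action on extension classes.\<close>

definition ext_dim ::
    "('n, 'a) pre_digraph \<Rightarrow> ('n, 'a, 'k::{field,finite}) qrep \<Rightarrow> ('n, 'a, 'k) qrep \<Rightarrow> nat" where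
  "ext_dim Q M N = (THE d. card (Ext1 Q M N) = CARD('k) ^ d)"

text \<open>The Euler form on dimension vectors is the common value of
  \<open>dim Hom(M, N) - dim Ext\<^sup>1(M, N)\<close> over all \<open>M\<close>, \<open>N\<close> with these dimension vectors.\<close>

definition euler :: "'k::{field,finite} itself \<Rightarrow> ('n::finite, 'a) pre_digraph
    \<Rightarrow> int ^ 'n \<Rightarrow> int ^ 'n \<Rightarrow> int" where
  "euler _ Q d e = (THE c. \<forall>M\<in>reps Q. \<forall>N :: ('n, 'a, 'k) qrep \<in> reps Q. dimv M = d \<longrightarrow> dimv N = e \<longrightarrow>
     c = int (hom_dim Q M N) - int (ext_dim Q M N))"


section \<open>The quantum torus\<close>

text \<open>Throughout, \<open>v\<close> is the chosen square root of \<open>q\<close>.\<close>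

definition coeff_ring :: "real \<Rightarrow> real set" where
  "coeff_ring v = {(\<Sum>i\<in>I. of_int (a i) * v powi i) | (I :: int set) (a :: int \<Rightarrow> int). finite I}"

text \<open>The element \<open>\<Sum>\<^sub>c a\<^sub>c X\<^sup>c\<close> is the finitely supported function \<open>c \<mapsto> a\<^sub>c\<close>, and \<open>X\<^sup>c\<close> is
  \<open>Poly_Mapping.single c 1\<close>. Only the additive structure of \<^typ>\<open>int ^ 'n \<Rightarrow>\<^sub>0 real\<close> is used:
  the product of the type class is the untwisted one.\<close>

definition qtorus_mult :: "int ^ 'n::finite ^ 'n \<Rightarrow> real
    \<Rightarrow> (int ^ 'n \<Rightarrow>\<^sub>0 real) \<Rightarrow> (int ^ 'n \<Rightarrow>\<^sub>0 real) \<Rightarrow> (int ^ 'n \<Rightarrow>\<^sub>0 real)" where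
  "qtorus_mult L v f g = (\<Sum>c\<in>Poly_Mapping.keys f. \<Sum>d\<in>Poly_Mapping.keys g.
     Poly_Mapping.single (c + d) (Poly_Mapping.lookup f c * Poly_Mapping.lookup g d * v powi form L c d))"

definition qtorus :: "int ^ 'n::finite ^ 'n \<Rightarrow> real \<Rightarrow> (int ^ 'n \<Rightarrow>\<^sub>0 real) ring" where
  "qtorus L v = \<lparr>carrier = {f. range (Poly_Mapping.lookup f) \<subseteq> coeff_ring v},
     mult = qtorus_mult L v, one = Poly_Mapping.single 0 1, zero = 0, add = (+)\<rparr>"

text \<open>An Ore domain determines its skew field of fractions up to unique isomorphism over it, so \<open>F\<close> and
  the embedding \<open>\<iota>\<close> of \<open>T\<close> are given by this characterisation.\<close>

definition skew_field_of_fractions :: "'t ring \<Rightarrow> 'f ring \<Rightarrow> ('t \<Rightarrow> 'f) \<Rightarrow> bool" where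
  "skew_field_of_fractions T F \<iota> \<longleftrightarrow>
     ring F \<and> Units F = carrier F - {\<zero>\<^bsub>F\<^esub>} \<and>
     \<iota> \<in> ring_hom T F \<and> inj_on \<iota> (carrier T) \<and>
     (\<forall>x\<in>carrier F. \<exists>a\<in>carrier T. \<exists>s\<in>carrier T - {\<zero>\<^bsub>T\<^esub>}. x = \<iota> a \<otimes>\<^bsub>F\<^esub> inv\<^bsub>F\<^esub> (\<iota> s))"


section \<open>The quantum cluster algebra\<close>

type_synonym ('n, 'f) seed = "(int ^ 'n \<Rightarrow> 'f) \<times> (int ^ 'n ^ 'n) \<times> (int ^ 'n ^ 'n)"

definition toric_frame :: "'f ring \<Rightarrow> ((int ^ 'n::finite \<Rightarrow>\<^sub>0 real) \<Rightarrow> 'f) \<Rightarrow> real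
    \<Rightarrow> int ^ 'n ^ 'n \<Rightarrow> (int ^ 'n \<Rightarrow> 'f) \<Rightarrow> bool" where
  "toric_frame F \<iota> v L M \<longleftrightarrow> transpose L = - L \<and>
     (\<forall>c. M c \<in> carrier F - {\<zero>\<^bsub>F\<^esub>}) \<and> M 0 = \<one>\<^bsub>F\<^esub> \<and>
     (\<forall>c d. M c \<otimes>\<^bsub>F\<^esub> M d = \<iota> (Poly_Mapping.single 0 (v powi form L c d)) \<otimes>\<^bsub>F\<^esub> M (c + d))"

definition E_mat :: "int ^ 'n::finite ^ 'n \<Rightarrow> 'n \<Rightarrow> int ^ 'n ^ 'n" where
  "E_mat B p = (\<chi> i j. if j \<noteq> p then (if i = j then 1 else 0)
                       else if i = p then - 1 else max 0 (- B $ i $ p))"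

definition mutate_mat :: "'n \<Rightarrow> int ^ 'n::finite ^ 'n \<Rightarrow> int ^ 'n ^ 'n" where
  "mutate_mat p B = (\<chi> i j. if i = p \<or> j = p then - B $ i $ j
                            else B $ i $ j + sgn (B $ i $ p) * max (B $ i $ p * B $ p $ j) 0)"

text \<open>A toric frame is determined by its form and its values on the standard basis vectors, so the
  following relation is functional.\<close>

definition is_mutation :: "'f ring \<Rightarrow> ((int ^ 'n::finite \<Rightarrow>\<^sub>0 real) \<Rightarrow> 'f) \<Rightarrow> real
    \<Rightarrow> 'n \<Rightarrow> ('n, 'f) seed \<Rightarrow> ('n, 'f) seed \<Rightarrow> bool" where
  "is_mutation F \<iota> v p = (\<lambda>(M, L, B) (M', L', B').
     L' = transpose (E_mat B p) ** L ** E_mat B p \<and>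
     B' = mutate_mat p B \<and>
     toric_frame F \<iota> v L' M' \<and>
     (\<forall>i. i \<noteq> p \<longrightarrow> M' (axis i 1) = M (axis i 1)) \<and>
     M' (axis p 1) = M ((\<chi> i. max (B $ i $ p) 0) - axis p 1) \<oplus>\<^bsub>F\<^esub> M ((\<chi> i. max (- B $ i $ p) 0) - axis p 1))"

inductive_set seeds :: "'f ring \<Rightarrow> ((int ^ 'n::finite \<Rightarrow>\<^sub>0 real) \<Rightarrow> 'f) \<Rightarrow> real
    \<Rightarrow> int ^ 'n ^ 'n \<Rightarrow> int ^ 'n ^ 'n \<Rightarrow> ('n, 'f) seed set"
  for F :: "'f ring" and \<iota> :: "(int ^ 'n::finite \<Rightarrow>\<^sub>0 real) \<Rightarrow> 'f" and v :: real
    and L B :: "int ^ 'n ^ 'n" where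
  initial: "((\<lambda>c. \<iota> (Poly_Mapping.single c 1)), L, B) \<in> seeds F \<iota> v L B"
| mutation: "s \<in> seeds F \<iota> v L B \<Longrightarrow> is_mutation F \<iota> v p s s' \<Longrightarrow> s' \<in> seeds F \<iota> v L B"

definition cluster_variables :: "'f ring \<Rightarrow> ((int ^ 'n::finite \<Rightarrow>\<^sub>0 real) \<Rightarrow> 'f) \<Rightarrow> real
    \<Rightarrow> int ^ 'n ^ 'n \<Rightarrow> int ^ 'n ^ 'n \<Rightarrow> 'f set" where
  "cluster_variables F \<iota> v L B = {M (axis i 1) | M L' B' i. (M, L', B') \<in> seeds F \<iota> v L B}"

definition quantum_cluster_algebra :: "'f ring \<Rightarrow> ((int ^ 'n::finite \<Rightarrow>\<^sub>0 real) \<Rightarrow> 'f) \<Rightarrow> real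
    \<Rightarrow> int ^ 'n ^ 'n \<Rightarrow> int ^ 'n ^ 'n \<Rightarrow> 'f set" where
  "quantum_cluster_algebra F \<iota> v L B =
     generate_ring F ((\<lambda>a. \<iota> (Poly_Mapping.single 0 a)) ` coeff_ring v \<union> cluster_variables F \<iota> v L B)"


section \<open>The dual Ringel-Hall algebra and the character map\<close>

definition quantum_character :: "('n::finite, 'a) pre_digraph \<Rightarrow> real
    \<Rightarrow> ('n, 'a, 'k::{field,finite}) qrep \<Rightarrow> (int ^ 'n \<Rightarrow>\<^sub>0 real)" where
  "quantum_character Q v M = (\<Sum>e | Gr Q M e \<noteq> {}.
     Poly_Mapping.single (- (B_mat Q *v e) - (mat 1 - transpose (R_mat Q)) *v dimv M)
       (real (card (Gr Q M e)) * v powi (- euler TYPE('k) Q e (dimv M - e))))"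

definition hall_number :: "('n, 'a) pre_digraph \<Rightarrow> ('n, 'a, 'k::field) qrep \<Rightarrow> ('n, 'a, 'k) qrep
    \<Rightarrow> ('n, 'a, 'k) qrep \<Rightarrow> real" where
  "hall_number Q M N E = real (card (Ext1_mid Q M N E)) / real (card (Hom Q M N))"

definition obj :: "('n, 'a, 'k) qrep set \<Rightarrow> ('n, 'a, 'k) qrep" where
  "obj C = (SOME M. M \<in> C)"

text \<open>\<open>\<delta>\<^sub>V\<close> is \<open>Poly_Mapping.single [V] 1\<close>.\<close>

definition hall_basis_mult :: "('n::finite, 'a) pre_digraph \<Rightarrow> int ^ 'n ^ 'n \<Rightarrow> real
    \<Rightarrow> ('n, 'a, 'k::{field,finite}) qrep set \<Rightarrow> ('n, 'a, 'k) qrep set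
    \<Rightarrow> (('n, 'a, 'k) qrep set \<Rightarrow>\<^sub>0 real)" where
  "hall_basis_mult Q L v C D =
     (let M = obj C; N = obj D; P = mat 1 - transpose (R_mat Q) in
      \<Sum>E | E \<in> isoclasses Q \<and> hall_number Q M N (obj E) \<noteq> 0.
        Poly_Mapping.single E
          (v powi (form L (P *v dimv M) (P *v dimv N) + 2 * euler TYPE('k) Q (dimv M) (dimv N))
             * hall_number Q M N (obj E)))"

definition dual_hall_algebra :: "('n::finite, 'a) pre_digraph \<Rightarrow> int ^ 'n ^ 'n \<Rightarrow> real
    \<Rightarrow> (('n, 'a, 'k::{field,finite}) qrep set \<Rightarrow>\<^sub>0 real) ring" where
  "dual_hall_algebra Q L v =
     \<lparr>carrier = {f. Poly_Mapping.keys f \<subseteq> isoclasses Q \<and> range (Poly_Mapping.lookup f) \<subseteq> coeff_ring v},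
      mult = (\<lambda>f g. \<Sum>C\<in>Poly_Mapping.keys f. \<Sum>D\<in>Poly_Mapping.keys g.
        Poly_Mapping.map ((*) (Poly_Mapping.lookup f C * Poly_Mapping.lookup g D))
          (hall_basis_mult Q L v C D)),
      one = Poly_Mapping.single {M \<in> reps Q. \<forall>i. vsp M i = {0}} 1,
      zero = 0, add = (+)\<rparr>"

definition Psi :: "('n::finite, 'a) pre_digraph \<Rightarrow> real
    \<Rightarrow> (('n, 'a, 'k::{field,finite}) qrep set \<Rightarrow>\<^sub>0 real) \<Rightarrow> (int ^ 'n \<Rightarrow>\<^sub>0 real)" where
  "Psi Q v f = (\<Sum>C\<in>Poly_Mapping.keys f.
     Poly_Mapping.map ((*) (Poly_Mapping.lookup f C)) (quantum_character Q v (obj C)))"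

end

(* Each quantum character X_V is a combination, over the coefficient ring, of products of the
   initial cluster variables x_i and the once-mutated ones x'_i.

   Let m be the dimension vector of V. For a family U of subspaces of the V_i, the condition that U
   is a subrepresentation says that the maps of V vanish on (U_tail --> V_head / U_head). It is
   expanded as a sum over families of maps g_a : V_head --> V_tail in the opposite direction with
   image in U_tail and with U_head in the kernel, paired with V by the trace. Exchanging the sums,
   every g contributes a sum over all families U with S <= U <= K, where S_i is spanned by the images
   of the g_a with tail i and K_i is the common kernel of the g_a with head i. With s = dim S,
   t = m - dim K and R as in the definition of B, this inner sum is, up to a power of v,
     X^(R s - t) * Z(S,K) * X^(R^T t - s),
   where both exponents are nonnegative. Peeling off one dimension of K at a vertex j that is
   minimal among those with S_j < K_j splits off a left factor x'_j from Z(S,K). *)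

theory Submission
  imports Defs
begin

section \<open>Linear algebra over a finite field\<close>

text \<open>Being a subrepresentation couples U at the two ends of every arrow through the maps of
  V, so the sum over subrepresentations has no product structure. The maps g absorb this coupling:
  for fixed g the spaces U_i range independently over intervals, and the maps of V survive only in
  one scalar weight. The vertices stay linked by the power of v alone, which is a bilinear
  expression in dimension vectors. With A the transpose of R, the expansion has q^A(u, m - u) terms
  for a family U of dimension u. Dividing by this number turns the Euler form 1 - A into 1 + A, the
  form for which a mutated variable factors off by a recursion of q-binomial type. Acyclicity enters
  twice: it provides the minimal vertex, and it excludes 2-cycles, so that the positive and negative
  parts of B are the two matrices of arrow counts. Two definitions need work of their own. The Euler
  form is a definite description over all representations, and is computed from the two-term complex
  for Hom and Ext. A seed carries a toric frame on all of Z^n, so the frame after one mutation is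
  built explicitly, with negative powers of x'_p.\<close>

lemma (in vector_space) card_finite_subspace:
  assumes "finite (UNIV :: 'a set)" "subspace V" "finite V"
  shows "card V = CARD('a) ^ dim V"
proof -
  obtain B where B: "B \<subseteq> V" "independent B" "V \<subseteq> span B" "card B = dim V"
    using basis_exists[of V] by blast
  have sp: "span B = V" using B assms(2) by (metis span_minimal subset_antisym)
  have finB: "finite B" using B(1) assms(3) finite_subset by blast
  have "bij_betw (\<lambda>u. \<Sum>x\<in>B. scale (u x) x) (PiE B (\<lambda>_. UNIV :: 'a set)) V"
    unfolding bij_betw_def
  proof
    show "inj_on (\<lambda>u. \<Sum>x\<in>B. scale (u x) x) (PiE B (\<lambda>_. UNIV :: 'a set))"
    proof (rule inj_onI)
      fix u w :: "'b \<Rightarrow> 'a"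
      assume u: "u \<in> B \<rightarrow>\<^sub>E UNIV" and w: "w \<in> B \<rightarrow>\<^sub>E UNIV"
        and eq: "(\<Sum>x\<in>B. scale (u x) x) = (\<Sum>x\<in>B. scale (w x) x)"
      have "(\<Sum>x\<in>B. scale (u x - w x) x) = 0"
        using eq by (simp add: scale_left_diff_distrib sum_subtractf)
      hence "u x = w x" if "x \<in> B" for x
        using independentD[OF B(2) finB subset_refl, of "\<lambda>x. u x - w x"] that by simp
      thus "u = w" using u w by (intro PiE_ext) auto
    qed
    show "(\<lambda>u. \<Sum>x\<in>B. scale (u x) x) ` (PiE B (\<lambda>_. UNIV :: 'a set)) = V"
    proof
      show "(\<lambda>u. \<Sum>x\<in>B. scale (u x) x) ` (PiE B (\<lambda>_. UNIV :: 'a set)) \<subseteq> V"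
        using B(1) assms(2) by (auto intro!: subspace_sum subspace_scale)
      show "V \<subseteq> (\<lambda>u. \<Sum>x\<in>B. scale (u x) x) ` (PiE B (\<lambda>_. UNIV :: 'a set))"
      proof
        fix x assume "x \<in> V"
        then obtain u where "x = (\<Sum>x\<in>B. scale (u x) x)"
          using span_finite[OF finB] sp by auto
        hence "x = (\<Sum>x\<in>B. scale (restrict u B x) x)" by simp
        thus "x \<in> (\<lambda>u. \<Sum>x\<in>B. scale (u x) x) ` (PiE B (\<lambda>_. UNIV :: 'a set))"
          by (intro image_eqI[where x = "restrict u B"]) simp_all
      qed
    qed
  qed
  thus ?thesis using B(4) finB by (auto simp: bij_betw_same_card[symmetric] card_PiE)
qed

interpretation vs: vector_space vscale
  by (rule vector_space_vscale)

interpretation vsp: vector_space_pair vscale vscale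
  by unfold_locales

text \<open>Every fibre over the image is a translate of the kernel. Sets closed under differences
  are the common setting of the subspaces and of the cochains to which this count is
  applied.\<close>

lemma card_eq_card_kernel_times_card_image:
  fixes f :: "'x::ab_group_add \<Rightarrow> 'y::ab_group_add"
  assumes fin: "finite V" and ne: "V \<noteq> {}"
    and diff: "\<And>x y. x \<in> V \<Longrightarrow> y \<in> V \<Longrightarrow> x - y \<in> V"
    and hom: "\<And>x y. x \<in> V \<Longrightarrow> y \<in> V \<Longrightarrow> f (x - y) = f x - f y"
  shows "card V = card {x \<in> V. f x = 0} * card (f ` V)"
proof -
  have z: "0 \<in> V" using ne diff by (metis all_not_in_conv diff_self)
  have neg: "- x \<in> V" if "x \<in> V" for x using diff[OF z that] by simp
  have add: "x + y \<in> V" if "x \<in> V" "y \<in> V" for x y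
    using diff[OF that(1) neg[OF that(2)]] by simp
  have f0: "f 0 = 0" using hom[OF z z] by simp
  have fneg: "f (- x) = - f x" if "x \<in> V" for x using hom[OF z that] f0 by simp
  have fadd: "f (x + y) = f x + f y" if "x \<in> V" "y \<in> V" for x y
    using hom[OF that(1) neg[OF that(2)]] fneg[OF that(2)] by simp
  have fib: "card {x \<in> V. f x = y} = card {x \<in> V. f x = 0}" if "y \<in> f ` V" for y
  proof -
    from that obtain x0 where x0: "x0 \<in> V" "y = f x0" by auto
    have "bij_betw (\<lambda>x. x + x0) {x \<in> V. f x = 0} {x \<in> V. f x = y}"
      by (rule bij_betw_byWitness[where f' = "\<lambda>x. x - x0"]) (use x0 in \<open>auto simp: add fadd diff hom\<close>)
    thus ?thesis by (simp add: bij_betw_same_card)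
  qed
  have "card V = (\<Sum>x\<in>V. 1)" by simp
  also have "\<dots> = (\<Sum>y\<in>f ` V. \<Sum>x\<in>{x \<in> V. f x = y}. 1)"
    by (rule sum.image_gen[OF fin])
  also have "\<dots> = (\<Sum>y\<in>f ` V. card {x \<in> V. f x = 0})"
    by (rule sum.cong) (simp_all add: fib)
  finally show ?thesis by (simp add: mult.commute)
qed

text \<open>Families indexed by arrows are 0 off the arrow set, where \<open>PiE\<close> would have
  \<open>undefined\<close>, so that they can be subtracted pointwise. The bijection carries the
  counting and finiteness of \<open>PiE\<close> over to them.\<close>

lemma families_0_eq_PiE:
  fixes X :: "'b \<Rightarrow> 'c::zero set"
  shows "bij_betw (\<lambda>g a. if a \<in> A then g a else 0) (PiE A X)
           {g. (\<forall>a\<in>A. g a \<in> X a) \<and> (\<forall>a. a \<notin> A \<longrightarrow> g a = 0)}"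
  by (rule bij_betw_byWitness[where f' = "\<lambda>g. restrict g A"])
     (auto simp: fun_eq_iff PiE_iff extensional_def)

lemma card_families_0:
  fixes X :: "'b \<Rightarrow> 'c::zero set"
  assumes "finite A"
  shows "card {g. (\<forall>a\<in>A. g a \<in> X a) \<and> (\<forall>a. a \<notin> A \<longrightarrow> g a = 0)} = (\<Prod>a\<in>A. card (X a))"
  using bij_betw_same_card[OF families_0_eq_PiE[of A X]] card_PiE[OF assms, of X] by (simp only:)

lemma finite_families_0:
  fixes X :: "'b \<Rightarrow> 'c::zero set"
  assumes "finite A" "\<And>a. a \<in> A \<Longrightarrow> finite (X a)"
  shows "finite {g. (\<forall>a\<in>A. g a \<in> X a) \<and> (\<forall>a. a \<notin> A \<longrightarrow> g a = 0)}"
  using finite_PiE[OF assms] bij_betw_finite[OF families_0_eq_PiE[of A X]] by (simp only: simp_thms)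

section \<open>Finite subspaces and the linear maps between them\<close>

definition fsub :: "(nat \<Rightarrow> 'k::field) set \<Rightarrow> bool" where
  "fsub V \<longleftrightarrow> vs.subspace V \<and> finite V"

lemma fsubD: "fsub V \<Longrightarrow> vs.subspace V" "fsub V \<Longrightarrow> finite V"
  by (auto simp: fsub_def)

lemma fsub_0: "fsub V \<Longrightarrow> 0 \<in> V"
  by (simp add: fsub_def vs.subspace_0)

lemma fsub_subspace: "fsub V \<Longrightarrow> vs.subspace U \<Longrightarrow> U \<subseteq> V \<Longrightarrow> fsub U"
  by (auto simp: fsub_def intro: finite_subset)

lemma fsub_zero: "fsub {0}"
  by (simp add: fsub_def vs.subspace_single_0)

lemma finite_span:
  fixes S :: "(nat \<Rightarrow> 'k::{field,finite}) set"
  assumes "finite S"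
  shows "finite (vs.span S)"
proof -
  have "vs.span S \<subseteq> (\<lambda>u. \<Sum>v\<in>S. vscale (u v) v) ` (PiE S (\<lambda>_. UNIV))"
  proof
    fix x assume "x \<in> vs.span S"
    then obtain u where "x = (\<Sum>v\<in>S. vscale (u v) v)"
      using vs.span_finite[OF assms] by auto
    hence "x = (\<lambda>u. \<Sum>v\<in>S. vscale (u v) v) (restrict u S)" by simp
    thus "x \<in> (\<lambda>u. \<Sum>v\<in>S. vscale (u v) v) ` (PiE S (\<lambda>_. UNIV))"
      by (intro image_eqI[where x = "restrict u S"]) simp_all
  qed
  thus ?thesis by (rule finite_subset) (simp add: finite_PiE assms)
qed

lemma fd_space_iff_fsub:
  fixes V :: "(nat \<Rightarrow> 'k::{field,finite}) set"
  shows "fd_space V \<longleftrightarrow> fsub V"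
proof
  show "fd_space V \<Longrightarrow> fsub V" by (auto simp: fd_space_def fsub_def finite_span)
  assume "fsub V"
  hence "finite V" "V = vs.span V" by (auto simp: fsub_def simp del: vs.span_eq_iff simp: vs.span_eq_iff[THEN iffD2])
  thus "fd_space V" unfolding fd_space_def by blast
qed

lemma fsub_extend_basis:
  fixes V :: "(nat \<Rightarrow> 'k::field) set"
  assumes "fsub V" "S \<subseteq> V" "vs.independent S"
  obtains B where "S \<subseteq> B" "B \<subseteq> V" "vs.independent B" "vs.span B = V" "finite B" "card B = vs.dim V"
proof -
  obtain B where B: "S \<subseteq> B" "B \<subseteq> V" "vs.independent B" "V \<subseteq> vs.span B"
    using vs.maximal_independent_subset_extend[OF assms(2,3)] .
  have "vs.span B = V" using B assms(1) by (metis fsubD(1) subset_antisym vs.span_minimal)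
  moreover have "finite B" using B assms(1) finite_subset fsubD(2) by blast
  moreover have "card B = vs.dim V" using B by (simp add: vs.basis_card_eq_dim)
  ultimately show ?thesis using B that by blast
qed

lemma fsub_basis:
  fixes V :: "(nat \<Rightarrow> 'k::field) set"
  assumes "fsub V"
  obtains B where "B \<subseteq> V" "vs.independent B" "vs.span B = V" "finite B" "card B = vs.dim V"
  using fsub_extend_basis[OF assms empty_subsetI vs.independent_empty] that by metis

text \<open>These are the maps from the quotient V / U to W, written without forming the quotient.
  The value 0 outside V makes each map a unique function, which the counting requires.\<close>

definition lin_maps :: "(nat \<Rightarrow> 'k::field) set \<Rightarrow> (nat \<Rightarrow> 'k) set \<Rightarrow> (nat \<Rightarrow> 'k) set
    \<Rightarrow> ((nat \<Rightarrow> 'k) \<Rightarrow> nat \<Rightarrow> 'k) set" where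
  "lin_maps U V W = {f. linear_between V W f \<and> (\<forall>x. x \<notin> V \<longrightarrow> f x = 0) \<and> (\<forall>x\<in>U. f x = 0)}"

lemma linear_between_0: "fsub V \<Longrightarrow> linear_between V W f \<Longrightarrow> f 0 = 0"
proof -
  assume "fsub V" "linear_between V W f"
  hence "f (vscale 0 0) = vscale 0 (f 0)"
    using fsub_0 unfolding linear_between_def by blast
  thus ?thesis by (simp only: vs.scale_zero_left)
qed

lemma linear_between_diff:
  assumes "fsub V" "linear_between V W f" "x \<in> V" "y \<in> V"
  shows "f (x - y) = f x - f y"
proof -
  have "x - y \<in> V" using assms vs.subspace_diff fsubD by metis
  hence "f (x - y + y) = f (x - y) + f y" using assms unfolding linear_between_def by blast
  thus ?thesis by simp
qed

lemma linear_between_sum: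
  assumes "fsub V" "linear_between V W f" "finite I" "\<And>i. i \<in> I \<Longrightarrow> x i \<in> V"
  shows "f (\<Sum>i\<in>I. vscale (c i) (x i)) = (\<Sum>i\<in>I. vscale (c i) (f (x i)))"
  using assms(3,4)
proof (induction I rule: finite_induct)
  case empty
  show ?case using linear_between_0[OF assms(1,2)] by (simp only: sum.empty)
next
  case (insert i I)
  have "vscale (c i) (x i) \<in> V" "(\<Sum>i\<in>I. vscale (c i) (x i)) \<in> V"
    using insert assms(1) by (auto simp: fsub_def intro!: vs.subspace_scale vs.subspace_sum)
  hence "f (vscale (c i) (x i) + (\<Sum>i\<in>I. vscale (c i) (x i))) =
      vscale (c i) (f (x i)) + f (\<Sum>i\<in>I. vscale (c i) (x i))"
    using insert.prems assms(2) unfolding linear_between_def by (metis insertI1)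
  thus ?case using insert by (simp only: sum.insert insert_iff simp_thms)
qed

lemma linear_between_eqI:
  assumes "fsub V" "linear_between V W f" "linear_between V W g" "vs.span B = V" "finite B"
    and "\<And>b. b \<in> B \<Longrightarrow> f b = g b" "x \<in> V"
  shows "f x = g x"
proof -
  obtain u where u: "x = (\<Sum>b\<in>B. vscale (u b) b)"
    using vs.span_finite[OF assms(5)] assms(4,7) by auto
  have BV: "b \<in> B \<Longrightarrow> b \<in> V" for b using assms(4) vs.span_base by auto
  show ?thesis
    unfolding u using linear_between_sum[OF assms(1,2) assms(5) BV] linear_between_sum[OF assms(1,3) assms(5) BV]
      assms(6) by simp
qed

lemma lin_maps_extend:
  fixes h :: "(nat \<Rightarrow> 'k::field) \<Rightarrow> nat \<Rightarrow> 'k"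
  assumes "fsub V" "fsub W" "vs.independent B" "vs.span B = V" "\<And>b. b \<in> B \<Longrightarrow> h b \<in> W"
  obtains f where "linear_between V W f" "\<And>x. x \<notin> V \<Longrightarrow> f x = 0" "\<And>b. b \<in> B \<Longrightarrow> f b = h b"
proof -
  obtain g where g: "Vector_Spaces.linear vscale vscale g" "\<forall>x\<in>B. g x = h x" "range g = vs.span (h ` B)"
    using vsp.linear_independent_extend_subspace[OF assms(3)] by blast
  interpret g: Vector_Spaces.linear vscale vscale g by fact
  have "h ` B \<subseteq> W" using assms(5) by blast
  hence sub: "range g \<subseteq> W" unfolding g(3) using assms(2) by (metis fsubD(1) vs.span_minimal)
  have V: "x + y \<in> V" "vscale c x \<in> V" if "x \<in> V" "y \<in> V" for x y c
    using that assms(1) by (auto simp: fsub_def vs.subspace_add vs.subspace_scale)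
  show ?thesis
  proof (rule that[of "\<lambda>x. if x \<in> V then g x else 0"])
    show "linear_between V W (\<lambda>x. if x \<in> V then g x else 0)"
      using sub V unfolding linear_between_def by (auto simp: g.add g.scale)
    show "(if b \<in> V then g b else 0) = h b" if "b \<in> B" for b
      using that g(2) assms(4) vs.span_base by auto
  qed auto
qed

lemma card_fsub:
  fixes V :: "(nat \<Rightarrow> 'k::{field,finite}) set"
  shows "fsub V \<Longrightarrow> card V = CARD('k) ^ vs.dim V"
  by (simp add: fsub_def vs.card_finite_subspace)

lemma CARD_field_gt_1: "CARD('k::{field,finite}) > 1"
proof -
  have "card {0, 1::'k} \<le> CARD('k)" by (rule card_mono) auto
  thus ?thesis by simp
qed

text \<open>A basis of U is extended to one of V; a map is determined by its arbitrary values on the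
  added basis vectors.\<close>

lemma card_lin_maps:
  fixes V W U :: "(nat \<Rightarrow> 'k::{field,finite}) set"
  assumes V: "fsub V" and W: "fsub W" and U: "vs.subspace U" "U \<subseteq> V"
  shows "card (lin_maps U V W) = card W ^ (vs.dim V - vs.dim U)"
proof -
  obtain B1 where B1: "B1 \<subseteq> U" "vs.independent B1" "vs.span B1 = U" "finite B1" "card B1 = vs.dim U"
    using fsub_basis[OF fsub_subspace[OF V U]] .
  obtain B where B: "B1 \<subseteq> B" "B \<subseteq> V" "vs.independent B" "vs.span B = V" "finite B" "card B = vs.dim V"
    using fsub_extend_basis[OF V _ B1(2)] B1(1) U(2) by blast
  have fU: "fsub U" using fsub_subspace[OF V U] .
  have "bij_betw (\<lambda>f. restrict f (B - B1)) (lin_maps U V W) (PiE (B - B1) (\<lambda>_. W))"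
    unfolding bij_betw_def
  proof
    show "inj_on (\<lambda>f. restrict f (B - B1)) (lin_maps U V W)"
    proof (rule inj_onI)
      fix f g assume f: "f \<in> lin_maps U V W" and g: "g \<in> lin_maps U V W"
        and eq: "restrict f (B - B1) = restrict g (B - B1)"
      have "f b = g b" if "b \<in> B" for b
      proof (cases "b \<in> B1")
        case True
        thus ?thesis using f g B1(1) unfolding lin_maps_def by auto
      next
        case False
        thus ?thesis using eq that by (metis Diff_iff restrict_apply')
      qed
      hence "f x = g x" if "x \<in> V" for x
        using linear_between_eqI[OF V, of W f g B x] f g B(4,5) that unfolding lin_maps_def by blast
      thus "f = g" using f g unfolding lin_maps_def fun_eq_iff by (metis (mono_tags, lifting) mem_Collect_eq)
    qed
    show "(\<lambda>f. restrict f (B - B1)) ` lin_maps U V W = PiE (B - B1) (\<lambda>_. W)"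
    proof
      show "(\<lambda>f. restrict f (B - B1)) ` lin_maps U V W \<subseteq> PiE (B - B1) (\<lambda>_. W)"
        using B(2) unfolding lin_maps_def linear_between_def by (auto simp: image_subset_iff subset_iff)
      show "PiE (B - B1) (\<lambda>_. W) \<subseteq> (\<lambda>f. restrict f (B - B1)) ` lin_maps U V W"
      proof
        fix h assume h: "h \<in> PiE (B - B1) (\<lambda>_. W)"
        obtain f where f: "linear_between V W f" "\<And>x. x \<notin> V \<Longrightarrow> f x = 0"
            "\<And>b. b \<in> B \<Longrightarrow> f b = (if b \<in> B1 then 0 else h b)"
        proof (rule lin_maps_extend[OF V W B(3,4), of "\<lambda>b. if b \<in> B1 then 0 else h b"])
          show "(if b \<in> B1 then 0 else h b) \<in> W" if "b \<in> B" for b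
            using h fsub_0[OF W] that by auto
        qed blast
        have lU: "linear_between U W f"
          using f(1) U(2) unfolding linear_between_def by blast
        have l0: "linear_between U W (\<lambda>_. 0)"
          using fsub_0[OF W] unfolding linear_between_def by auto
        have "f x = 0" if "x \<in> U" for x
        proof (rule linear_between_eqI[OF fU lU l0 B1(3,4) _ that])
          show "f b = 0" if "b \<in> B1" for b using f(3)[of b] B(1) that by auto
        qed
        hence "f \<in> lin_maps U V W" using f unfolding lin_maps_def by auto
        moreover have "restrict f (B - B1) = h"
          using h f(3) by (intro PiE_ext[OF _ h]) auto
        ultimately show "h \<in> (\<lambda>f. restrict f (B - B1)) ` lin_maps U V W" by blast
      qed
    qed
  qed
  hence "card (lin_maps U V W) = card W ^ card (B - B1)"
    using B(5) by (simp add: bij_betw_same_card card_PiE)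
  also have "card (B - B1) = vs.dim V - vs.dim U"
    using B B1 by (simp add: card_Diff_subset)
  finally show ?thesis .
qed

lemma finite_lin_maps:
  fixes V W U :: "(nat \<Rightarrow> 'k::{field,finite}) set"
  assumes "fsub V" "fsub W" "vs.subspace U" "U \<subseteq> V"
  shows "finite (lin_maps U V W)"
proof -
  have "card W > 0" using fsub_0[OF assms(2)] fsubD(2)[OF assms(2)] card_gt_0_iff by blast
  hence "card (lin_maps U V W) > 0" by (simp add: card_lin_maps[OF assms])
  thus ?thesis by (rule card_ge_0_finite)
qed

lemma fsub_dim_mono: "fsub V \<Longrightarrow> U \<subseteq> V \<Longrightarrow> vs.subspace U \<Longrightarrow> vs.dim U \<le> vs.dim V"
proof -
  assume V: "fsub V" and U: "U \<subseteq> V" "vs.subspace U"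
  obtain B1 where B1: "B1 \<subseteq> U" "vs.independent B1" "vs.span B1 = U" "finite B1" "card B1 = vs.dim U"
    using fsub_basis[OF fsub_subspace[OF V U(2,1)]] .
  obtain B where B: "B1 \<subseteq> B" "B \<subseteq> V" "vs.independent B" "vs.span B = V" "finite B" "card B = vs.dim V"
    using fsub_extend_basis[OF V _ B1(2)] B1(1) U(1) by blast
  thus ?thesis using B1 by (metis card_mono)
qed

lemma lin_maps_diff:
  assumes "fsub X" "fsub Y" "f \<in> lin_maps U X Y" "g \<in> lin_maps U X Y"
  shows "f - g \<in> lin_maps U X Y"
proof -
  have Ys: "vs.subspace Y" using assms fsubD by blast
  have "linear_between X Y (f - g)"
    unfolding linear_between_def
  proof (intro conjI ballI allI)
    show "(f - g) ` X \<subseteq> Y"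
      using assms(3,4) vs.subspace_diff[OF Ys] unfolding lin_maps_def linear_between_def
      by (auto simp: image_subset_iff)
    show "(f - g) (x + y) = (f - g) x + (f - g) y" if "x \<in> X" "y \<in> X" for x y
      using assms(3,4) that unfolding lin_maps_def linear_between_def by (simp add: algebra_simps)
    show "(f - g) (vscale c x) = vscale c ((f - g) x)" if "x \<in> X" for x c
      using assms(3,4) that unfolding lin_maps_def linear_between_def
      by (simp add: vs.scale_right_diff_distrib)
  qed
  thus ?thesis using assms(3,4) unfolding lin_maps_def by simp
qed

section \<open>Traces and the Fourier expansion of an incidence condition\<close>

definition trace_on :: "(nat \<Rightarrow> 'k::field) set \<Rightarrow> ((nat \<Rightarrow> 'k) \<Rightarrow> nat \<Rightarrow> 'k) \<Rightarrow> 'k" where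
  "trace_on V T = (let B = (SOME B. vs.independent B \<and> vs.span B = V)
     in \<Sum>b\<in>B. vs.representation B (T b) b)"

lemma finite_basis_fsub:
  "fsub V \<Longrightarrow> vs.span B = V \<Longrightarrow> finite B"
  using vs.span_superset finite_subset fsubD(2) by metis

text \<open>The argument behind tr(XY) = tr(YX): each b is expanded in the basis C, the two sums are
  exchanged, and the coefficients recombine to the diagonal entries with respect to C.\<close>

lemma sum_representation_basis_indep:
  fixes V :: "(nat \<Rightarrow> 'k::field) set"
  assumes V: "fsub V" and T: "linear_between V V T"
    and B: "vs.independent B" "vs.span B = V" and C: "vs.independent C" "vs.span C = V"
  shows "(\<Sum>b\<in>B. vs.representation B (T b) b) = (\<Sum>c\<in>C. vs.representation C (T c) c)"
proof -
  have fin: "finite B" "finite C" using finite_basis_fsub V B C by auto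
  have BV: "b \<in> B \<Longrightarrow> b \<in> V" and CV: "c \<in> C \<Longrightarrow> c \<in> V" for b c
    using B C vs.span_base by auto
  have TV: "x \<in> V \<Longrightarrow> T x \<in> V" for x using T unfolding linear_between_def by auto
  have e: "vs.representation B (T b) b = (\<Sum>c\<in>C. vs.representation C b c * vs.representation B (T c) b)"
    if "b \<in> B" for b
  proof -
    have "T (\<Sum>c\<in>C. vscale (vs.representation C b c) c) = (\<Sum>c\<in>C. vscale (vs.representation C b c) (T c))"
      by (rule linear_between_sum[OF V T fin(2)]) (rule CV)
    hence Tb: "T b = (\<Sum>c\<in>C. vscale (vs.representation C b c) (T c))"
      using vs.sum_representation_eq[OF C(1) _ fin(2) subset_refl, of b] BV[OF that] C(2) by (simp only:)
    have "vs.representation B (T b) b = (\<Sum>c\<in>C. vs.representation B (vscale (vs.representation C b c) (T c)) b)"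
      unfolding Tb using B TV CV by (subst vs.representation_sum) (auto intro!: vs.span_scale)
    also have "\<dots> = (\<Sum>c\<in>C. vs.representation C b c * vs.representation B (T c) b)"
      using B TV CV by (intro sum.cong refl) (simp add: vs.representation_scale)
    finally show ?thesis .
  qed
  have "(\<Sum>b\<in>B. vs.representation B (T b) b)
      = (\<Sum>c\<in>C. \<Sum>b\<in>B. vs.representation B (T c) b * vs.representation C b c)"
    by (subst sum.swap) (simp add: e mult.commute)
  also have "\<dots> = (\<Sum>c\<in>C. vs.representation C (\<Sum>b\<in>B. vscale (vs.representation B (T c) b) b) c)"
  proof (rule sum.cong[OF refl])
    fix c assume "c \<in> C"
    have "vs.representation C (\<Sum>b\<in>B. vscale (vs.representation B (T c) b) b) c
        = (\<Sum>b\<in>B. vs.representation C (vscale (vs.representation B (T c) b) b) c)"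
      using C BV vs.span_scale by (subst vs.representation_sum) auto
    also have "\<dots> = (\<Sum>b\<in>B. vs.representation B (T c) b * vs.representation C b c)"
      using C BV by (intro sum.cong refl) (simp add: vs.representation_scale)
    finally show "(\<Sum>b\<in>B. vs.representation B (T c) b * vs.representation C b c)
      = vs.representation C (\<Sum>b\<in>B. vscale (vs.representation B (T c) b) b) c" by simp
  qed
  also have "\<dots> = (\<Sum>c\<in>C. vs.representation C (T c) c)"
    using vs.sum_representation_eq[OF B(1) _ fin(1) subset_refl] B(2) TV CV
    by (intro sum.cong refl) simp
  finally show ?thesis .
qed

lemma trace_on_basis:
  assumes "fsub V" "linear_between V V T" "vs.independent C" "vs.span C = V"
  shows "trace_on V T = (\<Sum>c\<in>C. vs.representation C (T c) c)"
proof -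
  define B where "B = (SOME B. vs.independent B \<and> vs.span B = V)"
  have "vs.independent B \<and> vs.span B = V"
    unfolding B_def by (rule someI[of _ C]) (use assms in simp)
  thus ?thesis
    using sum_representation_basis_indep[OF assms(1,2) _ _ assms(3,4), of B]
    unfolding trace_on_def B_def[symmetric] Let_def by blast
qed

text \<open>In a basis of V that extends one of U the diagonal of T vanishes: basis vectors in U are
  killed, and each of the others is sent into U, where its own coefficient is 0.\<close>

lemma trace_on_eq_0:
  fixes V :: "(nat \<Rightarrow> 'k::field) set"
  assumes V: "fsub V" and U: "vs.subspace U" "U \<subseteq> V" and T: "linear_between V U T"
    and ker: "\<And>x. x \<in> U \<Longrightarrow> T x = 0"
  shows "trace_on V T = 0"
proof -
  obtain B1 where B1: "B1 \<subseteq> U" "vs.independent B1" "vs.span B1 = U" "finite B1" "card B1 = vs.dim U"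
    using fsub_basis[OF fsub_subspace[OF V U]] .
  obtain B where B: "B1 \<subseteq> B" "B \<subseteq> V" "vs.independent B" "vs.span B = V" "finite B" "card B = vs.dim V"
    using fsub_extend_basis[OF V _ B1(2)] B1(1) U(2) by blast
  have T': "linear_between V V T" using T U unfolding linear_between_def by blast
  have "vs.representation B (T b) b = 0" if "b \<in> B" for b
  proof (cases "b \<in> B1")
    case True
    hence "T b = 0" using ker B1(1) by auto
    thus ?thesis by (simp only: vs.representation_zero)
  next
    case False
    have "T b \<in> vs.span B1" using T B B1(3) that unfolding linear_between_def by blast
    hence "vs.representation B (T b) = vs.representation B1 (T b)"
      by (intro vs.representation_extend[OF B(3) _ B(1)])
    thus ?thesis using False vs.representation_ne_zero by metis
  qed
  thus ?thesis by (simp add: trace_on_basis[OF V T' B(3,4)])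
qed

lemma linear_between_comp:
  "linear_between U V g \<Longrightarrow> linear_between V W f \<Longrightarrow> linear_between U W (f \<circ> g)"
  unfolding linear_between_def by (auto simp: image_subset_iff simp del: plus_fun_apply)

lemma trace_on_diff:
  assumes V: "fsub V" and T: "linear_between V V T" "linear_between V V T'" "linear_between V V S"
    and S: "\<And>x. x \<in> V \<Longrightarrow> S x = T x - T' x"
  shows "trace_on V S = trace_on V T - trace_on V T'"
proof -
  obtain B where B: "B \<subseteq> V" "vs.independent B" "vs.span B = V" "finite B" "card B = vs.dim V"
    using fsub_basis[OF V] .
  have TV: "x \<in> V \<Longrightarrow> T x \<in> V" "x \<in> V \<Longrightarrow> T' x \<in> V" for x
    using T unfolding linear_between_def by auto
  have "vs.representation B (S b) b = vs.representation B (T b) b - vs.representation B (T' b) b"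
    if "b \<in> B" for b
    using that B TV S by (subst S) (auto simp: vs.representation_diff)
  thus ?thesis using B T by (simp add: trace_on_basis[OF V _ B(2,3)] sum_subtractf)
qed

text \<open>The witness that the trace pairing detects a violated inclusion. As A x lies outside U,
  it can be joined to a basis of U and the result extended to a basis of V. The map g sends z to x,
  scaled by the coefficient of z at A x; it has rank one and kills U, and A x contributes the only
  nonzero diagonal entry of \<open>A \<circ> g\<close>, which is 1.\<close>

lemma lin_maps_trace_1:
  fixes V W :: "(nat \<Rightarrow> 'k::field) set"
  assumes V: "fsub V" and U: "vs.subspace U" "U \<subseteq> V" and W: "fsub W" 
    and A: "linear_between W V A" and x: "x \<in> W" "A x \<notin> U"
    and W': "vs.subspace W'" "W' \<subseteq> W" "x \<in> W'"
  obtains g where "g \<in> lin_maps U V W'" "trace_on V (A \<circ> g) = 1"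
proof -
  have AxV: "A x \<in> V" using A x unfolding linear_between_def by auto
  obtain B1 where B1: "B1 \<subseteq> U" "vs.independent B1" "vs.span B1 = U" "finite B1" "card B1 = vs.dim U"
    using fsub_basis[OF fsub_subspace[OF V U]] .
  have ind: "vs.independent (insert (A x) B1)"
    using B1 x(2) by (auto simp: vs.independent_insert)
  have sub: "insert (A x) B1 \<subseteq> V" using B1(1) U(2) AxV by blast
  obtain B where B: "insert (A x) B1 \<subseteq> B" "B \<subseteq> V" "vs.independent B" "vs.span B = V" "finite B"
      "card B = vs.dim V"
    using fsub_extend_basis[OF V sub ind] .
  let ?r = "\<lambda>z. vs.representation B z (A x)"
  define g where "g z = (if z \<in> V then vscale (?r z) x else 0)" for z
  have V2: "y + z \<in> V" "vscale c y \<in> V" if "y \<in> V" "z \<in> V" for y z c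
    using that V by (auto simp: fsub_def vs.subspace_add vs.subspace_scale)
  have W2: "vscale c x \<in> W'" for c using W' vs.subspace_scale by blast
  have lg: "linear_between V W' g"
    unfolding linear_between_def
  proof (intro conjI ballI allI)
    show "g ` V \<subseteq> W'" using W2 by (auto simp: g_def)
    show "g (y + z) = g y + g z" if "y \<in> V" "z \<in> V" for y z
      using that V2 B(3,4) by (simp add: g_def vs.representation_add vs.scale_left_distrib del: plus_fun_apply)
    show "g (vscale c y) = vscale c (g y)" if "y \<in> V" for y c
      using that V2 B(3,4) by (simp add: g_def vs.representation_scale)
  qed
  have U0: "g u = 0" if "u \<in> U" for u
  proof -
    have "vs.representation B u = vs.representation B1 u"
      using that B1(3) B(1) by (intro vs.representation_extend[OF B(3)]) auto
    moreover have "A x \<notin> B1" using B1(1) x(2) by auto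
    ultimately have "?r u = 0" using vs.representation_ne_zero by metis
    thus ?thesis by (simp only: g_def vs.scale_zero_left if_cancel)
  qed
  have g: "g \<in> lin_maps U V W'" using lg U0 by (auto simp: lin_maps_def g_def)
  have "linear_between V W g" using lg W' unfolding linear_between_def by blast
  hence lAg: "linear_between V V (A \<circ> g)" using A linear_between_comp by blast
  have "vs.representation B ((A \<circ> g) b) b = (if b = A x then 1 else 0)" if "b \<in> B" for b
  proof -
    have bV: "b \<in> V" using that B by auto
    have "?r b = (if b = A x then 1 else 0)"
      using vs.representation_basis[OF B(3) that] by auto
    moreover have "A (vscale c x) = vscale c (A x)" for c
      using A x(1) unfolding linear_between_def by blast
    moreover have "A x \<in> B" using B by auto
    ultimately show ?thesis
      using bV vs.representation_basis[OF B(3), of "A x"] by (auto simp: g_def vs.representation_zero)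
  qed
  hence "trace_on V (A \<circ> g) = (\<Sum>b\<in>B. if b = A x then 1 else 0)"
    by (simp add: trace_on_basis[OF V lAg B(3,4)])
  also have "\<dots> = 1" using B(1,5) by simp
  finally show ?thesis using g that by blast
qed

text \<open>This difference of indicators sums to \<open>0\<close> along every nonzero linear functional, as a nontrivial
  additive character would, but its values are integers, so that the coefficients stay in the coefficient ring.\<close>

definition theta :: "'k::field \<Rightarrow> real" where
  "theta y = of_bool (y = 0) - of_bool (y = 1)"

lemma theta_0 [simp]: "theta 0 = 1" by (simp add: theta_def)

text \<open>Translation by g maps the fibre of f over 0 bijectively onto the fibre over 1, so the
  two indicators in \<open>theta\<close> contribute equally and cancel.\<close>

lemma sum_theta_eq_0:
  fixes f :: "'x::ab_group_add \<Rightarrow> 'k::field"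
  assumes fin: "finite G"
    and diff: "\<And>x y. x \<in> G \<Longrightarrow> y \<in> G \<Longrightarrow> x - y \<in> G"
    and hom: "\<And>x y. x \<in> G \<Longrightarrow> y \<in> G \<Longrightarrow> f (x - y) = f x - f y"
    and g: "g \<in> G" "f g = 1"
  shows "(\<Sum>x\<in>G. theta (f x)) = 0"
proof -
  have z: "0 \<in> G" using diff[OF g(1) g(1)] by simp
  have neg: "- x \<in> G" if "x \<in> G" for x using diff[OF z that] by simp
  have add: "x + y \<in> G" if "x \<in> G" "y \<in> G" for x y
    using diff[OF that(1) neg[OF that(2)]] by simp
  have f0: "f 0 = 0" using hom[OF z z] by simp
  have fneg: "f (- x) = - f x" if "x \<in> G" for x using hom[OF z that] f0 by simp
  have fadd: "f (x + y) = f x + f y" if "x \<in> G" "y \<in> G" for x y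
    using hom[OF that(1) neg[OF that(2)]] fneg[OF that(2)] by simp
  have "bij_betw (\<lambda>x. x + g) {x \<in> G. f x = 0} {x \<in> G. f x = 1}"
    by (rule bij_betw_byWitness[where f' = "\<lambda>x. x - g"]) (use g in \<open>auto simp: add fadd diff hom\<close>)
  hence "card {x \<in> G. f x = 0} = card {x \<in> G. f x = 1}" by (rule bij_betw_same_card)
  thus ?thesis using fin by (simp add: theta_def sum_subtractf of_bool_def sum.If_cases Int_def)
qed

text \<open>The members of F are the spaces spanned by W and x + y with y in K0, and y matters only
  modulo W. So they are counted by K0 / W, and each is one dimension larger than W. This is the
  power of q in the Pascal-type recursion for q-binomials.\<close>

lemma subset_lines_fiber_card:
  fixes K0 :: "(nat \<Rightarrow> 'k::{field,finite}) set"
  assumes K0: "fsub K0" and W: "vs.subspace W" "W \<subseteq> K0" and x: "x \<notin> K0"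
  defines "F \<equiv> {U. vs.subspace U \<and> U \<subseteq> vs.span (insert x K0) \<and> U \<inter> K0 = W \<and> \<not> U \<subseteq> K0}"
  shows "card F = CARD('k) ^ (vs.dim K0 - vs.dim W)"
    and "U \<in> F \<Longrightarrow> vs.dim U = Suc (vs.dim W)"
    and "finite F"
proof -
  let ?L = "\<lambda>y. vs.span (insert (x + y) W)"
  have fW: "fsub W" using fsub_subspace[OF K0 W] .
  have K0s: "vs.subspace K0" using fsubD K0 by blast
  have spK0: "vs.span K0 = K0" using K0s by (simp add: vs.span_eq_iff)
  have spW: "vs.span W = W" using W by (simp add: vs.span_eq_iff)
  have xy: "x + y \<notin> K0" if "y \<in> K0" for y
    using x that vs.subspace_diff[OF K0s, of "x + y" y] by auto
  have mem: "z \<in> ?L y \<longleftrightarrow> (\<exists>c. z - vscale c (x + y) \<in> W)" for z y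
    by (simp add: vs.span_insert spW)
  have memK: "z \<in> vs.span (insert x K0) \<longleftrightarrow> (\<exists>c. z - vscale c x \<in> K0)" for z
    by (simp add: vs.span_insert spK0)
  have int: "?L y \<inter> K0 = W" if y: "y \<in> K0" for y
  proof
    show "W \<subseteq> ?L y \<inter> K0" using W(2) vs.span_superset by blast
    show "?L y \<inter> K0 \<subseteq> W"
    proof
      fix z assume z: "z \<in> ?L y \<inter> K0"
      then obtain c where c: "z - vscale c (x + y) \<in> W" using mem by auto
      have "vscale c (x + y) = z - (z - vscale c (x + y))" by simp
      also have "\<dots> \<in> K0" using z c W(2) K0s vs.subspace_diff by blast
      finally have cK: "vscale c (x + y) \<in> K0" .
      have "c = 0"
      proof (rule ccontr)
        assume "c \<noteq> 0"
        hence "x + y = vscale (inverse c) (vscale c (x + y))" by (simp add: vs.scale_scale)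
        also have "\<dots> \<in> K0" using cK K0s vs.subspace_scale by blast
        finally show False using xy[OF y] by simp
      qed
      thus "z \<in> W" using c by (simp add: vs.scale_zero_left)
    qed
  qed
  have LF: "?L y \<in> F" if y: "y \<in> K0" for y
  proof -
    have "x + y \<in> vs.span (insert x K0)"
      using y vs.span_add vs.span_base by (metis insertI1 insertI2)
    hence "?L y \<subseteq> vs.span (insert x K0)"
      using W(2) vs.span_superset by (intro vs.span_minimal) (auto intro: vs.span_base)
    moreover have "x + y \<in> ?L y" by (rule vs.span_base) simp
    ultimately show ?thesis unfolding F_def using int[OF y] xy[OF y] vs.subspace_span by blast
  qed
  have surj: "\<exists>y\<in>K0. U = ?L y" if U: "U \<in> F" for U
  proof -
    have Us: "vs.subspace U" and UK: "U \<inter> K0 = W" using U by (auto simp: F_def)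
    obtain u where u: "u \<in> U" "u \<notin> K0" using U by (auto simp: F_def)
    obtain c where c: "u - vscale c x \<in> K0" using u U memK unfolding F_def by blast
    have c0: "c \<noteq> 0" using c u by (auto simp: vs.scale_zero_left)
    \<comment> \<open>A vector u of U outside K0 has a nonzero coefficient c at x; rescaling u to
      coefficient 1 gives x + y with y in K0.\<close>
    define y where "y = vscale (inverse c) (u - vscale c x)"
    have y: "y \<in> K0" using c K0s vs.subspace_scale unfolding y_def by blast
    have "x + y = vscale (inverse c) u"
      using c0 by (simp add: y_def vs.scale_right_diff_distrib vs.scale_scale)
    hence xyU: "x + y \<in> U" using u Us vs.subspace_scale by metis
    have "?L y \<subseteq> U" using xyU UK Us by (intro vs.span_minimal) auto
    moreover have "U \<subseteq> ?L y"
    proof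
      fix z assume z: "z \<in> U"
      obtain d where d: "z - vscale d x \<in> K0" using z U memK unfolding F_def by blast
      have "z - vscale d (x + y) = (z - vscale d x) - vscale d y"
        by (simp add: vs.scale_right_distrib)
      also have "\<dots> \<in> K0" using d y K0s vs.subspace_scale vs.subspace_diff by blast
      finally have "z - vscale d (x + y) \<in> K0" .
      moreover have "z - vscale d (x + y) \<in> U" using z xyU Us vs.subspace_scale vs.subspace_diff by blast
      ultimately show "z \<in> ?L y" using UK mem by blast
    qed
    ultimately show ?thesis using y by blast
  qed
  have F_eq: "F = ?L ` K0" using LF surj by blast
  thus finF: "finite F" using K0 fsubD by blast
  have fib: "{y \<in> K0. ?L y = ?L y0} = (\<lambda>w. w + y0) ` W" if y0: "y0 \<in> K0" for y0
  proof
    show "{y \<in> K0. ?L y = ?L y0} \<subseteq> (\<lambda>w. w + y0) ` W"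
    proof
      fix y assume y: "y \<in> {y \<in> K0. ?L y = ?L y0}"
      have "x + y \<in> ?L y" "x + y0 \<in> ?L y0" by (auto intro: vs.span_base)
      hence "(x + y) - (x + y0) \<in> ?L y0" using y vs.span_diff by fastforce
      moreover have "(x + y) - (x + y0) = y - y0" by simp
      moreover have "y - y0 \<in> K0" using y y0 K0s vs.subspace_diff by blast
      ultimately have "y - y0 \<in> W" using int[OF y0] by auto
      thus "y \<in> (\<lambda>w. w + y0) ` W" by (intro image_eqI[of _ _ "y - y0"]) simp_all
    qed
    show "(\<lambda>w. w + y0) ` W \<subseteq> {y \<in> K0. ?L y = ?L y0}"
    proof safe
      fix w assume w: "w \<in> W"
      show wK: "w + y0 \<in> K0" using w W(2) y0 K0s vs.subspace_add by blast
      have "x + (w + y0) = (x + y0) + w" by (simp add: ac_simps)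
      also have "\<dots> \<in> ?L y0" by (intro vs.span_add vs.span_base) (use w in auto)
      finally have 1: "?L (w + y0) \<subseteq> ?L y0"
        using vs.span_superset by (intro vs.span_minimal) (auto intro: vs.span_base)
      have "x + y0 = (x + (w + y0)) - w" by simp
      also have "\<dots> \<in> ?L (w + y0)" by (intro vs.span_diff vs.span_base) (use w in auto)
      finally have 2: "?L y0 \<subseteq> ?L (w + y0)"
        using vs.span_superset by (intro vs.span_minimal) (auto intro: vs.span_base)
      show "z \<in> ?L y0" if "z \<in> ?L (w + y0)" for z using 1 that by blast
      show "z \<in> ?L (w + y0)" if "z \<in> ?L y0" for z using 2 that by blast
    qed
  qed
  have q1: "CARD('k) > 1" by (rule CARD_field_gt_1)
  have dW: "vs.dim W \<le> vs.dim K0" by (rule fsub_dim_mono[OF K0 W(2,1)])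
  have "card K0 = (\<Sum>y\<in>K0. 1)" by simp
  also have "\<dots> = (\<Sum>U\<in>?L ` K0. \<Sum>y\<in>{y \<in> K0. ?L y = U}. 1)"
    by (rule sum.image_gen) (use K0 fsubD in blast)
  also have "\<dots> = (\<Sum>U\<in>?L ` K0. card W)"
  proof (rule sum.cong[OF refl])
    fix U assume "U \<in> ?L ` K0"
    then obtain y0 where y0: "y0 \<in> K0" "U = ?L y0" by auto
    have "card ((\<lambda>w. w + y0) ` W) = card W" by (rule card_image) (simp add: inj_on_def)
    thus "(\<Sum>y\<in>{y \<in> K0. ?L y = U}. 1) = card W" using fib[OF y0(1)] y0(2) by simp
  qed
  also have "\<dots> = card F * card W" by (simp add: F_eq)
  finally have "CARD('k) ^ vs.dim K0 = card F * CARD('k) ^ vs.dim W"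
    by (simp add: card_fsub K0 fW)
  moreover have "CARD('k) ^ vs.dim K0 = CARD('k) ^ (vs.dim K0 - vs.dim W) * CARD('k) ^ vs.dim W"
    using dW by (simp flip: power_add)
  ultimately show "card F = CARD('k) ^ (vs.dim K0 - vs.dim W)" using q1 by simp
  show "vs.dim U = Suc (vs.dim W)" if U: "U \<in> F"
  proof -
    obtain y where y: "y \<in> K0" "U = ?L y" using surj[OF U] by blast
    obtain B1 where B1: "B1 \<subseteq> W" "vs.independent B1" "vs.span B1 = W" "finite B1" "card B1 = vs.dim W"
      using fsub_basis[OF fW] .
    have nW: "x + y \<notin> W" using xy[OF y(1)] W(2) by blast
    have "vs.independent (insert (x + y) B1)" using B1 nW by (auto simp: vs.independent_insert)
    moreover have "vs.span (insert (x + y) B1) = U"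
      unfolding y(2) vs.span_insert B1(3) spW ..
    ultimately have "vs.dim U = card (insert (x + y) B1)"
      using vs.dim_span_eq_card_independent by metis
    thus ?thesis using B1 nW by (metis card_insert_disjoint subsetD)
  qed
qed

section \<open>Subrepresentations and maps in the opposite direction\<close>

text \<open>Its entry at (i, j) counts the arrows from i to j, so that
  \<open>mat 1 - A_mat Q\<close> is the matrix of the Euler form.\<close>

abbreviation A_mat :: "('n::finite, 'a) pre_digraph \<Rightarrow> int ^ 'n ^ 'n" where
  "A_mat Q \<equiv> transpose (R_mat Q)"

lemma card_filter_eq_sum: "finite A \<Longrightarrow> int (card {a \<in> A. P a}) = (\<Sum>a\<in>A. of_bool (P a))"
  by (simp add: of_bool_def sum.If_cases Int_def)

lemma sum_of_bool_eq_mult: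
  fixes f :: "'n::finite \<Rightarrow> int"
  shows "(\<Sum>i\<in>UNIV. of_bool (j = i) * f i) = f j"
proof -
  have "(\<Sum>i\<in>UNIV. of_bool (j = i) * f i) = (\<Sum>i\<in>UNIV. if j = i then f i else 0)"
    by (rule sum.cong) (auto simp: of_bool_def)
  thus ?thesis by simp
qed

lemma A_mat_entry:
  assumes "finite (arcs Q)"
  shows "A_mat Q $ i $ j = (\<Sum>a\<in>arcs Q. of_bool (tail Q a = i) * of_bool (head Q a = j))"
  using assms by (simp add: transpose_def R_mat_def arrow_count_def card_filter_eq_sum of_bool_conj)

lemma form_A_mat:
  assumes "finite (arcs Q)"
  shows "form (A_mat Q) x y = (\<Sum>a\<in>arcs Q. x $ tail Q a * y $ head Q a)"
proof -
  have "form (A_mat Q) x y =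
    (\<Sum>i\<in>UNIV. \<Sum>j\<in>UNIV. \<Sum>a\<in>arcs Q. of_bool (tail Q a = i) * (of_bool (head Q a = j) * (x $ i * y $ j)))"
    unfolding form_def A_mat_entry[OF assms]
    by (intro sum.cong refl) (simp add: sum_distrib_left sum_distrib_right mult_ac)
  also have "\<dots> = (\<Sum>i\<in>UNIV. \<Sum>a\<in>arcs Q. \<Sum>j\<in>UNIV. of_bool (tail Q a = i) * (of_bool (head Q a = j) * (x $ i * y $ j)))"
    by (intro sum.cong refl sum.swap)
  also have "\<dots> = (\<Sum>a\<in>arcs Q. \<Sum>i\<in>UNIV. \<Sum>j\<in>UNIV. of_bool (tail Q a = i) * (of_bool (head Q a = j) * (x $ i * y $ j)))"
    by (rule sum.swap)
  also have "\<dots> = (\<Sum>a\<in>arcs Q. x $ tail Q a * y $ head Q a)"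
    by (intro sum.cong refl) (simp add: sum_of_bool_eq_mult flip: sum_distrib_left)
  finally show ?thesis .
qed

lemma A_mat_mult_vec:
  assumes "finite (arcs Q)"
  shows "(A_mat Q *v y) $ i = (\<Sum>a\<in>{a \<in> arcs Q. tail Q a = i}. y $ head Q a)"
proof -
  have "(A_mat Q *v y) $ i = (\<Sum>j\<in>UNIV. \<Sum>a\<in>arcs Q. of_bool (head Q a = j) * (of_bool (tail Q a = i) * y $ j))"
    unfolding matrix_vector_mult_def A_mat_entry[OF assms] vec_lambda_beta
    by (intro sum.cong refl) (simp add: sum_distrib_left sum_distrib_right mult_ac)
  also have "\<dots> = (\<Sum>a\<in>arcs Q. \<Sum>j\<in>UNIV. of_bool (head Q a = j) * (of_bool (tail Q a = i) * y $ j))"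
    by (rule sum.swap)
  also have "\<dots> = (\<Sum>a\<in>arcs Q. if tail Q a = i then y $ head Q a else 0)"
    by (intro sum.cong refl) (simp add: sum_of_bool_eq_mult)
  also have "\<dots> = (\<Sum>a\<in>{a \<in> arcs Q. tail Q a = i}. y $ head Q a)"
    by (simp add: sum.If_cases assms Int_def)
  finally show ?thesis .
qed

lemma R_mat_mult_vec:
  assumes "finite (arcs Q)"
  shows "(R_mat Q *v y) $ i = (\<Sum>a\<in>{a \<in> arcs Q. head Q a = i}. y $ tail Q a)"
proof -
  have "(R_mat Q *v y) $ i = (\<Sum>j\<in>UNIV. A_mat Q $ j $ i * y $ j)"
    unfolding matrix_vector_mult_def by (simp add: transpose_def)
  also have "\<dots> = (\<Sum>j\<in>UNIV. \<Sum>a\<in>arcs Q. of_bool (tail Q a = j) * (of_bool (head Q a = i) * y $ j))"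
    unfolding A_mat_entry[OF assms]
    by (intro sum.cong refl) (simp add: sum_distrib_left sum_distrib_right mult_ac)
  also have "\<dots> = (\<Sum>a\<in>arcs Q. \<Sum>j\<in>UNIV. of_bool (tail Q a = j) * (of_bool (head Q a = i) * y $ j))"
    by (rule sum.swap)
  also have "\<dots> = (\<Sum>a\<in>arcs Q. if head Q a = i then y $ tail Q a else 0)"
    by (intro sum.cong refl) (simp add: sum_of_bool_eq_mult)
  also have "\<dots> = (\<Sum>a\<in>{a \<in> arcs Q. head Q a = i}. y $ tail Q a)"
    by (simp add: sum.If_cases assms Int_def)
  finally show ?thesis .
qed

lemma finite_families:
  fixes X :: "'n::finite \<Rightarrow> 'c set"
  assumes "\<And>i. finite (X i)"
  shows "finite {U. \<forall>i. U i \<in> X i}"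
proof -
  have "{U. \<forall>i. U i \<in> X i} = PiE UNIV X" by (auto simp: PiE_iff)
  thus ?thesis using assms by (simp add: finite_PiE)
qed

locale quiver_rep = fin_digraph Q for Q :: "('n::finite, 'a) pre_digraph" +
  fixes M :: "('n, 'a, 'k::{field,finite}) qrep"
  assumes rep: "M \<in> reps Q"
begin

abbreviation "V \<equiv> vsp M"
abbreviation "dV i \<equiv> vs.dim (V i)"

lemma fsub_V: "fsub (V i)"
  using rep by (simp add: reps_def flip: fd_space_iff_fsub)

lemma linear_vmap: "a \<in> arcs Q \<Longrightarrow> linear_between (V (tail Q a)) (V (head Q a)) (vmap M a)"
  using rep by (simp add: reps_def)

definition subfam :: "('n \<Rightarrow> (nat \<Rightarrow> 'k) set) set" where
  "subfam = {U. \<forall>i. vs.subspace (U i) \<and> U i \<subseteq> V i}"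

lemma finite_subfam: "finite subfam"
proof (rule finite_subset)
  show "subfam \<subseteq> {U. \<forall>i. U i \<in> Pow (V i)}" by (auto simp: subfam_def)
  show "finite {U. \<forall>i. U i \<in> Pow (V i)}" using fsubD(2)[OF fsub_V] by (intro finite_families) simp
qed

lemma subfam_fsub: "U \<in> subfam \<Longrightarrow> fsub (U i)"
  using fsub_subspace[OF fsub_V, of "U i" i] by (auto simp: subfam_def)

lemma subfam_dim_le: "U \<in> subfam \<Longrightarrow> vs.dim (U i) \<le> dV i"
  using fsub_dim_mono[OF fsub_V] by (auto simp: subfam_def)

definition opmaps :: "('a \<Rightarrow> (nat \<Rightarrow> 'k) \<Rightarrow> nat \<Rightarrow> 'k) set" where
  "opmaps = {g. (\<forall>a\<in>arcs Q. g a \<in> lin_maps {0} (V (head Q a)) (V (tail Q a))) \<and> (\<forall>a. a \<notin> arcs Q \<longrightarrow> g a = 0)}"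

text \<open>The obstruction to U being stable under an arrow a is the map from U_tail to V_head /
  U_head induced by \<open>vmap M a\<close>. The maps V_head / U_head --> U_tail collected here form
  the dual space of such obstructions under the trace.\<close>

definition opmaps_at :: "('n \<Rightarrow> (nat \<Rightarrow> 'k) set) \<Rightarrow> ('a \<Rightarrow> (nat \<Rightarrow> 'k) \<Rightarrow> nat \<Rightarrow> 'k) set" where
  "opmaps_at U = {g. (\<forall>a\<in>arcs Q. g a \<in> lin_maps (U (head Q a)) (V (head Q a)) (U (tail Q a))) \<and>
     (\<forall>a. a \<notin> arcs Q \<longrightarrow> g a = 0)}"

definition pairing :: "('a \<Rightarrow> (nat \<Rightarrow> 'k) \<Rightarrow> nat \<Rightarrow> 'k) \<Rightarrow> 'k" where
  "pairing g = (\<Sum>a\<in>arcs Q. trace_on (V (head Q a)) (vmap M a \<circ> g a))"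

definition gim :: "('a \<Rightarrow> (nat \<Rightarrow> 'k) \<Rightarrow> nat \<Rightarrow> 'k) \<Rightarrow> 'n \<Rightarrow> (nat \<Rightarrow> 'k) set" where
  "gim g i = vs.span (\<Union>a\<in>{a \<in> arcs Q. tail Q a = i}. g a ` V (head Q a))"

definition gker :: "('a \<Rightarrow> (nat \<Rightarrow> 'k) \<Rightarrow> nat \<Rightarrow> 'k) \<Rightarrow> 'n \<Rightarrow> (nat \<Rightarrow> 'k) set" where
  "gker g i = {x \<in> V i. \<forall>a\<in>arcs Q. head Q a = i \<longrightarrow> g a x = 0}"

lemma opmaps_at_subset: "U \<in> subfam \<Longrightarrow> opmaps_at U \<subseteq> opmaps"
proof
  fix g assume U: "U \<in> subfam" and g: "g \<in> opmaps_at U"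
  have "0 \<in> U i" for i using subfam_fsub[OF U] fsub_0 by blast
  thus "g \<in> opmaps"
    using g U unfolding opmaps_def opmaps_at_def subfam_def lin_maps_def linear_between_def by blast
qed

lemma finite_opmaps: "finite opmaps"
  unfolding opmaps_def
  by (intro finite_families_0 finite_lin_maps fsub_V finite_arcs vs.subspace_single_0)
    (use fsub_0[OF fsub_V] in auto)

text \<open>Read for fixed g, the condition no longer links different vertices: the admissible U
  form a product of intervals of subspaces. This is what makes exchanging the two sums
  worthwhile.\<close>

lemma mem_opmaps_at_iff:
  assumes U: "U \<in> subfam" and g: "g \<in> opmaps"
  shows "g \<in> opmaps_at U \<longleftrightarrow> (\<forall>i. gim g i \<subseteq> U i \<and> U i \<subseteq> gker g i)"
proof
  assume gU: "g \<in> opmaps_at U"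
  show "\<forall>i. gim g i \<subseteq> U i \<and> U i \<subseteq> gker g i"
  proof (intro allI conjI)
    fix i
    have "(\<Union>a\<in>{a \<in> arcs Q. tail Q a = i}. g a ` V (head Q a)) \<subseteq> U i"
      using gU unfolding opmaps_at_def lin_maps_def linear_between_def by blast
    thus "gim g i \<subseteq> U i" using U unfolding gim_def subfam_def by (intro vs.span_minimal) auto
    show "U i \<subseteq> gker g i"
      using gU U unfolding opmaps_at_def lin_maps_def gker_def subfam_def by blast
  qed
next
  assume *: "\<forall>i. gim g i \<subseteq> U i \<and> U i \<subseteq> gker g i"
  have "g a \<in> lin_maps (U (head Q a)) (V (head Q a)) (U (tail Q a))" if a: "a \<in> arcs Q" for a
  proof -
    have "g a ` V (head Q a) \<subseteq> gim g (tail Q a)"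
      unfolding gim_def using a vs.span_superset by fastforce
    hence 1: "g a ` V (head Q a) \<subseteq> U (tail Q a)" using * by blast
    have 2: "\<forall>x\<in>U (head Q a). g a x = 0" using * a unfolding gker_def by blast
    show ?thesis using g a 1 2 unfolding opmaps_def lin_maps_def linear_between_def by blast
  qed
  thus "g \<in> opmaps_at U" using g unfolding opmaps_def opmaps_at_def by blast
qed

lemma opmaps_at_diff:
  assumes "U \<in> subfam" "g \<in> opmaps_at U" "h \<in> opmaps_at U"
  shows "g - h \<in> opmaps_at U"
  using assms lin_maps_diff[OF fsub_V subfam_fsub[OF assms(1)]] unfolding opmaps_at_def by simp

lemma opmaps_linear:
  "g \<in> opmaps \<Longrightarrow> a \<in> arcs Q \<Longrightarrow> linear_between (V (head Q a)) (V (tail Q a)) (g a)"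
  by (simp add: opmaps_def lin_maps_def)

lemma linear_vmap_comp:
  assumes "g \<in> opmaps" "a \<in> arcs Q"
  shows "linear_between (V (head Q a)) (V (head Q a)) (vmap M a \<circ> g a)"
  by (rule linear_between_comp[OF opmaps_linear[OF assms] linear_vmap[OF assms(2)]])

lemma pairing_diff:
  assumes "g \<in> opmaps" "h \<in> opmaps"
  shows "pairing (g - h) = pairing g - pairing h"
proof -
  have "g - h \<in> opmaps"
    using assms lin_maps_diff[OF fsub_V fsub_V] unfolding opmaps_def by simp
  hence "trace_on (V (head Q a)) (vmap M a \<circ> (g - h) a) =
    trace_on (V (head Q a)) (vmap M a \<circ> g a) - trace_on (V (head Q a)) (vmap M a \<circ> h a)"
    if a: "a \<in> arcs Q" for a
  proof (intro trace_on_diff[OF fsub_V] linear_vmap_comp assms a)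
    fix x assume x: "x \<in> V (head Q a)"
    have "g a x \<in> V (tail Q a)" "h a x \<in> V (tail Q a)"
      using opmaps_linear[OF assms(1) a] opmaps_linear[OF assms(2) a] x
      by (auto simp: linear_between_def)
    thus "(vmap M a \<circ> (g - h) a) x = (vmap M a \<circ> g a) x - (vmap M a \<circ> h a) x"
      using linear_between_diff[OF fsub_V linear_vmap[OF a]] by simp
  qed
  thus ?thesis by (simp add: pairing_def sum_subtractf)
qed

lemma card_opmaps_at:
  assumes U: "U \<in> subfam"
  shows "card (opmaps_at U) =
    CARD('k) ^ (\<Sum>a\<in>arcs Q. vs.dim (U (tail Q a)) * (dV (head Q a) - vs.dim (U (head Q a))))"
proof -
  have "card (opmaps_at U) = (\<Prod>a\<in>arcs Q. card (lin_maps (U (head Q a)) (V (head Q a)) (U (tail Q a))))"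
    unfolding opmaps_at_def by (rule card_families_0) (rule finite_arcs)
  also have "\<dots> = (\<Prod>a\<in>arcs Q. CARD('k) ^ (vs.dim (U (tail Q a)) * (dV (head Q a) - vs.dim (U (head Q a)))))"
    using U subfam_fsub[OF U]
    by (intro prod.cong refl) (simp add: card_lin_maps[OF fsub_V] card_fsub power_mult subfam_def)
  finally show ?thesis by (simp add: power_sum)
qed

text \<open>If U is a subrepresentation, then \<open>vmap M a \<circ> g a\<close> maps V_head into
  U_head and kills U_head, so all traces vanish and every term is 1. Otherwise some arrow moves a
  vector of U out of U; a family supported on that single arrow has pairing 1, and its existence
  makes the sum vanish.\<close>

lemma sum_theta_pairing:
  assumes U: "U \<in> subfam"
  shows "(\<Sum>g\<in>opmaps_at U. theta (pairing g)) =
    (if U \<in> submodules Q M then real (card (opmaps_at U)) else 0)"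
proof (cases "U \<in> submodules Q M")
  case True
  have "pairing g = 0" if g: "g \<in> opmaps_at U" for g
    unfolding pairing_def
  proof (rule sum.neutral, rule ballI)
    fix a assume a: "a \<in> arcs Q"
    have ga: "g a \<in> lin_maps (U (head Q a)) (V (head Q a)) (U (tail Q a))"
      using g a by (simp add: opmaps_at_def)
    have "linear_between (U (tail Q a)) (U (head Q a)) (vmap M a)"
      using linear_vmap[OF a] True a U unfolding linear_between_def submodules_def subfam_def by blast
    hence l: "linear_between (V (head Q a)) (U (head Q a)) (vmap M a \<circ> g a)"
      using ga linear_between_comp unfolding lin_maps_def by blast
    show "trace_on (V (head Q a)) (vmap M a \<circ> g a) = 0"
    proof (rule trace_on_eq_0[OF fsub_V _ _ l])
      show "vs.subspace (U (head Q a))" "U (head Q a) \<subseteq> V (head Q a)"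
        using U by (auto simp: subfam_def)
      show "(vmap M a \<circ> g a) x = 0" if "x \<in> U (head Q a)" for x
        using ga that linear_between_0[OF fsub_V linear_vmap[OF a]] by (simp add: lin_maps_def)
    qed
  qed
  thus ?thesis using True by simp
next
  case False
  have Us: "\<And>i. vs.subspace (U i)" and UV: "\<And>i. U i \<subseteq> V i" using U by (auto simp: subfam_def)
  obtain a x where a: "a \<in> arcs Q" and x: "x \<in> U (tail Q a)" "vmap M a x \<notin> U (head Q a)"
    using False Us UV unfolding submodules_def by blast
  have xV: "x \<in> V (tail Q a)" using x UV by blast
  obtain h where h: "h \<in> lin_maps (U (head Q a)) (V (head Q a)) (U (tail Q a))"
      "trace_on (V (head Q a)) (vmap M a \<circ> h) = 1"
    using lin_maps_trace_1[OF fsub_V Us UV fsub_V linear_vmap[OF a] xV x(2) Us UV x(1)] .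
  define g where "g = (\<lambda>b. if b = a then h else 0)"
  have z: "0 \<in> lin_maps (U i) (V i) (U j)" for i j
    using vs.subspace_0[OF Us] unfolding lin_maps_def linear_between_def by auto
  have g: "g \<in> opmaps_at U" using h z a unfolding opmaps_at_def g_def by auto
  have t0: "trace_on (V (head Q b)) (vmap M b \<circ> 0) = 0" if b: "b \<in> arcs Q" for b
  proof (rule trace_on_eq_0[OF fsub_V vs.subspace_single_0])
    show "{0} \<subseteq> V (head Q b)" using fsub_0[OF fsub_V] by auto
    have e: "(vmap M b \<circ> 0) y = 0" for y using linear_between_0[OF fsub_V linear_vmap[OF b]] by simp
    show "linear_between (V (head Q b)) {0} (vmap M b \<circ> 0)"
      unfolding linear_between_def e by auto
    show "(vmap M b \<circ> 0) y = 0" for y by (rule e)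
  qed
  have "pairing g = (\<Sum>b\<in>arcs Q. if b = a then 1 else 0)"
    unfolding pairing_def by (intro sum.cong refl) (simp add: g_def h(2) t0)
  hence "pairing g = 1" using a by simp
  moreover have "finite (opmaps_at U)" using finite_subset[OF opmaps_at_subset[OF U] finite_opmaps] .
  moreover have "pairing (x - y) = pairing x - pairing y"
    if "x \<in> opmaps_at U" "y \<in> opmaps_at U" for x y
    using that opmaps_at_subset[OF U] pairing_diff by blast
  ultimately show ?thesis using False g opmaps_at_diff[OF U] sum_theta_eq_0[of "opmaps_at U" pairing g] by auto
qed

lemma subspace_gker:
  assumes g: "g \<in> opmaps"
  shows "vs.subspace (gker g i)"
  unfolding vs.subspace_def
proof (intro conjI ballI allI)
  have l: "linear_between (V i) (V (tail Q a)) (g a)" if "a \<in> arcs Q" "head Q a = i" for a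
    using opmaps_linear[OF g] that by auto
  have Vs: "vs.subspace (V i)" using fsub_V fsubD by blast
  show "0 \<in> gker g i" using fsub_0[OF fsub_V] linear_between_0[OF fsub_V l] unfolding gker_def by blast
  fix x assume x: "x \<in> gker g i"
  show "x + y \<in> gker g i" if "y \<in> gker g i" for y
    using x that l Vs vs.subspace_add unfolding gker_def linear_between_def by fastforce
  show "vscale c x \<in> gker g i" for c
    using x l Vs vs.subspace_scale unfolding gker_def linear_between_def
    by (auto simp: vs.scale_zero_right)
qed

lemma gim_subset: "g \<in> opmaps \<Longrightarrow> gim g i \<subseteq> V i"
  unfolding gim_def using fsubD(1)[OF fsub_V]
  by (intro vs.span_minimal) (fastforce simp: opmaps_def lin_maps_def linear_between_def)+

lemma subspace_gim: "vs.subspace (gim g i)"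
  by (simp add: gim_def vs.subspace_span)

lemma gker_subset: "gker g i \<subseteq> V i"
  by (auto simp: gker_def)

text \<open>Applying all \<open>g a\<close> with head i embeds V_i / K_i into the direct sum of the
  spaces S_tail. In dimension vectors this says that R s - t is nonnegative, so the left monomial
  involves no inverse of a variable.\<close>

lemma gker_codim_le:
  assumes g: "g \<in> opmaps"
  shows "dV i - vs.dim (gker g i) \<le> (\<Sum>a\<in>{a \<in> arcs Q. head Q a = i}. vs.dim (gim g (tail Q a)))"
proof -
  let ?A = "{a \<in> arcs Q. head Q a = i}"
  have finA: "finite ?A" using finite_arcs by simp
  have l: "linear_between (V i) (V (tail Q a)) (g a)" if "a \<in> ?A" for a
    using opmaps_linear[OF g] that by auto
  define f where "f x = (\<lambda>a. if a \<in> ?A then g a x else 0)" for x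
  have K: "{x \<in> V i. f x = 0} = gker g i" by (auto simp: gker_def f_def fun_eq_iff[of _ 0])
  have fS: "fsub (gim g j)" for j using fsub_subspace[OF fsub_V subspace_gim gim_subset[OF g]] .
  have "card (V i) = card {x \<in> V i. f x = 0} * card (f ` V i)"
  proof (rule card_eq_card_kernel_times_card_image)
    show "finite (V i)" "V i \<noteq> {}" using fsub_V fsubD fsub_0 by blast+
    show "x - y \<in> V i" if "x \<in> V i" "y \<in> V i" for x y
      using that fsub_V fsubD vs.subspace_diff by blast
    show "f (x - y) = f x - f y" if "x \<in> V i" "y \<in> V i" for x y
      using that linear_between_diff[OF fsub_V l] by (auto simp: f_def fun_eq_iff)
  qed
  also have "card (f ` V i) \<le> card {h. (\<forall>a\<in>?A. h a \<in> gim g (tail Q a)) \<and> (\<forall>a. a \<notin> ?A \<longrightarrow> h a = 0)}"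
  proof (rule card_mono)
    show "finite {h. (\<forall>a\<in>?A. h a \<in> gim g (tail Q a)) \<and> (\<forall>a. a \<notin> ?A \<longrightarrow> h a = 0)}"
      using fsubD(2)[OF fS] by (intro finite_families_0 finA)
    have "g a x \<in> gim g (tail Q a)" if "a \<in> ?A" "x \<in> V i" for a x
      unfolding gim_def by (rule vs.span_base) (use that in blast)
    thus "f ` V i \<subseteq> {h. (\<forall>a\<in>?A. h a \<in> gim g (tail Q a)) \<and> (\<forall>a. a \<notin> ?A \<longrightarrow> h a = 0)}"
      by (auto simp: f_def)
  qed
  also have "\<dots> = CARD('k) ^ (\<Sum>a\<in>?A. vs.dim (gim g (tail Q a)))"
    by (subst card_families_0[OF finA]) (simp add: card_fsub[OF fS] power_sum)
  finally have "CARD('k) ^ dV i \<le> CARD('k) ^ (vs.dim (gker g i) + (\<Sum>a\<in>?A. vs.dim (gim g (tail Q a))))"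
    using fsub_subspace[OF fsub_V subspace_gker[OF g] gker_subset]
    unfolding K by (simp add: card_fsub fsub_V power_add)
  hence "dV i \<le> vs.dim (gker g i) + (\<Sum>a\<in>?A. vs.dim (gim g (tail Q a)))"
    using CARD_field_gt_1 power_increasing_iff by blast
  thus ?thesis by simp
qed

text \<open>Each \<open>g a\<close> with tail i factors through V_head / K_head, which bounds the
  dimension of its image, and S_i is the sum of these images. In dimension vectors this says that
  R^T t - s is nonnegative, as the right monomial requires.\<close>

lemma gim_dim_le:
  assumes g: "g \<in> opmaps"
  shows "vs.dim (gim g i) \<le> (\<Sum>a\<in>{a \<in> arcs Q. tail Q a = i}. dV (head Q a) - vs.dim (gker g (head Q a)))"
proof -
  let ?A = "{a \<in> arcs Q. tail Q a = i}"
  have finA: "finite ?A" using finite_arcs by simp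
  have l: "linear_between (V (head Q a)) (V i) (g a)" if "a \<in> ?A" for a
    using opmaps_linear[OF g] that by auto
  have K: "fsub (gker g j)" for j using fsub_subspace[OF fsub_V subspace_gker[OF g] gker_subset] .
  have im: "card (g a ` V (head Q a)) \<le> CARD('k) ^ (dV (head Q a) - vs.dim (gker g (head Q a)))"
    if a: "a \<in> ?A" for a
  proof -
    let ?j = "head Q a"
    have "card (V ?j) = card {x \<in> V ?j. g a x = 0} * card (g a ` V ?j)"
    proof (rule card_eq_card_kernel_times_card_image)
      show "finite (V ?j)" "V ?j \<noteq> {}" using fsub_V fsubD fsub_0 by blast+
      show "x - y \<in> V ?j" if "x \<in> V ?j" "y \<in> V ?j" for x y
        using that fsub_V fsubD vs.subspace_diff by blast
      show "g a (x - y) = g a x - g a y" if "x \<in> V ?j" "y \<in> V ?j" for x y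
        using that linear_between_diff[OF fsub_V l[OF a]] by blast
    qed
    moreover have "card (gker g ?j) \<le> card {x \<in> V ?j. g a x = 0}"
      using fsubD(2)[OF fsub_V] a by (intro card_mono) (auto simp: gker_def)
    ultimately have "card (gker g ?j) * card (g a ` V ?j) \<le> card (V ?j)"
      by simp
    hence "CARD('k) ^ vs.dim (gker g ?j) * card (g a ` V ?j) \<le> CARD('k) ^ dV ?j"
      by (simp add: card_fsub K fsub_V)
    also have "dV ?j = vs.dim (gker g ?j) + (dV ?j - vs.dim (gker g ?j))"
      using fsub_dim_mono[OF fsub_V gker_subset subspace_gker[OF g]] by simp
    finally show ?thesis by (simp add: power_add)
  qed
  let ?F = "{h. (\<forall>a\<in>?A. h a \<in> g a ` V (head Q a)) \<and> (\<forall>a. a \<notin> ?A \<longrightarrow> h a = 0)}"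
  have fF: "finite ?F" using fsubD(2)[OF fsub_V] by (intro finite_families_0 finA) simp
  have gs: "vs.subspace (g a ` V (head Q a))" if aA: "a \<in> ?A" for a
    unfolding vs.subspace_def
  proof (intro conjI ballI allI)
    have Vs: "vs.subspace (V (head Q a))" using fsub_V fsubD by blast
    show "0 \<in> g a ` V (head Q a)"
      using linear_between_0[OF fsub_V l[OF aA]] fsub_0[OF fsub_V] by (metis imageI)
    show "x + y \<in> g a ` V (head Q a)" if xy: "x \<in> g a ` V (head Q a)" "y \<in> g a ` V (head Q a)" for x y
    proof -
      obtain x' y' where "x' \<in> V (head Q a)" "y' \<in> V (head Q a)" "x = g a x'" "y = g a y'" using xy by blast
      moreover from this have "g a (x' + y') = x + y"
        using l[OF aA] unfolding linear_between_def by blast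
      ultimately show ?thesis using Vs vs.subspace_add by (metis imageI)
    qed
    show "vscale c x \<in> g a ` V (head Q a)" if xy: "x \<in> g a ` V (head Q a)" for x c
    proof -
      obtain x' where "x' \<in> V (head Q a)" "x = g a x'" using xy by blast
      moreover from this have "g a (vscale c x') = vscale c x"
        using l[OF aA] unfolding linear_between_def by blast
      ultimately show ?thesis using Vs vs.subspace_scale by (metis imageI)
    qed
  qed
  \<comment> \<open>The sums of one vector from each image form a subspace containing every image,
    hence the span; their number is at most the product of the sizes of the images.\<close>
  have "gim g i \<subseteq> (\<lambda>h. \<Sum>a\<in>?A. h a) ` ?F"
    unfolding gim_def
  proof (rule vs.span_minimal)
    show "(\<Union>a\<in>?A. g a ` V (head Q a)) \<subseteq> (\<lambda>h. \<Sum>a\<in>?A. h a) ` ?F"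
    proof (intro UN_least image_subsetI)
      fix a x assume a: "a \<in> ?A" and x: "x \<in> V (head Q a)"
      let ?h = "\<lambda>b. if b = a then g a x else 0"
      have "g a x = (\<Sum>b\<in>?A. ?h b)" using finA a by (simp add: sum.delta)
      moreover have "?h \<in> ?F" using x a gs vs.subspace_0 by auto
      ultimately show "g a x \<in> (\<lambda>h. \<Sum>a\<in>?A. h a) ` ?F" by (rule image_eqI)
    qed
    show "vs.subspace ((\<lambda>h. \<Sum>a\<in>?A. h a) ` ?F)"
      unfolding vs.subspace_def
    proof (intro conjI ballI allI)
      show "0 \<in> (\<lambda>h. \<Sum>a\<in>?A. h a) ` ?F"
        by (rule image_eqI[of _ _ "\<lambda>_. 0"]) (use gs vs.subspace_0 in auto)
      show "x + y \<in> (\<lambda>h. \<Sum>a\<in>?A. h a) ` ?F"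
        if xy: "x \<in> (\<lambda>h. \<Sum>a\<in>?A. h a) ` ?F" "y \<in> (\<lambda>h. \<Sum>a\<in>?A. h a) ` ?F" for x y
      proof -
        obtain h h' where h: "h \<in> ?F" "h' \<in> ?F" "x = (\<Sum>a\<in>?A. h a)" "y = (\<Sum>a\<in>?A. h' a)" using xy by blast
        have "x + y = (\<Sum>a\<in>?A. (h + h') a)" unfolding h(3,4) by (simp add: sum.distrib)
        moreover have "h + h' \<in> ?F" using h(1,2) vs.subspace_add[OF gs] by simp
        ultimately show ?thesis by (rule image_eqI)
      qed
      show "vscale c x \<in> (\<lambda>h. \<Sum>a\<in>?A. h a) ` ?F" if xy: "x \<in> (\<lambda>h. \<Sum>a\<in>?A. h a) ` ?F" for c x
      proof -
        obtain h where h: "h \<in> ?F" "x = (\<Sum>a\<in>?A. h a)" using xy by blast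
        have "vscale c x = (\<Sum>a\<in>?A. vscale c (h a))" unfolding h(2) by (simp add: vs.scale_sum_right)
        moreover have "(\<lambda>a. vscale c (h a)) \<in> ?F"
          using h(1) vs.subspace_scale[OF gs] by (simp add: vs.scale_zero_right)
        ultimately show ?thesis by (rule image_eqI)
      qed
    qed
  qed
  hence "card (gim g i) \<le> card ?F"
    using fF card_mono[OF finite_imageI[OF fF]] card_image_le[OF fF] le_trans by blast
  also have "card ?F = (\<Prod>a\<in>?A. card (g a ` V (head Q a)))"
    by (rule card_families_0[OF finA])
  also have "\<dots> \<le> (\<Prod>a\<in>?A. CARD('k) ^ (dV (head Q a) - vs.dim (gker g (head Q a))))"
    by (intro prod_mono conjI) (use im in auto)
  also have "\<dots> = CARD('k) ^ (\<Sum>a\<in>?A. dV (head Q a) - vs.dim (gker g (head Q a)))"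
    by (simp add: power_sum)
  finally have "CARD('k) ^ vs.dim (gim g i) \<le> CARD('k) ^ (\<Sum>a\<in>?A. dV (head Q a) - vs.dim (gker g (head Q a)))"
    using card_fsub[OF fsub_subspace[OF fsub_V subspace_gim gim_subset[OF g]]] by simp
  thus ?thesis using CARD_field_gt_1 power_increasing_iff by blast
qed

lemma submodules_subset_subfam: "submodules Q M \<subseteq> subfam"
  by (auto simp: submodules_def subfam_def)

end

section \<open>Bilinear forms of integer matrices\<close>

lemma form_eq_sum_mult: "form L x y = (\<Sum>i\<in>UNIV. x $ i * (L *v y) $ i)"
  by (simp add: form_def matrix_vector_mult_def sum_distrib_left mult.assoc)

lemma form_add_left: "form L (x + y) z = form L x z + form L y z"
  by (simp add: form_def algebra_simps sum.distrib)

lemma form_add_right: "form L z (x + y) = form L z x + form L z y"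
  by (simp add: form_def algebra_simps sum.distrib)

lemma form_diff_left: "form L (x - y) z = form L x z - form L y z"
  by (simp add: form_def algebra_simps sum_subtractf)

lemma form_diff_right: "form L z (x - y) = form L z x - form L z y"
  by (simp add: form_def algebra_simps sum_subtractf)

lemma form_minus_left: "form L (- x) z = - form L x z"
  by (simp add: form_def sum_negf)

lemma form_minus_right: "form L z (- x) = - form L z x"
  by (simp add: form_def sum_negf)

lemma form_0_left [simp]: "form L 0 z = 0"
  by (simp add: form_def)

lemma form_0_right [simp]: "form L z 0 = 0"
  by (simp add: form_def)

lemmas form_linear = form_add_left form_add_right form_diff_left form_diff_right
  form_minus_left form_minus_right

lemma form_add_mat: "form (L + L') x y = form L x y + form L' x y"
  by (simp add: form_def algebra_simps sum.distrib)

lemma form_diff_mat: "form (L - L') x y = form L x y - form L' x y"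
  by (simp add: form_def algebra_simps sum_subtractf)

lemma form_minus_mat: "form (- L) x y = - form L x y"
  by (simp add: form_def sum_negf)

lemma form_transpose: "form (transpose L) x y = form L y x"
  unfolding form_def by (subst sum.swap) (simp add: transpose_def mult_ac)

lemma form_mult_vec_right: "form L x (C *v y) = form (L ** C) x y"
  by (simp add: form_eq_sum_mult matrix_vector_mul_assoc)

lemma form_mult_vec_left: "form L (C *v x) y = form (transpose C ** L) x y"
proof -
  have "form L (C *v x) y = form (transpose L ** C) y x"
    by (metis form_transpose form_mult_vec_right)
  also have "\<dots> = form (transpose (transpose L ** C)) x y"
    by (simp add: form_transpose)
  finally show ?thesis by (simp add: matrix_transpose_mul transpose_transpose)
qed

lemma form_mat_1_commute: "form (mat 1) x y = form (mat 1) y x"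
  using form_transpose[of "mat 1" x y] by (simp add: transpose_mat)

lemma form_mat_1_mult_right: "form (mat 1) x (C *v y) = form C x y"
  by (simp add: form_mult_vec_right)

lemma form_mat_1_mult_left: "form (mat 1) (C *v x) y = form C y x"
  using form_mat_1_commute form_mat_1_mult_right by metis

lemma single_sum: "Poly_Mapping.single k (sum f A) = (\<Sum>a\<in>A. Poly_Mapping.single k (f a))"
  by (induction A rule: infinite_finite_induct) (simp_all add: Poly_Mapping.single_add)

lemma powi_2_mult_nat: "(v::real) powi (2 * int n) = (v\<^sup>2) ^ n"
  by (metis int_ops(3) of_nat_mult of_nat_numeral power_int_of_nat power_mult)

context quiver_rep
begin

abbreviation "P_mat \<equiv> mat 1 - A_mat Q"

definition interval :: "('n \<Rightarrow> (nat \<Rightarrow> 'k) set) \<Rightarrow> ('n \<Rightarrow> (nat \<Rightarrow> 'k) set) \<Rightarrow> ('n \<Rightarrow> (nat \<Rightarrow> 'k) set) set" where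
  "interval S K = {U. \<forall>i. vs.subspace (U i) \<and> S i \<subseteq> U i \<and> U i \<subseteq> K i}"

lemma card_opmaps_at_powi:
  assumes v2: "v\<^sup>2 = real CARD('k)" and U: "U \<in> subfam"
  shows "real (card (opmaps_at U)) = v powi (2 * form (A_mat Q) (sdim U) (dimv M - sdim U))"
proof -
  have "form (A_mat Q) (sdim U) (dimv M - sdim U) =
    int (\<Sum>a\<in>arcs Q. vs.dim (U (tail Q a)) * (dV (head Q a) - vs.dim (U (head Q a))))"
    using subfam_dim_le[OF U] by (simp add: form_A_mat finite_arcs sdim_def dimv_def of_nat_diff)
  thus ?thesis by (simp only: powi_2_mult_nat v2 card_opmaps_at[OF U] of_nat_power)
qed

text \<open>The indicator of subrepresentations is the sum of \<open>theta (pairing g)\<close> over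
  \<open>opmaps_at U\<close>, divided by the number of its elements, which is v to the power 2 A(u,
  m - u). Together with the Euler form this gives the exponent -(1 - A) - 2 A = -(1 + A), evaluated
  at (u, m - u).\<close>

lemma quantum_character_eq_sum_intervals:
  assumes v2: "v\<^sup>2 = real CARD('k)"
    and euler: "\<And>U. U \<in> submodules Q M \<Longrightarrow>
      euler TYPE('k) Q (sdim U) (dimv M - sdim U) = form P_mat (sdim U) (dimv M - sdim U)"
  shows "quantum_character Q v M =
    (\<Sum>g\<in>opmaps. \<Sum>U\<in>interval (gim g) (gker g). Poly_Mapping.single (- (B_mat Q *v sdim U) - P_mat *v dimv M)
       (theta (pairing g) * v powi (- form (mat 1 + A_mat Q) (sdim U) (dimv M - sdim U))))"
    (is "_ = (\<Sum>g\<in>opmaps. \<Sum>U\<in>interval (gim g) (gker g). Poly_Mapping.single (?y (sdim U)) (theta (pairing g) * ?c' (sdim U)))")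
proof -
  have v0: "v \<noteq> 0" using v2 by auto
  define c where "c e = v powi (- form P_mat e (dimv M - e))" for e
  have fin: "finite (submodules Q M)" using finite_subset[OF submodules_subset_subfam finite_subfam] .
  have "quantum_character Q v M = (\<Sum>e\<in>sdim ` submodules Q M. \<Sum>U\<in>{U \<in> submodules Q M. sdim U = e}.
      Poly_Mapping.single (?y (sdim U)) (c (sdim U)))"
    unfolding quantum_character_def
  proof (rule sum.cong)
    show "{e. Gr Q M e \<noteq> {}} = sdim ` submodules Q M" by (auto simp: Gr_def)
    fix e assume "e \<in> sdim ` submodules Q M"
    then obtain U where "U \<in> submodules Q M" "e = sdim U" by blast
    hence "real (card (Gr Q M e)) * v powi - euler TYPE('k) Q e (dimv M - e) = (\<Sum>U\<in>Gr Q M e. c e)"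
      by (simp add: c_def euler)
    hence "Poly_Mapping.single (?y e) (real (card (Gr Q M e)) * v powi - euler TYPE('k) Q e (dimv M - e))
        = (\<Sum>U\<in>Gr Q M e. Poly_Mapping.single (?y e) (c e))" by (simp only: single_sum)
    also have "\<dots> = (\<Sum>U\<in>{U \<in> submodules Q M. sdim U = e}. Poly_Mapping.single (?y (sdim U)) (c (sdim U)))"
      by (rule sum.cong) (auto simp: Gr_def)
    finally show "Poly_Mapping.single (?y e) (real (card (Gr Q M e)) * v powi - euler TYPE('k) Q e (dimv M - e))
        = (\<Sum>U\<in>{U \<in> submodules Q M. sdim U = e}. Poly_Mapping.single (?y (sdim U)) (c (sdim U)))" .
  qed
  also have "\<dots> = (\<Sum>U\<in>submodules Q M. Poly_Mapping.single (?y (sdim U)) (c (sdim U)))"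
    by (rule sum.image_gen[OF fin, symmetric])
  also have "\<dots> = (\<Sum>U\<in>subfam. if U \<in> submodules Q M then Poly_Mapping.single (?y (sdim U)) (c (sdim U)) else 0)"
    using submodules_subset_subfam finite_subfam
    by (simp add: sum.inter_restrict[symmetric] Int_absorb1)
  also have "\<dots> = (\<Sum>U\<in>subfam. \<Sum>g\<in>opmaps_at U. Poly_Mapping.single (?y (sdim U)) (theta (pairing g) * ?c' (sdim U)))"
  proof (rule sum.cong[OF refl])
    fix U assume U: "U \<in> subfam"
    have "real (card (opmaps_at U)) * ?c' (sdim U) = c (sdim U)"
      by (simp add: card_opmaps_at_powi[OF v2 U] c_def v0 form_add_mat form_diff_mat flip: power_int_add)
    hence "(\<Sum>g\<in>opmaps_at U. theta (pairing g) * ?c' (sdim U)) = (if U \<in> submodules Q M then c (sdim U) else 0)"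
      by (simp add: sum_theta_pairing[OF U] flip: sum_distrib_right)
    thus "(if U \<in> submodules Q M then Poly_Mapping.single (?y (sdim U)) (c (sdim U)) else 0)
      = (\<Sum>g\<in>opmaps_at U. Poly_Mapping.single (?y (sdim U)) (theta (pairing g) * ?c' (sdim U)))"
      by (simp flip: single_sum)
  qed
  also have "\<dots> = (\<Sum>U\<in>subfam. \<Sum>g\<in>opmaps. if g \<in> opmaps_at U
      then Poly_Mapping.single (?y (sdim U)) (theta (pairing g) * ?c' (sdim U)) else 0)"
    by (intro sum.cong refl sum.mono_neutral_cong_left finite_opmaps opmaps_at_subset) auto
  also have "\<dots> = (\<Sum>g\<in>opmaps. \<Sum>U\<in>subfam. if g \<in> opmaps_at U
      then Poly_Mapping.single (?y (sdim U)) (theta (pairing g) * ?c' (sdim U)) else 0)"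
    by (rule sum.swap)
  also have "\<dots> = (\<Sum>g\<in>opmaps. \<Sum>U\<in>interval (gim g) (gker g).
      Poly_Mapping.single (?y (sdim U)) (theta (pairing g) * ?c' (sdim U)))"
  proof (rule sum.cong[OF refl])
    fix g assume g: "g \<in> opmaps"
    have "interval (gim g) (gker g) = {U \<in> subfam. g \<in> opmaps_at U}"
      using mem_opmaps_at_iff[OF _ g] gker_subset unfolding interval_def subfam_def by blast
    thus "(\<Sum>U\<in>subfam. if g \<in> opmaps_at U
        then Poly_Mapping.single (?y (sdim U)) (theta (pairing g) * ?c' (sdim U)) else 0)
      = (\<Sum>U\<in>interval (gim g) (gker g). Poly_Mapping.single (?y (sdim U)) (theta (pairing g) * ?c' (sdim U)))"
      by (simp add: sum.If_cases finite_subfam Int_def)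
  qed
  finally show ?thesis .
qed

end

section \<open>The quantum torus\<close>

lemma coeff_ringI:
  "finite I \<Longrightarrow> (\<Sum>i\<in>I. of_int (a i) * v powi i) \<in> coeff_ring v"
  unfolding coeff_ring_def by blast

lemma coeff_ring_add:
  assumes "x \<in> coeff_ring v" "y \<in> coeff_ring v"
  shows "x + y \<in> coeff_ring v"
proof -
  obtain I a J b where I: "finite I" "x = (\<Sum>i\<in>I. of_int (a i) * v powi i)"
    and J: "finite J" "y = (\<Sum>i\<in>J. of_int (b i) * v powi i)"
    using assms unfolding coeff_ring_def by blast
  have "x = (\<Sum>i\<in>I \<union> J. of_int (if i \<in> I then a i else 0) * v powi i)"
    unfolding I(2) by (rule sum.mono_neutral_cong_left) (use I J in auto)
  moreover have "y = (\<Sum>i\<in>I \<union> J. of_int (if i \<in> J then b i else 0) * v powi i)"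
    unfolding J(2) by (rule sum.mono_neutral_cong_left) (use I J in auto)
  ultimately have "x + y = (\<Sum>i\<in>I \<union> J. of_int ((if i \<in> I then a i else 0) + (if i \<in> J then b i else 0)) * v powi i)"
    by (simp only: of_int_add distrib_right sum.distrib)
  also have "\<dots> \<in> coeff_ring v" by (rule coeff_ringI) (use I J in simp)
  finally show ?thesis .
qed

lemma coeff_ring_monomial: "of_int n * v powi i \<in> coeff_ring v"
  using coeff_ringI[of "{i}" "\<lambda>_. n" v] by simp

lemma coeff_ring_of_int: "of_int n \<in> coeff_ring v"
  using coeff_ring_monomial[of n v 0] by simp

lemma coeff_ring_0: "0 \<in> coeff_ring v" and coeff_ring_1: "1 \<in> coeff_ring v"
  using coeff_ring_of_int[of 0] coeff_ring_of_int[of 1] by simp_all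

lemma coeff_ring_powi: "v powi i \<in> coeff_ring v"
  using coeff_ring_monomial[of 1 v i] by simp

lemma coeff_ring_sum: "(\<And>i. i \<in> I \<Longrightarrow> f i \<in> coeff_ring v) \<Longrightarrow> sum f I \<in> coeff_ring v"
  by (induction I rule: infinite_finite_induct) (auto simp: coeff_ring_0 coeff_ring_add)

lemma coeff_ring_mult:
  assumes "v \<noteq> 0" "x \<in> coeff_ring v" "y \<in> coeff_ring v"
  shows "x * y \<in> coeff_ring v"
proof -
  obtain I a J b where I: "finite I" "x = (\<Sum>i\<in>I. of_int (a i) * v powi i)"
    and J: "finite J" "y = (\<Sum>i\<in>J. of_int (b i) * v powi i)"
    using assms unfolding coeff_ring_def by blast
  have "of_int m * v powi i * (of_int n * v powi j) = of_int (m * n) * v powi (i + j)" for m n i j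
    using assms(1) by (simp add: power_int_add)
  hence "of_int m * v powi i * (of_int n * v powi j) \<in> coeff_ring v" for m n i j
    by (simp only: coeff_ring_monomial)
  thus ?thesis unfolding I(2) J(2) sum_product by (intro coeff_ring_sum)
qed

text \<open>Index sets larger than the supports allow several elements to be expanded over a common
  set, although the support of a sum may shrink; additivity of the product follows.\<close>

lemma qtorus_mult_eq_sum:
  assumes "finite C" "finite D" "Poly_Mapping.keys f \<subseteq> C" "Poly_Mapping.keys g \<subseteq> D"
  shows "qtorus_mult L v f g = (\<Sum>c\<in>C. \<Sum>d\<in>D.
     Poly_Mapping.single (c + d) (Poly_Mapping.lookup f c * Poly_Mapping.lookup g d * v powi form L c d))"
proof -
  have "qtorus_mult L v f g = (\<Sum>c\<in>Poly_Mapping.keys f. \<Sum>d\<in>D.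
     Poly_Mapping.single (c + d) (Poly_Mapping.lookup f c * Poly_Mapping.lookup g d * v powi form L c d))"
    unfolding qtorus_mult_def
    by (intro sum.cong refl sum.mono_neutral_left) (use assms in \<open>auto simp: in_keys_iff\<close>)
  also have "\<dots> = (\<Sum>c\<in>C. \<Sum>d\<in>D.
     Poly_Mapping.single (c + d) (Poly_Mapping.lookup f c * Poly_Mapping.lookup g d * v powi form L c d))"
    by (intro sum.mono_neutral_left) (use assms in \<open>auto simp: in_keys_iff\<close>)
  finally show ?thesis .
qed

lemma qtorus_mult_add_left: "qtorus_mult L v (f + f') g = qtorus_mult L v f g + qtorus_mult L v f' g"
proof -
  let ?C = "Poly_Mapping.keys f \<union> Poly_Mapping.keys f'" and ?D = "Poly_Mapping.keys g"
  have k: "Poly_Mapping.keys (f + f') \<subseteq> ?C" by (rule Poly_Mapping.keys_add)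
  have e: "qtorus_mult L v h g = (\<Sum>c\<in>?C. \<Sum>d\<in>?D.
     Poly_Mapping.single (c + d) (Poly_Mapping.lookup h c * Poly_Mapping.lookup g d * v powi form L c d))"
    if "Poly_Mapping.keys h \<subseteq> ?C" for h
    by (rule qtorus_mult_eq_sum) (use that in auto)
  show ?thesis
    by (simp add: e[OF k] e[of f] e[of f'] lookup_add distrib_right Poly_Mapping.single_add sum.distrib)
qed

lemma qtorus_mult_add_right: "qtorus_mult L v g (f + f') = qtorus_mult L v g f + qtorus_mult L v g f'"
proof -
  let ?C = "Poly_Mapping.keys f \<union> Poly_Mapping.keys f'" and ?D = "Poly_Mapping.keys g"
  have k: "Poly_Mapping.keys (f + f') \<subseteq> ?C" by (rule Poly_Mapping.keys_add)
  have e: "qtorus_mult L v g h = (\<Sum>d\<in>?D. \<Sum>c\<in>?C.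
     Poly_Mapping.single (d + c) (Poly_Mapping.lookup g d * Poly_Mapping.lookup h c * v powi form L d c))"
    if "Poly_Mapping.keys h \<subseteq> ?C" for h
    by (rule qtorus_mult_eq_sum) (use that in auto)
  show ?thesis
    by (simp add: e[OF k] e[of f] e[of f'] lookup_add distrib_right distrib_left Poly_Mapping.single_add sum.distrib)
qed

lemma qtorus_mult_0_left [simp]: "qtorus_mult L v 0 g = 0"
  and qtorus_mult_0_right [simp]: "qtorus_mult L v g 0 = 0"
  by (simp_all add: qtorus_mult_def)

lemma qtorus_mult_sum_left: "qtorus_mult L v (sum f I) g = (\<Sum>i\<in>I. qtorus_mult L v (f i) g)"
  by (induction I rule: infinite_finite_induct) (simp_all add: qtorus_mult_add_left)

lemma qtorus_mult_sum_right: "qtorus_mult L v g (sum f I) = (\<Sum>i\<in>I. qtorus_mult L v g (f i))"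
  by (induction I rule: infinite_finite_induct) (simp_all add: qtorus_mult_add_right)

lemma qtorus_mult_single:
  "qtorus_mult L v (Poly_Mapping.single c a) (Poly_Mapping.single d b)
    = Poly_Mapping.single (c + d) (a * b * v powi form L c d)"
  by (subst qtorus_mult_eq_sum[of "{c}" "{d}"]) (auto simp: lookup_single)

lemma qtorus_mult_scalar:
  "qtorus_mult L v (Poly_Mapping.single 0 r) (Poly_Mapping.single d b) = Poly_Mapping.single d (r * b)"
  by (simp add: qtorus_mult_single)

lemma poly_mapping_eq_sum_singles: "f = (\<Sum>k\<in>Poly_Mapping.keys f. Poly_Mapping.single k (Poly_Mapping.lookup f k))"
  by (rule poly_mapping_eqI) (simp add: lookup_sum lookup_single when_def in_keys_iff)

text \<open>Turns the scaling that occurs in \<open>Psi\<close> into multiplication by a constant of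
  the torus, under which a subring containing the constants is closed.\<close>

lemma qtorus_mult_scalar_eq_map:
  "r \<noteq> 0 \<Longrightarrow> qtorus_mult L v (Poly_Mapping.single 0 r) f = Poly_Mapping.map ((*) r) f"
proof -
  assume "r \<noteq> 0"
  have "qtorus_mult L v (Poly_Mapping.single 0 r) f =
      (\<Sum>k\<in>Poly_Mapping.keys f. Poly_Mapping.single k (r * Poly_Mapping.lookup f k))"
    by (subst poly_mapping_eq_sum_singles[of f]) (simp add: qtorus_mult_sum_right qtorus_mult_scalar)
  also have "\<dots> = Poly_Mapping.map ((*) r) f"
    by (rule poly_mapping_eqI) (simp add: lookup_sum lookup_single when_def in_keys_iff map.rep_eq)
  finally show ?thesis .
qed

definition tcarrier :: "real \<Rightarrow> ('c \<Rightarrow>\<^sub>0 real) set" where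
  "tcarrier v = {f. range (Poly_Mapping.lookup f) \<subseteq> coeff_ring v}"

lemma tcarrier_single: "a \<in> coeff_ring v \<Longrightarrow> Poly_Mapping.single c a \<in> tcarrier v"
  by (auto simp: tcarrier_def lookup_single when_def coeff_ring_0)

lemma tcarrier_add: "f \<in> tcarrier v \<Longrightarrow> g \<in> tcarrier v \<Longrightarrow> f + g \<in> tcarrier v"
  by (auto simp: tcarrier_def lookup_add intro!: coeff_ring_add)

lemma tcarrier_sum: "(\<And>i. i \<in> I \<Longrightarrow> f i \<in> tcarrier v) \<Longrightarrow> sum f I \<in> tcarrier v"
  by (induction I rule: infinite_finite_induct)
    (auto simp: tcarrier_add intro: tcarrier_single[of 0, simplified] coeff_ring_0)

lemma tcarrier_mult:
  assumes "v \<noteq> 0" "f \<in> tcarrier v" "g \<in> tcarrier v"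
  shows "qtorus_mult L v f g \<in> tcarrier v"
  unfolding qtorus_mult_def
  using assms by (intro tcarrier_sum tcarrier_single coeff_ring_mult coeff_ring_powi) (auto simp: tcarrier_def)

section \<open>Arrow matrices and compatible pairs\<close>

lemma B_mat_eq: "B_mat Q = A_mat Q - R_mat Q"
  by (simp add: B_mat_def R_mat_def transpose_def vec_eq_iff)

lemma form_B_mat: "form (B_mat Q) x y = form (A_mat Q) x y - form (A_mat Q) y x"
  by (simp add: B_mat_eq form_diff_mat form_transpose)

lemma matrix_vector_minus_left: "(- C) *v x = - (C *v (x :: int ^ 'n::finite))"
  by (simp add: matrix_vector_mult_def vec_eq_iff sum_negf)

lemma form_mat_1_axis: "form (mat 1) (axis j 1) x = x $ j"
proof -
  have "form (mat 1) (axis j 1) x = (\<Sum>i\<in>UNIV. axis j 1 $ i * x $ i)"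
    by (simp add: form_eq_sum_mult)
  also have "\<dots> = (\<Sum>i\<in>UNIV. if i = j then x $ i else 0)"
    by (rule sum.cong) (auto simp: axis_def)
  finally show ?thesis by simp
qed

locale compatible_pair =
  fixes Q :: "('n::finite, 'a) pre_digraph" and L :: "int ^ 'n ^ 'n"
  assumes antisym: "transpose L = - L" and compatible: "L ** (- B_mat Q) = mat 1"
begin

lemma form_L_swap: "form L x y = - form L y x"
  using form_transpose[of L x y] by (simp add: antisym form_minus_mat)

text \<open>Compatibility of the pair in the form in which it is applied: pairing with
  \<open>B f\<close> is the ordinary scalar product with f up to sign, so every commutation exponent
  involving a B-part becomes explicit.\<close>

lemma form_L_B_right: "form L y (B_mat Q *v f) = - form (mat 1) y f"
  using form_mult_vec_right[of L y "- B_mat Q" f]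
  by (simp add: compatible matrix_vector_minus_left form_minus_right)

lemma form_L_B_left: "form L (B_mat Q *v f) y = form (mat 1) f y"
  using form_L_swap[of "B_mat Q *v f" y] by (simp add: form_L_B_right form_mat_1_commute[of y f])

end

section \<open>Sums over intervals of graded subspaces\<close>

text \<open>A basis of S is extended to one of K; dropping one added vector x leaves a basis of a
  hyperplane that still contains S.\<close>

lemma fsub_hyperplane:
  assumes K: "fsub K" and S: "vs.subspace S" "S \<subseteq> K" "S \<noteq> K"
  obtains K0 x where "fsub K0" "S \<subseteq> K0" "K0 \<subseteq> K" "x \<notin> K0" "vs.span (insert x K0) = K"
    "vs.dim K = Suc (vs.dim K0)"
proof -
  obtain B1 where B1: "B1 \<subseteq> S" "vs.independent B1" "vs.span B1 = S" "finite B1" "card B1 = vs.dim S"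
    using fsub_basis[OF fsub_subspace[OF K S(1,2)]] .
  have "B1 \<subseteq> K" using B1(1) S(2) by blast
  then obtain B where B: "B1 \<subseteq> B" "B \<subseteq> K" "vs.independent B" "vs.span B = K" "finite B" "card B = vs.dim K"
    using fsub_extend_basis[OF K _ B1(2)] by blast
  have "B1 \<noteq> B" using B(4) B1(3) S(3) by blast
  then obtain x where x: "x \<in> B" "x \<notin> B1" using B(1) by blast
  define K0 where "K0 = vs.span (B - {x})"
  have ind: "vs.independent (B - {x})" using B(3) vs.independent_mono by blast
  have sub: "K0 \<subseteq> K" unfolding K0_def using B(4) by (metis Diff_subset vs.span_mono)
  show ?thesis
  proof (rule that[of K0 x])
    show "fsub K0" using fsub_subspace[OF K _ sub] by (simp add: K0_def vs.subspace_span)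
    show "S \<subseteq> K0"
      unfolding K0_def B1(3)[symmetric] by (rule vs.span_mono) (use B(1) x in blast)
    show "K0 \<subseteq> K" by (rule sub)
    show "x \<notin> K0" using B(3) x(1) unfolding K0_def vs.dependent_def by blast
    have "vs.span (insert x K0) = vs.span (insert x (B - {x}))"
      unfolding vs.span_insert K0_def vs.span_span ..
    thus "vs.span (insert x K0) = K" using x(1) B(4) by (simp add: insert_absorb)
    have "vs.dim K0 = card (B - {x})" unfolding K0_def by (rule vs.dim_span_eq_card_independent[OF ind])
    moreover have "card B = Suc (card (B - {x}))" using card.remove[OF B(5) x(1)] .
    ultimately show "vs.dim K = Suc (vs.dim K0)" using B(6) by linarith
  qed
qed

text \<open>\<open>Sub\<close> stands for any subring with the constants, the initial variables and
  the once-mutated ones, which keeps the argument inside the torus, away from the skew field. The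
  exponents in \<open>Sub_mutated\<close> are A e_j - e_j and R e_j - e_j, those of the exchange
  relation at j; the same sum is the quantum character of the simple representation at j.\<close>

locale lower_bound = quiver_rep Q M + compatible_pair Q L
  for Q :: "('n::finite, 'a) pre_digraph" and M :: "('n, 'a, 'k::{field,finite}) qrep"
    and L :: "int ^ 'n ^ 'n" +
  fixes v :: real and Sub :: "(int ^ 'n \<Rightarrow>\<^sub>0 real) set"
  assumes acyclic: "acyclic (arcs_ends Q)"
    and v2: "v\<^sup>2 = real CARD('k)"
    and Sub_add: "f \<in> Sub \<Longrightarrow> g \<in> Sub \<Longrightarrow> f + g \<in> Sub"
    and Sub_mult: "f \<in> Sub \<Longrightarrow> g \<in> Sub \<Longrightarrow> qtorus_mult L v f g \<in> Sub"
    and Sub_scalar: "r \<in> coeff_ring v \<Longrightarrow> Poly_Mapping.single 0 r \<in> Sub"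
    and Sub_var: "Poly_Mapping.single (axis i 1) 1 \<in> Sub"
    and Sub_mutated: "Poly_Mapping.single (- (P_mat *v axis j 1)) 1
       + Poly_Mapping.single (- (B_mat Q *v axis j 1) - P_mat *v axis j 1) 1 \<in> Sub"
begin

lemma v_nonzero: "v \<noteq> 0"
  using v2 by auto

lemma Sub_0: "0 \<in> Sub"
  using Sub_scalar[OF coeff_ring_0] by simp

lemma Sub_sum: "(\<And>i. i \<in> I \<Longrightarrow> f i \<in> Sub) \<Longrightarrow> sum f I \<in> Sub"
  by (induction I rule: infinite_finite_induct) (auto simp: Sub_0 Sub_add)

lemma Sub_monomial:
  assumes "\<And>i. 0 \<le> p $ i"
  shows "Poly_Mapping.single p 1 \<in> Sub"
  using assms
proof (induction "\<Sum>i\<in>UNIV. nat (p $ i)" arbitrary: p rule: less_induct)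
  case less
  show ?case
  proof (cases "p = 0")
    case True
    thus ?thesis using Sub_scalar[OF coeff_ring_1] by simp
  next
    case False
    then obtain j where j: "p $ j \<noteq> 0" by (auto simp: vec_eq_iff)
    hence j1: "p $ j \<ge> 1" using less.prems[of j] by simp
    define p' where "p' = p - axis j 1"
    have p': "0 \<le> p' $ i" for i using less.prems[of i] j1 by (auto simp: p'_def axis_def)
    have "(\<Sum>i\<in>UNIV. nat (p' $ i)) < (\<Sum>i\<in>UNIV. nat (p $ i))"
    proof (rule sum_strict_mono_ex1)
      show "\<forall>i\<in>UNIV. nat (p' $ i) \<le> nat (p $ i)" by (auto simp: p'_def axis_def)
      show "\<exists>i\<in>UNIV. nat (p' $ i) < nat (p $ i)" using j1 by (intro bexI[of _ j]) (auto simp: p'_def axis_def)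
    qed simp
    hence IH: "Poly_Mapping.single p' 1 \<in> Sub" using less.hyps p' by blast
    \<comment> \<open>The constant undoes the power of v that the twisted product of the two
      monomials introduces.\<close>
    have "Poly_Mapping.single p 1 = qtorus_mult L v (Poly_Mapping.single 0 (v powi - form L (axis j 1) p'))
      (qtorus_mult L v (Poly_Mapping.single (axis j 1) 1) (Poly_Mapping.single p' 1))"
      using v_nonzero by (simp add: qtorus_mult_single p'_def flip: power_int_add)
    thus ?thesis using Sub_mult Sub_scalar coeff_ring_powi Sub_var IH by presburger
  qed
qed

definition Z :: "('n \<Rightarrow> (nat \<Rightarrow> 'k) set) \<Rightarrow> ('n \<Rightarrow> (nat \<Rightarrow> 'k) set) \<Rightarrow> (int ^ 'n \<Rightarrow>\<^sub>0 real)" where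
  "Z S K = (\<Sum>U\<in>interval S K. Poly_Mapping.single
     (- (B_mat Q *v (sdim U - sdim S)) - P_mat *v (sdim K - sdim S))
     (v powi - form (mat 1 + A_mat Q) (sdim U - sdim S) (sdim K - sdim U)))"

lemma form_P_L: "form L (P_mat *v x) (B_mat Q *v f) = - form P_mat f x"
  by (simp add: form_L_B_right form_mat_1_mult_left)

text \<open>Both powers of \<open>v\<close> absorb the same factor, independent of \<open>f\<close>; the first one needs that no arrow
  ends at \<open>j\<close> in the support of \<open>f\<close>, the second one cancels the number of lifts counted in
  \<open>subset_lines_fiber_card\<close>.\<close>

lemma mutated_mult_term:
  fixes e f d :: "int ^ 'n"
  defines "y \<equiv> - (B_mat Q *v f) - P_mat *v d"
  assumes e: "e = axis j 1" and A0: "form (A_mat Q) f e = 0"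
  shows "qtorus_mult L v (Poly_Mapping.single 0 (v powi - form L (P_mat *v e) (P_mat *v d)))
     (qtorus_mult L v (Poly_Mapping.single (- (P_mat *v e)) 1 + Poly_Mapping.single (- (B_mat Q *v e) - P_mat *v e) 1)
       (Poly_Mapping.single y (v powi - form (mat 1 + A_mat Q) f (d - f))))
   = Poly_Mapping.single (- (B_mat Q *v f) - P_mat *v (d + e)) (v powi - form (mat 1 + A_mat Q) f (d + e - f))
   + Poly_Mapping.single (- (B_mat Q *v (f + e)) - P_mat *v (d + e))
       (v powi (2 * (d - f) $ j) * v powi - form (mat 1 + A_mat Q) (f + e) (d - f))"
proof -
  let ?c = "form L (P_mat *v e) (P_mat *v d)" and ?N = "form (mat 1 + A_mat Q)"
  have y1: "- (P_mat *v e) + y = - (B_mat Q *v f) - P_mat *v (d + e)"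
    by (simp add: y_def matrix_vector_right_distrib)
  have y2: "- (B_mat Q *v e) - P_mat *v e + y = - (B_mat Q *v (f + e)) - P_mat *v (d + e)"
    by (simp add: y_def matrix_vector_right_distrib)
  have c1: "- ?c + (- ?N f (d - f) + form L (- (P_mat *v e)) y) = - ?N f (d + e - f)"
    using A0 by (simp add: y_def form_linear form_P_L form_add_mat form_diff_mat)
  have dj: "(d - f) $ j = form (mat 1) e (d - f)" by (simp add: e form_mat_1_axis)
  have c2: "- ?c + (- ?N f (d - f) + form L (- (B_mat Q *v e) - P_mat *v e) y)
      = 2 * (d - f) $ j + - ?N (f + e) (d - f)"
    unfolding dj
    by (simp add: y_def form_linear form_P_L form_L_B_left form_L_B_right form_mat_1_mult_right form_mat_1_mult_left form_add_mat
        form_diff_mat form_B_mat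
        form_mat_1_commute[of f e])
  have "v powi - ?c * (v powi - ?N f (d - f) * v powi form L (- (P_mat *v e)) y) = v powi - ?N f (d + e - f)"
    unfolding c1[symmetric] using v_nonzero by (simp only: power_int_add simp_thms)
  moreover have "v powi - ?c * (v powi - ?N f (d - f) * v powi form L (- (B_mat Q *v e) - P_mat *v e) y)
      = v powi (2 * (d - f) $ j) * v powi - ?N (f + e) (d - f)"
    using v_nonzero c2 by (metis power_int_add)
  ultimately show ?thesis
    by (simp only: qtorus_mult_add_left qtorus_mult_add_right qtorus_mult_single qtorus_mult_scalar y1 y2
        mult_1_left mult_1_right mult.assoc add_0_left form_0_left power_int_0_right)
qed

lemma finite_interval: "(\<And>i. K i \<subseteq> V i) \<Longrightarrow> finite (interval S K)"
  by (rule finite_subset[OF _ finite_subfam]) (unfold interval_def subfam_def, blast)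

text \<open>Away from j the family U agrees with W, so the fibre is described by the possible spaces
  U_j alone, which are those counted in \<open>subset_lines_fiber_card\<close>.\<close>

lemma interval_upd_fiber:
  assumes K0: "fsub K0" "S j \<subseteq> K0" "x \<notin> K0" "vs.span (insert x K0) = K j"
    and W: "W \<in> interval S (K(j := K0))"
  shows "{U \<in> interval S K. \<not> U j \<subseteq> K0 \<and> U(j := U j \<inter> K0) = W} =
    (\<lambda>Y. W(j := Y)) ` {U. vs.subspace U \<and> U \<subseteq> vs.span (insert x K0) \<and> U \<inter> K0 = W j \<and> \<not> U \<subseteq> K0}"
    (is "?A = ?f ` ?F")
proof
  have Wj: "vs.subspace (W i)" "S i \<subseteq> W i" "i \<noteq> j \<Longrightarrow> W i \<subseteq> K i" "W j \<subseteq> K0" for i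
    using W by (auto simp: interval_def split: if_splits)
  show "?A \<subseteq> ?f ` ?F"
  proof
    fix U assume U: "U \<in> ?A"
    hence "U j \<in> ?F" using K0(4) by (auto simp: interval_def)
    moreover have "U = ?f (U j)" using U by (auto simp: fun_eq_iff split: if_splits)
    ultimately show "U \<in> ?f ` ?F" by (rule rev_image_eqI)
  qed
  show "?f ` ?F \<subseteq> ?A"
  proof
    fix U assume "U \<in> ?f ` ?F"
    then obtain Y where Y: "vs.subspace Y" "Y \<subseteq> K j" "Y \<inter> K0 = W j" "\<not> Y \<subseteq> K0" "U = W(j := Y)"
      using K0(4) by blast
    moreover have "S j \<subseteq> Y" using Y(3) Wj(2)[of j] by blast
    ultimately show "U \<in> ?A" using Wj by (auto simp: interval_def fun_eq_iff)
  qed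
qed

lemma sdim_upd: "sdim (W(j := Y)) = sdim W + axis j (int (vs.dim Y) - int (vs.dim (W j)))"
  by (simp add: sdim_def vec_eq_iff axis_def)

text \<open>Families with U_j inside the hyperplane K0 give the first monomial of x'_j times the
  smaller sum. The others are grouped by their intersection W with K0; the number of lifts of W is
  exactly the power of v that the second monomial of x'_j produces. The hypothesis
  \<open>src\<close> excludes any contribution of arrows into j to the form A(U - S, e_j), without
  which the two monomials would not match a common factor.\<close>

lemma Z_step:
  assumes K0: "fsub K0" "S j \<subseteq> K0" "x \<notin> K0" "vs.span (insert x K0) = K j" "vs.dim (K j) = Suc (vs.dim K0)"
    and KV: "\<And>i. K i \<subseteq> V i"
    and src: "\<And>a. a \<in> arcs Q \<Longrightarrow> head Q a = j \<Longrightarrow> S (tail Q a) = K (tail Q a)"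
  shows "Z S K = qtorus_mult L v
     (Poly_Mapping.single 0 (v powi - form L (P_mat *v axis j 1) (P_mat *v (sdim (K(j := K0)) - sdim S))))
     (qtorus_mult L v (Poly_Mapping.single (- (P_mat *v axis j 1)) 1
        + Poly_Mapping.single (- (B_mat Q *v axis j 1) - P_mat *v axis j 1) 1) (Z S (K(j := K0))))"
proof -
  let ?K' = "K(j := K0)" and ?e = "axis j 1 :: int ^ 'n" and ?N = "form (mat 1 + A_mat Q)"
  define T where "T f d = Poly_Mapping.single (- (B_mat Q *v f) - P_mat *v d) (v powi - ?N f (d - f))" for f d
  let ?d = "sdim ?K' - sdim S"
  have KK': "sdim K = sdim ?K' + ?e" by (simp add: sdim_upd K0(5) vec_eq_iff axis_def)
  have K0K: "K0 \<subseteq> K j" using vs.span_superset[of "insert x K0"] unfolding K0(4) by blast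
  have K'V: "?K' i \<subseteq> V i" for i using KV K0K by (cases "i = j") auto
  have ZT: "Z S K = (\<Sum>U\<in>interval S K. T (sdim U - sdim S) (?d + ?e))" and
       ZT': "Z S ?K' = (\<Sum>U\<in>interval S ?K'. T (sdim U - sdim S) ?d)"
    unfolding Z_def T_def by (simp_all add: KK' algebra_simps)
  have fin: "finite (interval S K)" "finite (interval S ?K')" using finite_interval KV K'V by blast+
  let ?I1 = "{U \<in> interval S K. U j \<subseteq> K0}" and ?I2 = "{U \<in> interval S K. \<not> U j \<subseteq> K0}"
  have I1: "?I1 = interval S ?K'"
  proof
    show "?I1 \<subseteq> interval S ?K'" by (auto simp: interval_def)
    show "interval S ?K' \<subseteq> ?I1"
    proof
      fix U assume U: "U \<in> interval S ?K'"
      have "U i \<subseteq> K i" for i using U K0K by (cases "i = j") (auto simp: interval_def split: if_splits)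
      thus "U \<in> ?I1" using U by (auto simp: interval_def split: if_splits)
    qed
  qed
  \<comment> \<open>Intersecting with K0 at j maps the remaining families into the smaller interval;
    the lower bound survives because S_j lies in K0.\<close>
  have img: "(\<lambda>U. U(j := U j \<inter> K0)) ` ?I2 \<subseteq> interval S ?K'"
  proof (rule image_subsetI)
    fix U assume U: "U \<in> ?I2"
    have *: "vs.subspace (U i)" "S i \<subseteq> U i" "U i \<subseteq> K i" for i
      using U unfolding interval_def by blast+
    show "U(j := U j \<inter> K0) \<in> interval S ?K'"
      using K0(2) fsubD(1)[OF K0(1)]
      by (auto simp: interval_def dest: subsetD[OF *(2)] subsetD[OF *(3)] intro!: vs.subspace_inter *(1))
  qed
  have fiber: "(\<Sum>U\<in>{U \<in> ?I2. U(j := U j \<inter> K0) = W}. T (sdim U - sdim S) (?d + ?e)) =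
      Poly_Mapping.single (- (B_mat Q *v ((sdim W - sdim S) + ?e)) - P_mat *v (?d + ?e))
       (v powi (2 * (?d - (sdim W - sdim S)) $ j) * v powi - ?N ((sdim W - sdim S) + ?e) (?d - (sdim W - sdim S)))"
    if W: "W \<in> interval S ?K'" for W
  proof -
    let ?F = "{U. vs.subspace U \<and> U \<subseteq> vs.span (insert x K0) \<and> U \<inter> K0 = W j \<and> \<not> U \<subseteq> K0}"
    have "vs.subspace (W j) \<and> W j \<subseteq> ?K' j" using W unfolding interval_def by blast
    hence Wj: "vs.subspace (W j)" "W j \<subseteq> K0" by simp_all
    note F = subset_lines_fiber_card[OF K0(1) Wj K0(3)]
    have inj: "inj_on (\<lambda>Y. W(j := Y)) ?F" by (auto simp: inj_on_def dest: fun_upd_eqD)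
    have "{U \<in> ?I2. U(j := U j \<inter> K0) = W} = (\<lambda>Y. W(j := Y)) ` ?F"
      using interval_upd_fiber[of K0 S j x K W] K0 W by auto
    hence "(\<Sum>U\<in>{U \<in> ?I2. U(j := U j \<inter> K0) = W}. T (sdim U - sdim S) (?d + ?e))
       = (\<Sum>Y\<in>?F. T (sdim (W(j := Y)) - sdim S) (?d + ?e))"
      by (simp add: sum.reindex[OF inj])
    also have "\<dots> = (\<Sum>Y\<in>?F. T ((sdim W - sdim S) + ?e) (?d + ?e))"
    proof (rule sum.cong[OF refl])
      fix Y assume "Y \<in> ?F"
      hence "vs.dim Y = Suc (vs.dim (W j))" by (rule F(2))
      hence "sdim (W(j := Y)) - sdim S = (sdim W - sdim S) + ?e" by (simp add: sdim_upd)
      thus "T (sdim (W(j := Y)) - sdim S) (?d + ?e) = T ((sdim W - sdim S) + ?e) (?d + ?e)" by (simp only:)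
    qed
    also have "\<dots> = Poly_Mapping.single (- (B_mat Q *v ((sdim W - sdim S) + ?e)) - P_mat *v (?d + ?e))
       (real (card ?F) * v powi - ?N ((sdim W - sdim S) + ?e) (?d - (sdim W - sdim S)))"
      unfolding T_def single_sum[symmetric] by (simp add: algebra_simps)
    also have "real (card ?F) = v powi (2 * (?d - (sdim W - sdim S)) $ j)"
    proof -
      have "vs.dim (W j) \<le> vs.dim K0" by (rule fsub_dim_mono[OF K0(1) Wj(2,1)])
      hence "(?d - (sdim W - sdim S)) $ j = int (vs.dim K0 - vs.dim (W j))"
        by (simp add: sdim_def of_nat_diff)
      thus ?thesis using F(1) v2 by (simp add: powi_2_mult_nat)
    qed
    finally show ?thesis .
  qed
  have "Z S K = (\<Sum>U\<in>?I1. T (sdim U - sdim S) (?d + ?e)) + (\<Sum>U\<in>?I2. T (sdim U - sdim S) (?d + ?e))"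
    unfolding ZT by (subst sum.union_disjoint[symmetric]) (use fin in \<open>auto intro!: sum.cong\<close>)
  also have "(\<Sum>U\<in>?I2. T (sdim U - sdim S) (?d + ?e)) =
     (\<Sum>W\<in>interval S ?K'. \<Sum>U\<in>{U \<in> ?I2. U(j := U j \<inter> K0) = W}. T (sdim U - sdim S) (?d + ?e))"
    by (rule sum.group[symmetric]) (use fin img in auto)
  also have "(\<Sum>U\<in>?I1. T (sdim U - sdim S) (?d + ?e)) + \<dots> =
     (\<Sum>W\<in>interval S ?K'. T (sdim W - sdim S) (?d + ?e) +
      Poly_Mapping.single (- (B_mat Q *v ((sdim W - sdim S) + ?e)) - P_mat *v (?d + ?e))
       (v powi (2 * (?d - (sdim W - sdim S)) $ j) * v powi - ?N ((sdim W - sdim S) + ?e) (?d - (sdim W - sdim S))))"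
    unfolding I1 sum.distrib by (intro arg_cong2[where f = "(+)"] sum.cong refl fiber)
  also have "\<dots> = (\<Sum>W\<in>interval S ?K'. qtorus_mult L v
     (Poly_Mapping.single 0 (v powi - form L (P_mat *v axis j 1) (P_mat *v ?d)))
     (qtorus_mult L v (Poly_Mapping.single (- (P_mat *v axis j 1)) 1
        + Poly_Mapping.single (- (B_mat Q *v axis j 1) - P_mat *v axis j 1) 1) (T (sdim W - sdim S) ?d)))"
  proof (rule sum.cong[OF refl])
    fix W assume W: "W \<in> interval S ?K'"
    \<comment> \<open>An arrow into j starts where S and K agree, which forces W = S there; for any
      other arrow the second factor is 0.\<close>
    have "(sdim W - sdim S) $ tail Q a * ?e $ head Q a = 0" if a: "a \<in> arcs Q" for a
    proof (cases "head Q a = j")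
      case True
      hence "S (tail Q a) = K (tail Q a)" using src a by blast
      moreover have "S (tail Q a) \<subseteq> W (tail Q a)" "W (tail Q a) \<subseteq> K (tail Q a)"
        using W K0K unfolding interval_def by (auto split: if_splits)
      ultimately have "W (tail Q a) = S (tail Q a)" by blast
      thus ?thesis by (simp add: sdim_def)
    qed (simp add: axis_def)
    hence "form (A_mat Q) (sdim W - sdim S) ?e = 0"
      unfolding form_A_mat[OF finite_arcs] by (intro sum.neutral ballI)
    from mutated_mult_term[OF refl this, of ?d]
    show "T (sdim W - sdim S) (?d + ?e) +
      Poly_Mapping.single (- (B_mat Q *v ((sdim W - sdim S) + ?e)) - P_mat *v (?d + ?e))
       (v powi (2 * (?d - (sdim W - sdim S)) $ j) * v powi - ?N ((sdim W - sdim S) + ?e) (?d - (sdim W - sdim S)))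
      = qtorus_mult L v
     (Poly_Mapping.single 0 (v powi - form L (P_mat *v axis j 1) (P_mat *v ?d)))
     (qtorus_mult L v (Poly_Mapping.single (- (P_mat *v axis j 1)) 1
        + Poly_Mapping.single (- (B_mat Q *v axis j 1) - P_mat *v axis j 1) 1) (T (sdim W - sdim S) ?d))"
      unfolding T_def by (simp only:)
  qed
  also have "\<dots> = qtorus_mult L v
     (Poly_Mapping.single 0 (v powi - form L (P_mat *v axis j 1) (P_mat *v ?d)))
     (qtorus_mult L v (Poly_Mapping.single (- (P_mat *v axis j 1)) 1
        + Poly_Mapping.single (- (B_mat Q *v axis j 1) - P_mat *v axis j 1) 1) (Z S ?K'))"
    unfolding ZT' qtorus_mult_sum_right ..
  finally show ?thesis .
qed

lemma Z_mem:
  assumes "\<And>i. vs.subspace (S i)" "\<And>i. vs.subspace (K i)" "\<And>i. S i \<subseteq> K i" "\<And>i. K i \<subseteq> V i"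
  shows "Z S K \<in> Sub"
  using assms(2-4)
proof (induction "\<Sum>i\<in>UNIV. vs.dim (K i)" arbitrary: K rule: less_induct)
  case less
  show ?case
  proof (cases "S = K")
    case True
    \<comment> \<open>The base of the recursion: the interval has a single member, and its monomial
      is the unit of the torus.\<close>
    hence "U \<in> interval S K \<longleftrightarrow> U = S" for U
      using assms(1) unfolding interval_def fun_eq_iff by (auto dest: subset_antisym)
    hence "interval S K = {S}" by blast
    hence "Z S K = Poly_Mapping.single 0 1" using True by (simp add: Z_def matrix_vector_mult_0_right)
    thus ?thesis using Sub_scalar[OF coeff_ring_1] by simp
  next
    case False
    then obtain j0 where j0: "S j0 \<noteq> K j0" by (auto simp: fun_eq_iff)
    \<comment> \<open>A finite acyclic relation is well-founded, so among the vertices where S and K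
      differ there is one that no arrow enters from another such vertex. This is the hypothesis
      \<open>src\<close> of the recursion.\<close>
    have "finite (arcs_ends Q)" using finite_arcs by (simp add: arcs_ends_def)
    hence "wf (arcs_ends Q)" using acyclic by (rule finite_acyclic_wf)
    then obtain j where j: "j \<in> {j. S j \<noteq> K j}" "\<And>i. (i, j) \<in> arcs_ends Q \<Longrightarrow> i \<notin> {j. S j \<noteq> K j}"
      using wfE_min[of "arcs_ends Q" j0 "{j. S j \<noteq> K j}"] j0 by blast
    have fK: "fsub (K j)" using fsub_subspace[OF fsub_V] less.prems by blast
    obtain K0 x where K0: "fsub K0" "S j \<subseteq> K0" "K0 \<subseteq> K j" "x \<notin> K0" "vs.span (insert x K0) = K j"
        "vs.dim (K j) = Suc (vs.dim K0)"
      using fsub_hyperplane[OF fK assms(1) less.prems(2)] j(1) by blast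
    have src: "S (tail Q a) = K (tail Q a)" if "a \<in> arcs Q" "head Q a = j" for a
    proof -
      have "(tail Q a, j) \<in> arcs_ends Q" using that by (auto simp: arcs_ends_def arc_to_ends_def)
      thus ?thesis using j(2) by blast
    qed
    have "Z S (K(j := K0)) \<in> Sub"
    proof (rule less.hyps)
      show "(\<Sum>i\<in>UNIV. vs.dim ((K(j := K0)) i)) < (\<Sum>i\<in>UNIV. vs.dim (K i))"
        by (rule sum_strict_mono_ex1) (use K0(6) in auto)
      show "vs.subspace ((K(j := K0)) i)" for i using less.prems(1) fsubD(1)[OF K0(1)] by simp
      show "S i \<subseteq> (K(j := K0)) i" for i using less.prems(2) K0(2) by simp
      show "(K(j := K0)) i \<subseteq> V i" for i using less.prems(3)[of i] less.prems(3)[of j] K0(3) by auto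
    qed
    moreover obtain r where "Z S K = qtorus_mult L v (Poly_Mapping.single 0 (v powi r))
        (qtorus_mult L v (Poly_Mapping.single (- (P_mat *v axis j 1)) 1
          + Poly_Mapping.single (- (B_mat Q *v axis j 1) - P_mat *v axis j 1) 1) (Z S (K(j := K0))))"
      using Z_step[OF K0(1,2,4,5,6) less.prems(3) src] by blast
    ultimately show ?thesis
      by (simp only: Sub_mult Sub_scalar coeff_ring_powi Sub_mutated)
  qed
qed

text \<open>With u = s + f and m = s + d + t the exponent splits as -B u - P m = (R s - t) + (-B f -
  P d) + (A t - s), and the middle term belongs to Z. The sides are dictated by the twist: with R s
  - t on the left and A t - s on the right, the commutation with -B f yields exactly the terms
  linear in f by which the form 1 + A at (u, m - u) differs from that at (f, d - f). On the opposite
  sides they would have the wrong sign.\<close>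

lemma interval_sum_mem:
  assumes g: "g \<in> opmaps" and \<theta>: "\<theta> \<in> coeff_ring v"
  shows "(\<Sum>U\<in>interval (gim g) (gker g). Poly_Mapping.single (- (B_mat Q *v sdim U) - P_mat *v dimv M)
       (\<theta> * v powi (- form (mat 1 + A_mat Q) (sdim U) (dimv M - sdim U)))) \<in> Sub"
proof (cases "interval (gim g) (gker g) = {}")
  case True
  thus ?thesis by (simp add: Sub_0)
next
  case False
  let ?S = "gim g" and ?K = "gker g"
  have SK: "?S i \<subseteq> ?K i" for i using False unfolding interval_def by blast
  define s k m where "s = sdim ?S" and "k = sdim ?K" and "m = dimv M"
  define d t where "d = k - s" and "t = m - k"
  define p1 p2 where "p1 = R_mat Q *v s - t" and "p2 = A_mat Q *v t - s"
  have m: "m = s + d + t" by (simp add: d_def t_def)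
  have kle: "vs.dim (?K i) \<le> dV i" for i
    by (rule fsub_dim_mono[OF fsub_V gker_subset subspace_gker[OF g]])
  have "0 \<le> p1 $ i" for i
  proof -
    have "t $ i = int (dV i - vs.dim (?K i))"
      using kle[of i] by (simp add: t_def m_def k_def dimv_def sdim_def of_nat_diff)
    also have "\<dots> \<le> int (\<Sum>a\<in>{a \<in> arcs Q. head Q a = i}. vs.dim (?S (tail Q a)))"
      using gker_codim_le[OF g, of i] by (simp only: of_nat_le_iff)
    finally show ?thesis by (simp add: p1_def R_mat_mult_vec finite_arcs s_def sdim_def)
  qed
  hence p1: "Poly_Mapping.single p1 1 \<in> Sub" by (rule Sub_monomial)
  have "0 \<le> p2 $ i" for i
  proof -
    have "s $ i = int (vs.dim (?S i))" by (simp add: s_def sdim_def)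
    also have "\<dots> \<le> int (\<Sum>a\<in>{a \<in> arcs Q. tail Q a = i}. dV (head Q a) - vs.dim (?K (head Q a)))"
      using gim_dim_le[OF g, of i] by (simp only: of_nat_le_iff)
    also have "\<dots> = (\<Sum>a\<in>{a \<in> arcs Q. tail Q a = i}. t $ head Q a)"
      using kle by (simp add: t_def m_def k_def dimv_def sdim_def of_nat_diff)
    finally show ?thesis
      unfolding p2_def vector_minus_component A_mat_mult_vec[OF finite_arcs] by simp
  qed
  hence p2: "Poly_Mapping.single p2 1 \<in> Sub" by (rule Sub_monomial)
  let ?N = "form (mat 1 + A_mat Q)"
  \<comment> \<open>What remains of the exponent of v once all terms containing f have cancelled; it
    is the same for every U and can leave the sum.\<close>
  define c where "c = - ?N s t - ?N s d + form L (P_mat *v d) p2 + form L p1 (P_mat *v d) - form L p1 p2"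
  have summand: "Poly_Mapping.single (- (B_mat Q *v sdim U) - P_mat *v m) (\<theta> * v powi (- ?N (sdim U) (m - sdim U)))
     = qtorus_mult L v (Poly_Mapping.single 0 (\<theta> * v powi c))
       (qtorus_mult L v (Poly_Mapping.single p1 1)
         (qtorus_mult L v (Poly_Mapping.single (- (B_mat Q *v (sdim U - s)) - P_mat *v d)
           (v powi - ?N (sdim U - s) (k - sdim U))) (Poly_Mapping.single p2 1)))" for U
  proof -
    define f where "f = sdim U - s"
    have U: "sdim U = s + f" "k - sdim U = d - f" "m - sdim U = t + d - f"
      by (simp_all add: f_def d_def m)
    let ?y = "- (B_mat Q *v f) - P_mat *v d"
    have y: "p1 + (?y + p2) = - (B_mat Q *v (s + f)) - P_mat *v m"
      unfolding m p1_def p2_def B_mat_eq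
      by (simp add: matrix_vector_right_distrib matrix_vector_mult_diff_rdistrib)
    have p1f: "form (mat 1) p1 f = form (A_mat Q) s f - form (mat 1) t f"
      unfolding p1_def using form_transpose[of "R_mat Q" s f]
      by (simp add: form_diff_left form_mat_1_mult_left)
    have p2f: "form (mat 1) f p2 = form (A_mat Q) f t - form (mat 1) f s"
      unfolding p2_def by (simp add: form_diff_right form_mat_1_mult_right del: transpose_matrix_vector)
    have "c + (- ?N f (d - f) + form L ?y p2 + form L p1 (?y + p2)) = - ?N (s + f) (t + d - f)"
      using p1f p2f
      by (simp add: c_def form_linear form_L_B_left form_L_B_right form_add_mat form_mat_1_commute[of t f]
          form_mat_1_commute[of f s])
    hence "v powi c * (v powi - ?N f (d - f) * v powi form L ?y p2 * v powi form L p1 (?y + p2))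
      = v powi - ?N (s + f) (t + d - f)"
      using v_nonzero by (metis power_int_add)
    thus ?thesis
      unfolding f_def[symmetric] U(2,3) unfolding U(1) qtorus_mult_single qtorus_mult_scalar y
      by (simp add: mult.assoc)
  qed
  have "(\<Sum>U\<in>interval ?S ?K. Poly_Mapping.single (- (B_mat Q *v sdim U) - P_mat *v m)
       (\<theta> * v powi (- ?N (sdim U) (m - sdim U)))) = qtorus_mult L v (Poly_Mapping.single 0 (\<theta> * v powi c))
       (qtorus_mult L v (Poly_Mapping.single p1 1) (qtorus_mult L v (Z ?S ?K) (Poly_Mapping.single p2 1)))"
    unfolding Z_def s_def[symmetric] k_def[symmetric] d_def[symmetric]
    unfolding qtorus_mult_sum_right qtorus_mult_sum_left by (rule sum.cong[OF refl summand])
  also have "\<dots> \<in> Sub"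
    by (intro Sub_mult Sub_scalar p1 p2 Z_mem SK subspace_gim subspace_gker[OF g] gker_subset
        coeff_ring_mult v_nonzero \<theta> coeff_ring_powi)
  finally show ?thesis unfolding m_def .
qed

lemma theta_coeff_ring: "theta y \<in> coeff_ring v"
proof -
  have "theta y = of_int (of_bool (y = 0) - of_bool (y = 1))" by (simp add: theta_def)
  thus ?thesis using coeff_ring_of_int by metis
qed

theorem quantum_character_mem:
  assumes "\<And>U. U \<in> submodules Q M \<Longrightarrow>
      euler TYPE('k) Q (sdim U) (dimv M - sdim U) = form P_mat (sdim U) (dimv M - sdim U)"
  shows "quantum_character Q v M \<in> Sub"
proof -
  have "(\<Sum>g\<in>opmaps. \<Sum>U\<in>interval (gim g) (gker g). Poly_Mapping.single (- (B_mat Q *v sdim U) - P_mat *v dimv M)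
       (theta (pairing g) * v powi (- form (mat 1 + A_mat Q) (sdim U) (dimv M - sdim U)))) \<in> Sub"
    by (intro Sub_sum interval_sum_mem theta_coeff_ring)
  thus ?thesis using quantum_character_eq_sum_intervals[OF v2 assms] by simp
qed

end

section \<open>Morphisms and extensions\<close>

lemma linear_betweenI:
  assumes "\<And>x. x \<in> V \<Longrightarrow> f x \<in> W"
    and "\<And>x y. x \<in> V \<Longrightarrow> y \<in> V \<Longrightarrow> f (x + y) = f x + f y"
    and "\<And>c x. x \<in> V \<Longrightarrow> f (vscale c x) = vscale c (f x)"
  shows "linear_between V W f"
  using assms unfolding linear_between_def by blast

lemma linear_betweenD:
  assumes "linear_between V W f"
  shows "x \<in> V \<Longrightarrow> f x \<in> W"
    and "x \<in> V \<Longrightarrow> y \<in> V \<Longrightarrow> f (x + y) = f x + f y"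
    and "x \<in> V \<Longrightarrow> f (vscale c x) = vscale c (f x)"
  using assms unfolding linear_between_def by blast+

lemma fsub_closed:
  assumes "fsub V"
  shows "x \<in> V \<Longrightarrow> y \<in> V \<Longrightarrow> x + y \<in> V" "x \<in> V \<Longrightarrow> y \<in> V \<Longrightarrow> x - y \<in> V" "x \<in> V \<Longrightarrow> vscale c x \<in> V"
  using fsubD(1)[OF assms] vs.subspace_add vs.subspace_diff vs.subspace_scale by blast+

lemma HomI:
  assumes "\<And>i. linear_between (vsp M i) (vsp N i) (\<phi> i)" "\<And>i x. x \<notin> vsp M i \<Longrightarrow> \<phi> i x = 0"
    and "\<And>a x. a \<in> arcs Q \<Longrightarrow> x \<in> vsp M (tail Q a) \<Longrightarrow> \<phi> (head Q a) (vmap M a x) = vmap N a (\<phi> (tail Q a) x)"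
  shows "\<phi> \<in> Hom Q M N"
  using assms by (simp add: Hom_def)

lemma HomD:
  assumes "\<phi> \<in> Hom Q M N"
  shows "linear_between (vsp M i) (vsp N i) (\<phi> i)" "x \<notin> vsp M i \<Longrightarrow> \<phi> i x = 0"
    "a \<in> arcs Q \<Longrightarrow> x \<in> vsp M (tail Q a) \<Longrightarrow> \<phi> (head Q a) (vmap M a x) = vmap N a (\<phi> (tail Q a) x)"
  using assms by (auto simp: Hom_def)

lemma reps_fsub: "M \<in> reps Q \<Longrightarrow> fsub (vsp M i :: (nat \<Rightarrow> 'k::{field,finite}) set)"
  by (simp add: reps_def flip: fd_space_iff_fsub)

lemma reps_linear: "M \<in> reps Q \<Longrightarrow> a \<in> arcs Q \<Longrightarrow> linear_between (vsp M (tail Q a)) (vsp M (head Q a)) (vmap M a)"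
  by (simp add: reps_def)

lemma Iso_refl:
  fixes M :: "('n, 'a, 'k::{field,finite}) qrep"
  assumes M: "M \<in> reps Q"
  shows "(\<lambda>i x. if x \<in> vsp M i then x else 0) \<in> Iso Q M M"
proof -
  have "(\<lambda>i x. if x \<in> vsp M i then x else 0) \<in> Hom Q M M"
  proof (rule HomI)
    show "linear_between (vsp M i) (vsp M i) (\<lambda>x. if x \<in> vsp M i then x else 0)" for i
      using fsub_closed[OF reps_fsub[OF M]] by (intro linear_betweenI) simp_all
  qed (use linear_betweenD(1)[OF reps_linear[OF M]] in auto)
  moreover have "bij_betw (\<lambda>x. if x \<in> vsp M i then x else 0) (vsp M i) (vsp M i)" for i
    by (rule bij_betw_byWitness[where f' = "\<lambda>x. x"]) auto
  ultimately show ?thesis by (simp add: Iso_def)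
qed

lemma Iso_sym:
  fixes M N :: "('n, 'a, 'k::{field,finite}) qrep"
  assumes M: "M \<in> reps Q" and N: "N \<in> reps Q" and \<phi>: "\<phi> \<in> Iso Q M N"
  defines "\<psi> \<equiv> \<lambda>i y. if y \<in> vsp N i then inv_into (vsp M i) (\<phi> i) y else 0"
  shows "\<psi> \<in> Iso Q N M"
    and "\<And>i x. x \<in> vsp M i \<Longrightarrow> \<psi> i (\<phi> i x) = x" "\<And>i y. y \<in> vsp N i \<Longrightarrow> \<phi> i (\<psi> i y) = y"
proof -
  have h: "\<phi> \<in> Hom Q M N" and b: "\<And>i. bij_betw (\<phi> i) (vsp M i) (vsp N i)" using \<phi> by (auto simp: Iso_def)
  note l = HomD(1)[OF h]
  show 1: "\<psi> i (\<phi> i x) = x" if "x \<in> vsp M i" for i x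
    using that linear_betweenD(1)[OF l that] bij_betw_inv_into_left[OF b that] by (simp add: \<psi>_def)
  show 2: "\<phi> i (\<psi> i y) = y" if "y \<in> vsp N i" for i y
    using that bij_betw_inv_into_right[OF b that] by (simp add: \<psi>_def)
  have mem: "\<psi> i y \<in> vsp M i" if "y \<in> vsp N i" for i y
    using that bij_betw_apply[OF bij_betw_inv_into[OF b]] by (simp add: \<psi>_def)
  note cM = fsub_closed[OF reps_fsub[OF M]] and cN = fsub_closed[OF reps_fsub[OF N]]
  have "\<psi> \<in> Hom Q N M"
  proof (rule HomI)
    show "linear_between (vsp N i) (vsp M i) (\<psi> i)" for i
    proof (rule linear_betweenI)
      show "\<psi> i (x + y) = \<psi> i x + \<psi> i y" if "x \<in> vsp N i" "y \<in> vsp N i" for x y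
      proof -
        have "\<phi> i (\<psi> i x + \<psi> i y) = x + y" using that mem 2 linear_betweenD(2)[OF l] by simp
        thus ?thesis using 1[of "\<psi> i x + \<psi> i y" i] cM(1) mem that by metis
      qed
      show "\<psi> i (vscale c x) = vscale c (\<psi> i x)" if "x \<in> vsp N i" for x c
      proof -
        have "\<phi> i (vscale c (\<psi> i x)) = vscale c x" using that mem 2 linear_betweenD(3)[OF l] by simp
        thus ?thesis using 1[of "vscale c (\<psi> i x)" i] cM(3) mem that by metis
      qed
    qed (rule mem)
    show "\<psi> i x = 0" if "x \<notin> vsp N i" for i x using that by (simp add: \<psi>_def)
    show "\<psi> (head Q a) (vmap N a y) = vmap M a (\<psi> (tail Q a) y)" if a: "a \<in> arcs Q" and y: "y \<in> vsp N (tail Q a)" for a y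
    proof -
      have "\<phi> (head Q a) (vmap M a (\<psi> (tail Q a) y)) = vmap N a y"
        using HomD(3)[OF h a mem[OF y]] 2[OF y] by simp
      thus ?thesis
        using 1[OF linear_betweenD(1)[OF reps_linear[OF M a] mem[OF y]]] by metis
    qed
  qed
  moreover have "bij_betw (\<psi> i) (vsp N i) (vsp M i)" for i
    by (rule bij_betw_byWitness[where f' = "\<phi> i"]) (use 1 2 mem linear_betweenD(1)[OF l] in auto)
  ultimately show "\<psi> \<in> Iso Q N M" by (simp add: Iso_def)
qed

lemma Iso_trans:
  fixes M N E :: "('n, 'a, 'k::{field,finite}) qrep"
  assumes M: "M \<in> reps Q" and N: "N \<in> reps Q" and E: "E \<in> reps Q" and \<phi>: "\<phi> \<in> Iso Q M N" and \<psi>: "\<psi> \<in> Iso Q N E"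
  shows "(\<lambda>i. \<psi> i \<circ> \<phi> i) \<in> Iso Q M E"
proof -
  have h: "\<phi> \<in> Hom Q M N" "\<psi> \<in> Hom Q N E" and b: "\<And>i. bij_betw (\<phi> i) (vsp M i) (vsp N i)"
    "\<And>i. bij_betw (\<psi> i) (vsp N i) (vsp E i)" using \<phi> \<psi> by (auto simp: Iso_def)
  have "(\<lambda>i. \<psi> i \<circ> \<phi> i) \<in> Hom Q M E"
  proof (rule HomI)
    show "linear_between (vsp M i) (vsp E i) (\<psi> i \<circ> \<phi> i)" for i
      using linear_between_comp HomD(1)[OF h(1)] HomD(1)[OF h(2)] .
    show "(\<psi> i \<circ> \<phi> i) x = 0" if "x \<notin> vsp M i" for i x
      using HomD(2)[OF h(1) that] linear_between_0[OF reps_fsub[OF N] HomD(1)[OF h(2)]] by simp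
    show "(\<psi> (head Q a) \<circ> \<phi> (head Q a)) (vmap M a x) = vmap E a ((\<psi> (tail Q a) \<circ> \<phi> (tail Q a)) x)"
      if "a \<in> arcs Q" "x \<in> vsp M (tail Q a)" for a x
      using HomD(3)[OF h(1) that] HomD(3)[OF h(2) that(1) linear_betweenD(1)[OF HomD(1)[OF h(1)] that(2)]] by simp
  qed
  thus ?thesis using bij_betw_trans[OF b] by (simp add: Iso_def)
qed

lemma Iso_mem: "\<phi> \<in> Iso Q M N \<Longrightarrow> x \<in> vsp M i \<Longrightarrow> \<phi> i x \<in> vsp N i"
  using bij_betw_apply unfolding Iso_def by fast

lemma ses_equiv_iff:
  "((E, f, g), (E', f', g')) \<in> ses_equiv Q M N \<longleftrightarrow>
     (E, f, g) \<in> short_exact Q M N \<and> (E', f', g') \<in> short_exact Q M N \<and>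
     (\<exists>\<phi>\<in>Iso Q E E'. \<forall>i. (\<forall>x\<in>vsp N i. \<phi> i (f i x) = f' i x) \<and> (\<forall>x\<in>vsp E i. g' i (\<phi> i x) = g i x))"
  by (simp add: ses_equiv_def)

lemma equiv_ses_equiv:
  fixes M N :: "('n, 'a, 'k::{field,finite}) qrep"
  shows "equiv (short_exact Q M N) (ses_equiv Q M N)"
proof (rule equivI)
  show "ses_equiv Q M N \<subseteq> short_exact Q M N \<times> short_exact Q M N" by (auto simp: ses_equiv_def)
  show "refl_on (short_exact Q M N) (ses_equiv Q M N)"
  proof (rule refl_onI)
    fix s assume s: "s \<in> short_exact Q M N"
    obtain E f g where sE: "s = (E, f, g)" by (cases s)
    have E: "E \<in> reps Q" and f: "f \<in> Hom Q N E" using s sE by (auto simp: short_exact_def)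
    define e where "e = (\<lambda>i x. if x \<in> vsp E i then x else 0)"
    have "e \<in> Iso Q E E" unfolding e_def by (rule Iso_refl[OF E])
    moreover have "\<forall>i. (\<forall>x\<in>vsp N i. e i (f i x) = f i x) \<and> (\<forall>x\<in>vsp E i. g i (e i x) = g i x)"
      using linear_betweenD(1)[OF HomD(1)[OF f]] by (auto simp: e_def)
    ultimately show "(s, s) \<in> ses_equiv Q M N" using s unfolding sE ses_equiv_iff by blast
  qed
  show "sym (ses_equiv Q M N)"
  proof (rule symI)
    fix s t assume st: "(s, t) \<in> ses_equiv Q M N"
    obtain E f g E' f' g' where sE: "s = (E, f, g)" "t = (E', f', g')" by (cases s, cases t)
    obtain \<phi> where \<phi>: "\<phi> \<in> Iso Q E E'" "\<And>i x. x \<in> vsp N i \<Longrightarrow> \<phi> i (f i x) = f' i x"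
        "\<And>i x. x \<in> vsp E i \<Longrightarrow> g' i (\<phi> i x) = g i x"
      and se: "(E, f, g) \<in> short_exact Q M N" "(E', f', g') \<in> short_exact Q M N"
      using st unfolding sE ses_equiv_iff by blast
    have E: "E \<in> reps Q" "E' \<in> reps Q" and f: "f \<in> Hom Q N E" using se by (auto simp: short_exact_def)
    define \<psi> where "\<psi> = (\<lambda>i y. if y \<in> vsp E' i then inv_into (vsp E i) (\<phi> i) y else 0)"
    have \<psi>: "\<psi> \<in> Iso Q E' E" and 1: "\<And>i x. x \<in> vsp E i \<Longrightarrow> \<psi> i (\<phi> i x) = x"
      and 2: "\<And>i y. y \<in> vsp E' i \<Longrightarrow> \<phi> i (\<psi> i y) = y"
      using Iso_sym[OF E \<phi>(1)] unfolding \<psi>_def by blast+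
    have mem: "y \<in> vsp E' i \<Longrightarrow> \<psi> i y \<in> vsp E i" for i y
      using \<psi> by (rule Iso_mem)
    have "\<psi> i (f' i x) = f i x" if "x \<in> vsp N i" for i x
      using \<phi>(2)[OF that] 1[OF linear_betweenD(1)[OF HomD(1)[OF f] that]] by simp
    moreover have "g i (\<psi> i y) = g' i y" if "y \<in> vsp E' i" for i y
      using \<phi>(3)[OF mem[OF that]] 2[OF that] by simp
    ultimately show "(t, s) \<in> ses_equiv Q M N" using se \<psi> unfolding sE ses_equiv_iff by blast
  qed
  show "trans (ses_equiv Q M N)"
  proof (rule transI)
    fix s t u assume st: "(s, t) \<in> ses_equiv Q M N" and tu: "(t, u) \<in> ses_equiv Q M N"
    obtain E f g E' f' g' E'' f'' g'' where sE: "s = (E, f, g)" "t = (E', f', g')" "u = (E'', f'', g'')"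
      by (cases s, cases t, cases u)
    obtain \<phi> where \<phi>: "\<phi> \<in> Iso Q E E'" "\<And>i x. x \<in> vsp N i \<Longrightarrow> \<phi> i (f i x) = f' i x"
        "\<And>i x. x \<in> vsp E i \<Longrightarrow> g' i (\<phi> i x) = g i x" and se: "(E, f, g) \<in> short_exact Q M N"
      using st unfolding sE ses_equiv_iff by blast
    obtain \<psi> where \<psi>: "\<psi> \<in> Iso Q E' E''" "\<And>i x. x \<in> vsp N i \<Longrightarrow> \<psi> i (f' i x) = f'' i x"
        "\<And>i x. x \<in> vsp E' i \<Longrightarrow> g'' i (\<psi> i x) = g' i x"
      and se': "(E', f', g') \<in> short_exact Q M N" "(E'', f'', g'') \<in> short_exact Q M N"
      using tu unfolding sE ses_equiv_iff by blast
    have "E \<in> reps Q" "E' \<in> reps Q" "E'' \<in> reps Q" using se se' by (auto simp: short_exact_def)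
    hence "(\<lambda>i. \<psi> i \<circ> \<phi> i) \<in> Iso Q E E''" using \<phi>(1) \<psi>(1) by (rule Iso_trans)
    then obtain \<xi> where iso: "\<xi> \<in> Iso Q E E''" and \<xi>: "\<And>i x. \<xi> i x = \<psi> i (\<phi> i x)" by simp
    have mem: "x \<in> vsp E i \<Longrightarrow> \<phi> i x \<in> vsp E' i" for i x
      using \<phi>(1) by (rule Iso_mem)
    have "\<forall>i. (\<forall>x\<in>vsp N i. \<xi> i (f i x) = f'' i x) \<and> (\<forall>x\<in>vsp E i. g'' i (\<xi> i x) = g i x)"
      using \<phi>(2,3) \<psi>(2,3) mem by (simp add: \<xi>)
    thus "(s, u) \<in> ses_equiv Q M N" using se se' iso unfolding sE ses_equiv_iff by blast
  qed
qed

text \<open>Interleaving embeds the direct sum of two subspaces of \<^typ>\<open>nat \<Rightarrow> 'k\<close> into the same space, so that it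
  can serve as the underlying space of an extension.\<close>

definition evens :: "(nat \<Rightarrow> 'k) \<Rightarrow> nat \<Rightarrow> 'k" where "evens z = (\<lambda>j. z (2 * j))"
definition odds :: "(nat \<Rightarrow> 'k) \<Rightarrow> nat \<Rightarrow> 'k" where "odds z = (\<lambda>j. z (2 * j + 1))"
definition interleave :: "(nat \<Rightarrow> 'k) \<Rightarrow> (nat \<Rightarrow> 'k) \<Rightarrow> nat \<Rightarrow> 'k" where
  "interleave x y = (\<lambda>j. if even j then x (j div 2) else y (j div 2))"

lemma evens_interleave [simp]: "evens (interleave x y) = x"
  and odds_interleave [simp]: "odds (interleave x y) = y"
  by (simp_all add: evens_def odds_def interleave_def)

lemma interleave_evens_odds [simp]: "interleave (evens z) (odds z) = z"
  by (auto simp: evens_def odds_def interleave_def fun_eq_iff elim!: oddE)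

lemma evens_add [simp]: "evens (x + y) = evens x + evens y"
  and odds_add [simp]: "odds (x + y) = odds x + odds y"
  and evens_0 [simp]: "evens 0 = 0"
  and odds_0 [simp]: "odds 0 = 0"
  and evens_vscale [simp]: "evens (vscale c x) = vscale c (evens x)"
  and odds_vscale [simp]: "odds (vscale c x) = vscale c (odds x)"
  by (simp_all add: evens_def odds_def vscale_def fun_eq_iff)

lemma interleave_eqI: "evens z = evens w \<Longrightarrow> odds z = odds w \<Longrightarrow> z = w"
  by (metis interleave_evens_odds)

lemma interleave_add:
  fixes x y x' y' :: "nat \<Rightarrow> 'k::field"
  shows "interleave (x + x') (y + y') = interleave x y + interleave x' y'"
  by (rule interleave_eqI) simp_all

lemma interleave_vscale: "interleave (vscale c x) (vscale c y) = vscale c (interleave x y)"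
  by (rule interleave_eqI) simp_all

lemma interleave_0 [simp]: "interleave 0 0 = (0 :: nat \<Rightarrow> 'k::field)"
  by (rule interleave_eqI) simp_all

section \<open>The Euler form\<close>

locale rep_pair = fin_digraph Q for Q :: "('n::finite, 'a) pre_digraph" +
  fixes M N :: "('n, 'a, 'k::{field,finite}) qrep"
  assumes M: "M \<in> reps Q" and N: "N \<in> reps Q"
begin

lemmas fM = reps_fsub[OF M] and fN = reps_fsub[OF N]
lemmas lM = reps_linear[OF M] and lN = reps_linear[OF N]
lemmas cM = fsub_closed[OF fM] and cN = fsub_closed[OF fN]

definition C0 :: "('n \<Rightarrow> (nat \<Rightarrow> 'k) \<Rightarrow> nat \<Rightarrow> 'k) set" where
  "C0 = {\<phi>. \<forall>i. \<phi> i \<in> lin_maps {0} (vsp M i) (vsp N i)}"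

definition C1 :: "('a \<Rightarrow> (nat \<Rightarrow> 'k) \<Rightarrow> nat \<Rightarrow> 'k) set" where
  "C1 = {\<psi>. (\<forall>a\<in>arcs Q. \<psi> a \<in> lin_maps {0} (vsp M (tail Q a)) (vsp N (head Q a))) \<and>
     (\<forall>a. a \<notin> arcs Q \<longrightarrow> \<psi> a = 0)}"

text \<open>The differential of the standard two-term complex \<open>C0\<close> -->
  \<open>C1\<close>, with kernel Hom(M, N) and cokernel Ext^1(M, N).\<close>

definition diff_map :: "('n \<Rightarrow> (nat \<Rightarrow> 'k) \<Rightarrow> nat \<Rightarrow> 'k) \<Rightarrow> 'a \<Rightarrow> (nat \<Rightarrow> 'k) \<Rightarrow> nat \<Rightarrow> 'k" where
  "diff_map \<phi> = (\<lambda>a x. if a \<in> arcs Q \<and> x \<in> vsp M (tail Q a)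
     then \<phi> (head Q a) (vmap M a x) - vmap N a (\<phi> (tail Q a) x) else 0)"

lemma lin_maps_0_iff: "fsub V \<Longrightarrow> f \<in> lin_maps {0} V W \<longleftrightarrow> linear_between V W f \<and> (\<forall>x. x \<notin> V \<longrightarrow> f x = 0)"
  using linear_between_0 by (auto simp: lin_maps_def)

lemma C0D:
  assumes "\<phi> \<in> C0"
  shows "linear_between (vsp M i) (vsp N i) (\<phi> i)" "x \<notin> vsp M i \<Longrightarrow> \<phi> i x = 0"
  using assms by (simp_all add: C0_def lin_maps_0_iff[OF fM])

lemma C1D:
  assumes "\<psi> \<in> C1"
  shows "a \<in> arcs Q \<Longrightarrow> linear_between (vsp M (tail Q a)) (vsp N (head Q a)) (\<psi> a)"
    "a \<in> arcs Q \<Longrightarrow> x \<notin> vsp M (tail Q a) \<Longrightarrow> \<psi> a x = 0" "a \<notin> arcs Q \<Longrightarrow> \<psi> a = 0"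
  using assms by (simp_all add: C1_def lin_maps_0_iff[OF fM])

lemma dim_0: "vs.dim {0 :: nat \<Rightarrow> 'k} = 0"
proof -
  have "card {0 :: nat \<Rightarrow> 'k} = CARD('k) ^ vs.dim {0 :: nat \<Rightarrow> 'k}" by (rule card_fsub[OF fsub_zero])
  hence "\<not> 1 < CARD('k) ^ vs.dim {0 :: nat \<Rightarrow> 'k}" by simp
  thus ?thesis using one_less_power[OF CARD_field_gt_1[where ?'k = 'k]] by blast
qed

lemma card_lin_maps_0:
  "fsub V \<Longrightarrow> fsub W \<Longrightarrow> card (lin_maps {0} V W) = CARD('k) ^ (vs.dim V * vs.dim (W :: (nat \<Rightarrow> 'k) set))"
  using card_lin_maps[of V W "{0}"] fsub_0[of V]
  by (simp add: card_fsub dim_0 vs.subspace_single_0 power_mult[symmetric] mult.commute)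

lemma finite_lin_maps_0: "fsub V \<Longrightarrow> fsub W \<Longrightarrow> finite (lin_maps {0} V (W :: (nat \<Rightarrow> 'k) set))"
  using finite_lin_maps[of V W "{0}"] fsub_0[of V] by (simp add: vs.subspace_single_0)

lemma card_C0: "card C0 = CARD('k) ^ (\<Sum>i\<in>UNIV. vs.dim (vsp M i) * vs.dim (vsp N i))"
proof -
  have "C0 = PiE UNIV (\<lambda>i. lin_maps {0} (vsp M i) (vsp N i))" by (auto simp: C0_def PiE_iff)
  thus ?thesis by (simp add: card_PiE card_lin_maps_0 fM fN power_sum)
qed

lemma finite_C0: "finite C0"
  unfolding C0_def by (intro finite_families finite_lin_maps_0 fM fN)

lemma card_C1: "card C1 = CARD('k) ^ (\<Sum>a\<in>arcs Q. vs.dim (vsp M (tail Q a)) * vs.dim (vsp N (head Q a)))"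
  unfolding C1_def by (subst card_families_0) (simp_all add: finite_arcs card_lin_maps_0 fM fN power_sum)

lemma finite_C1: "finite C1"
  unfolding C1_def by (intro finite_families_0 finite_lin_maps_0 fM fN finite_arcs)

lemma C1_diff: "\<psi> \<in> C1 \<Longrightarrow> \<psi>' \<in> C1 \<Longrightarrow> \<psi> - \<psi>' \<in> C1"
  unfolding C1_def by (simp add: lin_maps_diff[OF fM fN])

lemma C0_diff: "\<phi> \<in> C0 \<Longrightarrow> \<phi>' \<in> C0 \<Longrightarrow> \<phi> - \<phi>' \<in> C0"
  unfolding C0_def by (simp add: lin_maps_diff[OF fM fN])

lemma diff_map_C1:
  assumes \<phi>: "\<phi> \<in> C0"
  shows "diff_map \<phi> \<in> C1"
proof -
  have "diff_map \<phi> a \<in> lin_maps {0} (vsp M (tail Q a)) (vsp N (head Q a))" if a: "a \<in> arcs Q" for a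
    unfolding lin_maps_0_iff[OF fM]
  proof
    note l = C0D(1)[OF \<phi>] and m = linear_betweenD(1)[OF lM[OF a]]
    show "linear_between (vsp M (tail Q a)) (vsp N (head Q a)) (diff_map \<phi> a)"
    proof (rule linear_betweenI)
      fix x assume x: "x \<in> vsp M (tail Q a)"
      show "diff_map \<phi> a x \<in> vsp N (head Q a)"
        using a x linear_betweenD(1)[OF l] linear_betweenD(1)[OF lN[OF a]] m cN(2) by (simp add: diff_map_def)
      show "diff_map \<phi> a (x + y) = diff_map \<phi> a x + diff_map \<phi> a y" if y: "y \<in> vsp M (tail Q a)" for y
      proof -
        have "\<phi> (head Q a) (vmap M a (x + y)) = \<phi> (head Q a) (vmap M a x) + \<phi> (head Q a) (vmap M a y)"
          using x y m linear_betweenD(2)[OF l] linear_betweenD(2)[OF lM[OF a]] by simp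
        moreover have "vmap N a (\<phi> (tail Q a) (x + y)) = vmap N a (\<phi> (tail Q a) x) + vmap N a (\<phi> (tail Q a) y)"
          using x y linear_betweenD(1,2)[OF l] linear_betweenD(2)[OF lN[OF a]] by simp
        ultimately show ?thesis using a x y cM(1) by (simp add: diff_map_def)
      qed
      show "diff_map \<phi> a (vscale c x) = vscale c (diff_map \<phi> a x)" for c
      proof -
        have "\<phi> (head Q a) (vmap M a (vscale c x)) = vscale c (\<phi> (head Q a) (vmap M a x))"
          using x m linear_betweenD(3)[OF l] linear_betweenD(3)[OF lM[OF a]] by simp
        moreover have "vmap N a (\<phi> (tail Q a) (vscale c x)) = vscale c (vmap N a (\<phi> (tail Q a) x))"
          using x linear_betweenD(1,3)[OF l] linear_betweenD(3)[OF lN[OF a]] by simp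
        ultimately show ?thesis using a x cM(3) by (simp add: diff_map_def vs.scale_right_diff_distrib)
      qed
    qed
    show "\<forall>x. x \<notin> vsp M (tail Q a) \<longrightarrow> diff_map \<phi> a x = 0" by (simp add: diff_map_def)
  qed
  thus ?thesis by (auto simp: C1_def diff_map_def fun_eq_iff)
qed

lemma diff_map_diff:
  assumes "\<phi> \<in> C0" "\<phi>' \<in> C0"
  shows "diff_map (\<phi> - \<phi>') = diff_map \<phi> - diff_map \<phi>'"
proof (intro ext)
  fix a x j
  have "vmap N a (\<phi> (tail Q a) x - \<phi>' (tail Q a) x) = vmap N a (\<phi> (tail Q a) x) - vmap N a (\<phi>' (tail Q a) x)"
    if "a \<in> arcs Q" "x \<in> vsp M (tail Q a)"
    using linear_between_diff[OF fN lN[OF that(1)]] linear_betweenD(1)[OF C0D(1)] assms that(2) by blast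
  thus "diff_map (\<phi> - \<phi>') a x j = (diff_map \<phi> - diff_map \<phi>') a x j"
    by (simp add: diff_map_def)
qed

lemma ker_diff_map: "{\<phi> \<in> C0. diff_map \<phi> = 0} = Hom Q M N"
proof (rule subset_antisym; rule subsetI)
  fix \<phi> assume \<phi>: "\<phi> \<in> {\<phi> \<in> C0. diff_map \<phi> = 0}"
  hence \<phi>C: "\<phi> \<in> C0" and z: "diff_map \<phi> = 0" by auto
  show "\<phi> \<in> Hom Q M N"
  proof (rule HomI)
    show "linear_between (vsp M i) (vsp N i) (\<phi> i)" "x \<notin> vsp M i \<Longrightarrow> \<phi> i x = 0" for i x
      using C0D[OF \<phi>C] by auto
    fix a x assume "a \<in> arcs Q" "x \<in> vsp M (tail Q a)"
    moreover have "diff_map \<phi> a x = 0" using z by simp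
    ultimately show "\<phi> (head Q a) (vmap M a x) = vmap N a (\<phi> (tail Q a) x)" by (simp add: diff_map_def)
  qed
next
  fix \<phi> assume \<phi>: "\<phi> \<in> Hom Q M N"
  have "diff_map \<phi> = 0"
  proof (intro ext)
    fix a x j show "diff_map \<phi> a x j = (0 :: 'a \<Rightarrow> (nat \<Rightarrow> 'k) \<Rightarrow> nat \<Rightarrow> 'k) a x j"
      using HomD(3)[OF \<phi>] by (simp add: diff_map_def)
  qed
  thus "\<phi> \<in> {\<phi> \<in> C0. diff_map \<phi> = 0}" using HomD(1,2)[OF \<phi>] by (simp add: C0_def lin_maps_0_iff[OF fM])
qed

lemma zero_C0: "0 \<in> C0"
proof -
  have "linear_between (vsp M i) (vsp N i) 0" for i
    by (rule linear_betweenI) (simp_all add: fsub_0[OF fN] vs.scale_zero_right)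
  thus ?thesis by (simp add: C0_def lin_maps_0_iff[OF fM])
qed

lemma zero_C1: "0 \<in> C1"
  using C1_diff[OF diff_map_C1[OF zero_C0] diff_map_C1[OF zero_C0]] by simp

lemma card_C0_eq: "card C0 = card (Hom Q M N) * card (diff_map ` C0)"
  unfolding ker_diff_map[symmetric]
  by (rule card_eq_card_kernel_times_card_image) (use finite_C0 zero_C0 C0_diff diff_map_diff in auto)

lemma card_Hom: "card (Hom Q M N) = CARD('k) ^ hom_dim Q M N"
  unfolding hom_dim_def
proof (rule vector_space.card_finite_subspace[OF vector_space_hom_scale])
  show "finite (Hom Q M N)" using finite_C0 unfolding ker_diff_map[symmetric] by simp
  interpret hs: vector_space "hom_scale :: 'k \<Rightarrow> ('n \<Rightarrow> (nat \<Rightarrow> 'k) \<Rightarrow> nat \<Rightarrow> 'k) \<Rightarrow> _" by (rule vector_space_hom_scale)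
  show "hs.subspace (Hom Q M N)"
    unfolding hs.subspace_def
  proof (intro conjI ballI allI)
    have d: "x - y \<in> Hom Q M N" if "x \<in> Hom Q M N" "y \<in> Hom Q M N" for x y
      using that C0_diff diff_map_diff unfolding ker_diff_map[symmetric] by simp
    have z: "0 \<in> Hom Q M N"
    proof -
      have "diff_map 0 = diff_map (0 - 0)" by simp
      also have "\<dots> = 0" by (subst diff_map_diff[OF zero_C0 zero_C0]) simp
      finally show ?thesis using zero_C0 unfolding ker_diff_map[symmetric] by simp
    qed
    show "0 \<in> Hom Q M N" by (rule z)
    show "x + y \<in> Hom Q M N" if "x \<in> Hom Q M N" "y \<in> Hom Q M N" for x y
      using d[OF that(1) d[OF z that(2)]] by simp
    show "hom_scale c x \<in> Hom Q M N" if x: "x \<in> Hom Q M N" for c x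
    proof (rule HomI)
      show "linear_between (vsp M i) (vsp N i) (hom_scale c x i)" for i
        using linear_betweenD[OF HomD(1)[OF x]] cN(3)
        by (intro linear_betweenI) (simp_all add: hom_scale_def vs.scale_right_distrib vs.scale_left_commute)
      show "hom_scale c x i y = 0" if "y \<notin> vsp M i" for i y
        using HomD(2)[OF x that] by (simp add: hom_scale_def vs.scale_zero_right)
      show "hom_scale c x (head Q a) (vmap M a y) = vmap N a (hom_scale c x (tail Q a) y)"
        if "a \<in> arcs Q" "y \<in> vsp M (tail Q a)" for a y
        using HomD(3)[OF x that] linear_betweenD(3)[OF lN[OF that(1)]] linear_betweenD(1)[OF HomD(1)[OF x] that(2)]
        by (simp add: hom_scale_def)
    qed
  qed
qed simp

text \<open>The extension with cocycle \<psi>: even positions hold N, odd positions hold M, and each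
  arrow acts as a block triangular matrix with \<psi> in the corner from M to N.\<close>

definition ext_rep :: "('a \<Rightarrow> (nat \<Rightarrow> 'k) \<Rightarrow> nat \<Rightarrow> 'k) \<Rightarrow> ('n, 'a, 'k) qrep" where
  "ext_rep \<psi> = \<lparr>vsp = (\<lambda>i. {z. evens z \<in> vsp N i \<and> odds z \<in> vsp M i}),
     vmap = (\<lambda>a z. interleave (vmap N a (evens z) + \<psi> a (odds z)) (vmap M a (odds z)))\<rparr>"

definition ext_inj :: "'n \<Rightarrow> (nat \<Rightarrow> 'k) \<Rightarrow> nat \<Rightarrow> 'k" where
  "ext_inj i x = (if x \<in> vsp N i then interleave x 0 else 0)"

definition ext_proj :: "'n \<Rightarrow> (nat \<Rightarrow> 'k) \<Rightarrow> nat \<Rightarrow> 'k" where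
  "ext_proj i z = (if evens z \<in> vsp N i \<and> odds z \<in> vsp M i then odds z else 0)"

definition ext_ses :: "('a \<Rightarrow> (nat \<Rightarrow> 'k) \<Rightarrow> nat \<Rightarrow> 'k) \<Rightarrow> ('n, 'a, 'k) ses" where
  "ext_ses \<psi> = (ext_rep \<psi>, ext_inj, ext_proj)"

lemma vsp_ext_rep [simp]: "z \<in> vsp (ext_rep \<psi>) i \<longleftrightarrow> evens z \<in> vsp N i \<and> odds z \<in> vsp M i"
  by (simp add: ext_rep_def)

lemma vmap_ext_rep [simp]:
  "vmap (ext_rep \<psi>) a z = interleave (vmap N a (evens z) + \<psi> a (odds z)) (vmap M a (odds z))"
  by (simp add: ext_rep_def)

lemma fsub_ext_rep: "fsub (vsp (ext_rep \<psi>) i)"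
proof -
  have "vsp (ext_rep \<psi>) i = (\<lambda>(x, y). interleave x y) ` (vsp N i \<times> vsp M i)"
  proof (rule subset_antisym; rule subsetI)
    fix z assume "z \<in> vsp (ext_rep \<psi>) i"
    thus "z \<in> (\<lambda>(x, y). interleave x y) ` (vsp N i \<times> vsp M i)"
      by (intro image_eqI[of _ _ "(evens z, odds z)"]) auto
  qed auto
  hence "finite (vsp (ext_rep \<psi>) i)" using fsubD(2)[OF fM] fsubD(2)[OF fN] by simp
  moreover have "vs.subspace (vsp (ext_rep \<psi>) i)"
    unfolding vs.subspace_def using cM cN fsub_0[OF fM] fsub_0[OF fN] by auto
  ultimately show ?thesis by (simp add: fsub_def)
qed

lemma ext_rep_reps:
  assumes \<psi>: "\<psi> \<in> C1"
  shows "ext_rep \<psi> \<in> reps Q"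
proof -
  have "linear_between (vsp (ext_rep \<psi>) (tail Q a)) (vsp (ext_rep \<psi>) (head Q a)) (vmap (ext_rep \<psi>) a)"
    if a: "a \<in> arcs Q" for a
  proof (rule linear_betweenI)
    note l = linear_betweenD[OF lM[OF a]] linear_betweenD[OF lN[OF a]] linear_betweenD[OF C1D(1)[OF \<psi> a]]
    fix x assume x: "x \<in> vsp (ext_rep \<psi>) (tail Q a)"
    show "vmap (ext_rep \<psi>) a x \<in> vsp (ext_rep \<psi>) (head Q a)" using x l cN(1) by simp
    show "vmap (ext_rep \<psi>) a (x + y) = vmap (ext_rep \<psi>) a x + vmap (ext_rep \<psi>) a y"
      if "y \<in> vsp (ext_rep \<psi>) (tail Q a)" for y
      using x that l by (simp add: add_ac flip: interleave_add)
    show "vmap (ext_rep \<psi>) a (vscale c x) = vscale c (vmap (ext_rep \<psi>) a x)" for c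
      using x l by (simp add: vs.scale_right_distrib flip: interleave_vscale)
  qed
  thus ?thesis using fsub_ext_rep by (simp add: reps_def fd_space_iff_fsub)
qed

lemma ext_ses_short_exact:
  assumes \<psi>: "\<psi> \<in> C1"
  shows "ext_ses \<psi> \<in> short_exact Q M N"
proof -
  have inj: "ext_inj \<in> Hom Q N (ext_rep \<psi>)"
  proof (rule HomI)
    show "linear_between (vsp N i) (vsp (ext_rep \<psi>) i) (ext_inj i)" for i
    proof (rule linear_betweenI)
      show "ext_inj i (x + y) = ext_inj i x + ext_inj i y" if "x \<in> vsp N i" "y \<in> vsp N i" for x y
        using that cN(1) interleave_add[of x y 0 0] by (simp add: ext_inj_def)
      show "ext_inj i (vscale c x) = vscale c (ext_inj i x)" if "x \<in> vsp N i" for x c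
        using that cN(3) interleave_vscale[of c x 0] by (simp add: ext_inj_def vs.scale_zero_right)
    qed (simp add: ext_inj_def fsub_0[OF fM])
    show "ext_inj (head Q a) (vmap N a x) = vmap (ext_rep \<psi>) a (ext_inj (tail Q a) x)"
      if "a \<in> arcs Q" "x \<in> vsp N (tail Q a)" for a x
      using that linear_betweenD(1)[OF lN] linear_between_0[OF fM lM] linear_between_0[OF fM C1D(1)[OF \<psi>]]
      by (simp add: ext_inj_def)
  qed (simp add: ext_inj_def)
  have proj: "ext_proj \<in> Hom Q (ext_rep \<psi>) M"
  proof (rule HomI)
    show "linear_between (vsp (ext_rep \<psi>) i) (vsp M i) (ext_proj i)" for i
      by (rule linear_betweenI) (simp_all add: ext_proj_def cM cN)
    show "ext_proj (head Q a) (vmap (ext_rep \<psi>) a x) = vmap M a (ext_proj (tail Q a) x)"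
      if "a \<in> arcs Q" "x \<in> vsp (ext_rep \<psi>) (tail Q a)" for a x
      using that linear_betweenD(1)[OF lN] linear_betweenD(1)[OF lM] linear_betweenD(1)[OF C1D(1)[OF \<psi>]] cN(1)
      by (simp add: ext_proj_def)
  qed (auto simp: ext_proj_def)
  have "inj_on (ext_inj i) (vsp N i)" for i
  proof (rule inj_onI)
    fix x y assume "x \<in> vsp N i" "y \<in> vsp N i" "ext_inj i x = ext_inj i y"
    hence "evens (interleave x 0) = evens (interleave y 0)" by (simp add: ext_inj_def)
    thus "x = y" by simp
  qed
  moreover have "ext_proj i ` vsp (ext_rep \<psi>) i = vsp M i" for i
  proof (rule subset_antisym; rule subsetI)
    fix x assume "x \<in> vsp M i"
    thus "x \<in> ext_proj i ` vsp (ext_rep \<psi>) i"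
      by (intro image_eqI[of _ _ "interleave 0 x"]) (simp_all add: ext_proj_def fsub_0[OF fN])
  qed (auto simp: ext_proj_def)
  moreover have "ext_inj i ` vsp N i = {x \<in> vsp (ext_rep \<psi>) i. ext_proj i x = 0}" for i
  proof (rule subset_antisym; rule subsetI)
    fix z assume z: "z \<in> {x \<in> vsp (ext_rep \<psi>) i. ext_proj i x = 0}"
    hence "odds z = 0" by (auto simp: ext_proj_def)
    hence "interleave (evens z) 0 = z" by (metis evens_interleave odds_interleave interleave_eqI)
    thus "z \<in> ext_inj i ` vsp N i" using z by (intro image_eqI[of _ _ "evens z"]) (simp_all add: ext_inj_def)
  qed (auto simp: ext_proj_def ext_inj_def fsub_0[OF fM])
  ultimately show ?thesis
    using inj proj ext_rep_reps[OF \<psi>] by (simp add: short_exact_def ext_ses_def)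
qed

end

section \<open>Extension classes as cochains modulo coboundaries\<close>

context rep_pair
begin

text \<open>Preimages under the injective f are unique, and this uniqueness makes the lift of h
  linear.\<close>

lemma linear_between_inj_solve:
  assumes f: "linear_between V W f" and V: "fsub V" and inj: "inj_on f V"
    and h: "linear_between U W h" and U: "fsub U" and im: "h ` U \<subseteq> f ` V"
  obtains \<psi> where "linear_between U V \<psi>" "\<And>x. x \<in> U \<Longrightarrow> f (\<psi> x) = h x" "\<And>x. x \<notin> U \<Longrightarrow> \<psi> x = 0"
proof -
  define \<psi> where "\<psi> x = (if x \<in> U then inv_into V f (h x) else 0)" for x
  have mem: "\<psi> x \<in> V" and eq: "f (\<psi> x) = h x" if "x \<in> U" for x
  proof -
    have "h x \<in> f ` V" using im that by blast
    thus "\<psi> x \<in> V" "f (\<psi> x) = h x" using that by (simp_all add: \<psi>_def inv_into_into f_inv_into_f)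
  qed
  note cU = fsub_closed[OF U] and cV = fsub_closed[OF V]
  have "linear_between U V \<psi>"
  proof (rule linear_betweenI)
    show "\<psi> (x + y) = \<psi> x + \<psi> y" if "x \<in> U" "y \<in> U" for x y
    proof (rule inj_onD[OF inj])
      show "f (\<psi> (x + y)) = f (\<psi> x + \<psi> y)"
        using that eq mem cU(1) linear_betweenD(2)[OF f] linear_betweenD(2)[OF h] by simp
    qed (use that mem cU(1) cV(1) in auto)
    show "\<psi> (vscale c x) = vscale c (\<psi> x)" if "x \<in> U" for c x
    proof (rule inj_onD[OF inj])
      show "f (\<psi> (vscale c x)) = f (vscale c (\<psi> x))"
        using that eq mem cU(3) linear_betweenD(3)[OF f] linear_betweenD(3)[OF h] by simp
    qed (use that mem cU(3) cV(3) in auto)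
  qed (rule mem)
  moreover have "\<psi> x = 0" if "x \<notin> U" for x using that by (simp add: \<psi>_def)
  ultimately show ?thesis using eq that by blast
qed

lemma linear_section:
  assumes g: "linear_between (E :: (nat \<Rightarrow> 'k) set) V g" and E: "fsub E" and V: "fsub V" and surj: "g ` E = V"
  obtains \<sigma> where "linear_between V E \<sigma>" "\<And>x. x \<in> V \<Longrightarrow> g (\<sigma> x) = x"
proof -
  obtain B where B: "B \<subseteq> V" "vs.independent B" "vs.span B = V" "finite B" "card B = vs.dim V"
    using fsub_basis[OF V] .
  define h where "h b = inv_into E g b" for b
  have h: "h b \<in> E" "g (h b) = b" if "b \<in> B" for b
  proof -
    have "b \<in> g ` E" using that B(1) surj by blast
    thus "h b \<in> E" "g (h b) = b" by (simp_all add: h_def inv_into_into f_inv_into_f)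
  qed
  obtain \<sigma> where \<sigma>: "linear_between V E \<sigma>" "\<And>x. x \<notin> V \<Longrightarrow> \<sigma> x = 0" "\<And>b. b \<in> B \<Longrightarrow> \<sigma> b = h b"
    using lin_maps_extend[OF V E B(2,3), of h, OF h(1)] by blast
  have l1: "linear_between V V (g \<circ> \<sigma>)" by (rule linear_between_comp[OF \<sigma>(1) g])
  have l2: "linear_between V V (\<lambda>x. x)" by (rule linear_betweenI) auto
  have "g (\<sigma> x) = x" if "x \<in> V" for x
    using linear_between_eqI[OF V l1 l2 B(3,4) _ that] \<sigma>(3) h(2) by simp
  thus ?thesis using \<sigma>(1) that by blast
qed

text \<open>A short exact sequence splits at each vertex. The chosen sections need not commute with
  the arrows, but their defect is killed by g, hence comes from N and defines the cocycle \<psi>.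
  Then (n, m) |-> f n + \<sigma> m identifies the extension of \<psi> with the given one.\<close>

lemma ext_ses_surj:
  assumes s: "(E, f, g) \<in> short_exact Q M N"
  obtains \<psi> where "\<psi> \<in> C1" "(ext_ses \<psi>, (E, f, g)) \<in> ses_equiv Q M N"
proof -
  have E: "E \<in> reps Q" and f: "f \<in> Hom Q N E" and g: "g \<in> Hom Q E M"
    and inj: "\<And>i. inj_on (f i) (vsp N i)" and surj: "\<And>i. g i ` vsp E i = vsp M i"
    and ex: "\<And>i. f i ` vsp N i = {x \<in> vsp E i. g i x = 0}"
    using s by (simp_all add: short_exact_def)
  note fE = reps_fsub[OF E] and lE = reps_linear[OF E]
  note cE = fsub_closed[OF fE]
  note lf = HomD(1)[OF f] and lg = HomD(1)[OF g]
  have gf: "g i (f i x) = 0" if "x \<in> vsp N i" for i x using ex[of i] that by blast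
  have "\<forall>i. \<exists>\<sigma>. linear_between (vsp M i) (vsp E i) \<sigma> \<and> (\<forall>x\<in>vsp M i. g i (\<sigma> x) = x)"
    using linear_section[OF lg fE fM surj] by metis
  then obtain \<sigma> where ls: "\<And>i. linear_between (vsp M i) (vsp E i) (\<sigma> i)"
    and gs: "\<And>i x. x \<in> vsp M i \<Longrightarrow> g i (\<sigma> i x) = x" by metis
  note mf = linear_betweenD(1)[OF lf] and mg = linear_betweenD(1)[OF lg] and ms = linear_betweenD(1)[OF ls]
  let ?h = "\<lambda>a x. vmap E a (\<sigma> (tail Q a) x) - \<sigma> (head Q a) (vmap M a x)"
  have "\<exists>\<psi>. linear_between (vsp M (tail Q a)) (vsp N (head Q a)) \<psi> \<and>
      (\<forall>x\<in>vsp M (tail Q a). f (head Q a) (\<psi> x) = ?h a x) \<and> (\<forall>x. x \<notin> vsp M (tail Q a) \<longrightarrow> \<psi> x = 0)"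
    if a: "a \<in> arcs Q" for a
  proof -
    note mE = linear_betweenD(1)[OF lE[OF a]] and mM = linear_betweenD(1)[OF lM[OF a]]
    have lh: "linear_between (vsp M (tail Q a)) (vsp E (head Q a)) (?h a)"
    proof (rule linear_betweenI)
      fix x assume x: "x \<in> vsp M (tail Q a)"
      show "?h a x \<in> vsp E (head Q a)" using x mE mM ms cE(2) by simp
      show "?h a (x + y) = ?h a x + ?h a y" if "y \<in> vsp M (tail Q a)" for y
        using x that ms mM linear_betweenD(2)[OF ls] linear_betweenD(2)[OF lE[OF a]] linear_betweenD(2)[OF lM[OF a]]
        by simp
      show "?h a (vscale c x) = vscale c (?h a x)" for c
        using x ms mM linear_betweenD(3)[OF ls] linear_betweenD(3)[OF lE[OF a]] linear_betweenD(3)[OF lM[OF a]]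
        by (simp add: vs.scale_right_diff_distrib)
    qed
    have "?h a ` vsp M (tail Q a) \<subseteq> f (head Q a) ` vsp N (head Q a)"
    proof (rule image_subsetI)
      fix x assume x: "x \<in> vsp M (tail Q a)"
      have "g (head Q a) (?h a x) = g (head Q a) (vmap E a (\<sigma> (tail Q a) x)) - g (head Q a) (\<sigma> (head Q a) (vmap M a x))"
        by (rule linear_between_diff[OF fE lg]) (use x mE mM ms in auto)
      also have "\<dots> = 0" using HomD(3)[OF g a ms[OF x]] gs[OF x] gs[OF mM[OF x]] by simp
      finally show "?h a x \<in> f (head Q a) ` vsp N (head Q a)"
        using linear_betweenD(1)[OF lh x] unfolding ex by blast
    qed
    from linear_between_inj_solve[OF lf fN inj lh fM this] show ?thesis by metis
  qed
  then obtain \<psi>0 where \<psi>0: "\<And>a. a \<in> arcs Q \<Longrightarrow> linear_between (vsp M (tail Q a)) (vsp N (head Q a)) (\<psi>0 a)"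
      "\<And>a x. a \<in> arcs Q \<Longrightarrow> x \<in> vsp M (tail Q a) \<Longrightarrow> f (head Q a) (\<psi>0 a x) = ?h a x"
      "\<And>a x. a \<in> arcs Q \<Longrightarrow> x \<notin> vsp M (tail Q a) \<Longrightarrow> \<psi>0 a x = 0" by metis
  define \<psi> where "\<psi> a = (if a \<in> arcs Q then \<psi>0 a else 0)" for a
  have \<psi>: "\<psi> \<in> C1" using \<psi>0(1,3) by (simp add: C1_def \<psi>_def lin_maps_0_iff[OF fM])
  have f\<psi>: "f (head Q a) (\<psi> a x) = ?h a x" if "a \<in> arcs Q" "x \<in> vsp M (tail Q a)" for a x
    using \<psi>0(2)[OF that] that by (simp add: \<psi>_def)
  note mpsi = linear_betweenD(1)[OF C1D(1)[OF \<psi>]]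
  define \<xi> where "\<xi> i z = (if evens z \<in> vsp N i \<and> odds z \<in> vsp M i then f i (evens z) + \<sigma> i (odds z) else 0)" for i z
  have "\<xi> \<in> Hom Q (ext_rep \<psi>) E"
  proof (rule HomI)
    show "linear_between (vsp (ext_rep \<psi>) i) (vsp E i) (\<xi> i)" for i
    proof (rule linear_betweenI)
      fix z assume z: "z \<in> vsp (ext_rep \<psi>) i"
      show "\<xi> i z \<in> vsp E i" using z mf ms cE(1) by (simp add: \<xi>_def)
      show "\<xi> i (z + w) = \<xi> i z + \<xi> i w" if "w \<in> vsp (ext_rep \<psi>) i" for w
        using z that cM(1) cN(1) linear_betweenD(2)[OF lf] linear_betweenD(2)[OF ls]
        by (simp add: \<xi>_def add_ac)
      show "\<xi> i (vscale c z) = vscale c (\<xi> i z)" for c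
        using z cM(3) cN(3) linear_betweenD(3)[OF lf] linear_betweenD(3)[OF ls]
        by (simp add: \<xi>_def vs.scale_right_distrib)
    qed
    show "\<xi> i z = 0" if "z \<notin> vsp (ext_rep \<psi>) i" for i z using that by (auto simp: \<xi>_def)
    show "\<xi> (head Q a) (vmap (ext_rep \<psi>) a z) = vmap E a (\<xi> (tail Q a) z)"
      if a: "a \<in> arcs Q" and z: "z \<in> vsp (ext_rep \<psi>) (tail Q a)" for a z
    proof -
      note mM = linear_betweenD(1)[OF lM[OF a]] and mN = linear_betweenD(1)[OF lN[OF a]]
      have zz: "evens z \<in> vsp N (tail Q a)" "odds z \<in> vsp M (tail Q a)" using z by simp_all
      have "\<xi> (head Q a) (vmap (ext_rep \<psi>) a z) =
          f (head Q a) (vmap N a (evens z)) + f (head Q a) (\<psi> a (odds z)) + \<sigma> (head Q a) (vmap M a (odds z))"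
        using zz mM mN mpsi[OF a] cN(1) linear_betweenD(2)[OF lf] by (simp add: \<xi>_def)
      also have "\<dots> = vmap E a (f (tail Q a) (evens z)) + vmap E a (\<sigma> (tail Q a) (odds z))"
        using HomD(3)[OF f a zz(1)] f\<psi>[OF a zz(2)] by simp
      also have "\<dots> = vmap E a (f (tail Q a) (evens z) + \<sigma> (tail Q a) (odds z))"
        using linear_betweenD(2)[OF lE[OF a]] mf ms zz by simp
      finally show ?thesis using zz by (simp add: \<xi>_def)
    qed
  qed
  moreover have "bij_betw (\<xi> i) (vsp (ext_rep \<psi>) i) (vsp E i)" for i
    unfolding bij_betw_def
  proof
    have g\<xi>: "g i (\<xi> i z) = odds z" if "z \<in> vsp (ext_rep \<psi>) i" for z
      using that mf ms gf gs linear_betweenD(2)[OF lg] by (simp add: \<xi>_def)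
    show "inj_on (\<xi> i) (vsp (ext_rep \<psi>) i)"
    proof (rule inj_onI)
      fix z w assume z: "z \<in> vsp (ext_rep \<psi>) i" "w \<in> vsp (ext_rep \<psi>) i" "\<xi> i z = \<xi> i w"
      have o: "odds z = odds w" using g\<xi>[OF z(1)] g\<xi>[OF z(2)] z(3) by simp
      hence "f i (evens z) = f i (evens w)" using z by (simp add: \<xi>_def)
      hence "evens z = evens w" using inj_onD[OF inj] z by simp
      thus "z = w" using o interleave_eqI by blast
    qed
    show "\<xi> i ` vsp (ext_rep \<psi>) i = vsp E i"
    proof (rule subset_antisym; rule subsetI)
      fix y assume y: "y \<in> vsp E i"
      define m where "m = g i y"
      have m: "m \<in> vsp M i" using mg[OF y] by (simp add: m_def)
      have "g i (y - \<sigma> i m) = 0"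
        using linear_between_diff[OF fE lg y ms[OF m]] gs[OF m] by (simp add: m_def)
      moreover have "y - \<sigma> i m \<in> vsp E i" using y ms[OF m] cE(2) by blast
      ultimately have "y - \<sigma> i m \<in> f i ` vsp N i" unfolding ex by blast
      then obtain n where n: "n \<in> vsp N i" "y - \<sigma> i m = f i n" by blast
      have "y = \<xi> i (interleave n m)" using n m by (simp add: \<xi>_def algebra_simps)
      moreover have "interleave n m \<in> vsp (ext_rep \<psi>) i" using n m by simp
      ultimately show "y \<in> \<xi> i ` vsp (ext_rep \<psi>) i" by (rule image_eqI)
    next
      fix y assume "y \<in> \<xi> i ` vsp (ext_rep \<psi>) i"
      thus "y \<in> vsp E i" using mf ms cE(1) by (auto simp: \<xi>_def)
    qed
  qed
  ultimately have iso: "\<xi> \<in> Iso Q (ext_rep \<psi>) E" by (simp add: Iso_def)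
  have "\<xi> i (ext_inj i x) = f i x" if "x \<in> vsp N i" for i x
    using that fsub_0[OF fM] linear_between_0[OF fM ls] by (simp add: \<xi>_def ext_inj_def)
  moreover have "g i (\<xi> i z) = ext_proj i z" if "z \<in> vsp (ext_rep \<psi>) i" for i z
    using that mf ms gf gs linear_betweenD(2)[OF lg] by (simp add: \<xi>_def ext_proj_def)
  ultimately have "(ext_ses \<psi>, (E, f, g)) \<in> ses_equiv Q M N"
    using iso s ext_ses_short_exact[OF \<psi>] unfolding ext_ses_def ses_equiv_iff by blast
  thus ?thesis using \<psi> that by blast
qed

text \<open>An equivalence is the identity on N and on the quotient M, so it has the form (n, x) |->
  (n + h x, x). Compatibility with the arrows then says that \<psi>' - \<psi> is the coboundary of
  h.\<close>

lemma ext_ses_equiv_iff: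
  assumes \<psi>: "\<psi> \<in> C1" and \<psi>': "\<psi>' \<in> C1"
  shows "(ext_ses \<psi>, ext_ses \<psi>') \<in> ses_equiv Q M N \<longleftrightarrow> \<psi> - \<psi>' \<in> diff_map ` C0"
proof
  assume "(ext_ses \<psi>, ext_ses \<psi>') \<in> ses_equiv Q M N"
  then obtain \<phi> where \<phi>: "\<phi> \<in> Iso Q (ext_rep \<psi>) (ext_rep \<psi>')"
      and \<phi>i: "\<And>i x. x \<in> vsp N i \<Longrightarrow> \<phi> i (ext_inj i x) = ext_inj i x"
      and \<phi>p: "\<And>i z. z \<in> vsp (ext_rep \<psi>) i \<Longrightarrow> ext_proj i (\<phi> i z) = ext_proj i z"
    unfolding ext_ses_def ses_equiv_iff by blast
  have h\<phi>: "\<phi> \<in> Hom Q (ext_rep \<psi>) (ext_rep \<psi>')" using \<phi> by (simp add: Iso_def)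
  note l\<phi> = HomD(1)[OF h\<phi>]
  have m\<phi>: "evens (\<phi> i z) \<in> vsp N i" "odds (\<phi> i z) \<in> vsp M i" if "z \<in> vsp (ext_rep \<psi>) i" for i z
    using linear_betweenD(1)[OF l\<phi> that] by simp_all
  \<comment> \<open>The component in N of the image of (0, x) under the equivalence.\<close>
  define h where "h i x = (if x \<in> vsp M i then evens (\<phi> i (interleave 0 x)) else 0)" for i x
  have zx: "interleave 0 x \<in> vsp (ext_rep \<psi>) i" if "x \<in> vsp M i" for i x
    using that fsub_0[OF fN] by simp
  have ox: "odds (\<phi> i (interleave 0 x)) = x" if "x \<in> vsp M i" for i x
    using \<phi>p[OF zx[OF that]] m\<phi>[OF zx[OF that]] that fsub_0[OF fN] by (simp add: ext_proj_def)
  have e\<phi>: "\<phi> i (interleave n x) = interleave (n + h i x) x" if n: "n \<in> vsp N i" and x: "x \<in> vsp M i" for i n x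
  proof -
    have "interleave n x = interleave n 0 + interleave 0 x" by (simp flip: interleave_add)
    moreover have "interleave n 0 \<in> vsp (ext_rep \<psi>) i" using n fsub_0[OF fM] by simp
    ultimately have "\<phi> i (interleave n x) = \<phi> i (interleave n 0) + \<phi> i (interleave 0 x)"
      using linear_betweenD(2)[OF l\<phi>] zx[OF x] by simp
    also have "\<phi> i (interleave n 0) = interleave n 0" using \<phi>i[OF n] n by (simp add: ext_inj_def)
    also have "\<phi> i (interleave 0 x) = interleave (h i x) x"
      by (rule interleave_eqI) (use x ox in \<open>simp_all add: h_def\<close>)
    also have "interleave n 0 + interleave (h i x) x = interleave (n + h i x) x"
      by (metis interleave_add add_0_left)
    finally show ?thesis .
  qed
  have h: "h \<in> C0"
  proof -
    have "linear_between (vsp M i) (vsp N i) (h i)" for i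
    proof (rule linear_betweenI)
      fix x assume x: "x \<in> vsp M i"
      show "h i x \<in> vsp N i" using m\<phi>(1)[OF zx[OF x]] x by (simp add: h_def)
      show "h i (x + y) = h i x + h i y" if y: "y \<in> vsp M i" for y
      proof -
        have "interleave 0 (x + y) = interleave 0 x + interleave 0 y" by (simp flip: interleave_add)
        thus ?thesis using linear_betweenD(2)[OF l\<phi> zx[OF x] zx[OF y]] x y cM(1) by (simp add: h_def)
      qed
      show "h i (vscale c x) = vscale c (h i x)" for c
      proof -
        have "interleave 0 (vscale c x) = vscale c (interleave 0 x)"
          by (simp add: vs.scale_zero_right flip: interleave_vscale)
        thus ?thesis using linear_betweenD(3)[OF l\<phi> zx[OF x]] x cM(3) by (simp add: h_def)
      qed
    qed
    thus ?thesis by (simp add: C0_def lin_maps_0_iff[OF fM] h_def)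
  qed
  have "\<psi>' a x - \<psi> a x = diff_map h a x" if a: "a \<in> arcs Q" and x: "x \<in> vsp M (tail Q a)" for a x
  proof -
    note mM = linear_betweenD(1)[OF lM[OF a]] and mN = linear_betweenD(1)[OF lN[OF a]]
    note N0 = linear_between_0[OF fN lN[OF a]]
    have "\<phi> (head Q a) (vmap (ext_rep \<psi>) a (interleave 0 x)) = vmap (ext_rep \<psi>') a (\<phi> (tail Q a) (interleave 0 x))"
      by (rule HomD(3)[OF h\<phi> a zx[OF x]])
    moreover have "vmap (ext_rep \<psi>) a (interleave 0 x) = interleave (\<psi> a x) (vmap M a x)" by (simp add: N0)
    moreover have "\<phi> (tail Q a) (interleave 0 x) = interleave (h (tail Q a) x) x"
      using e\<phi>[OF fsub_0[OF fN] x] by simp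
    moreover have "\<phi> (head Q a) (interleave (\<psi> a x) (vmap M a x)) = interleave (\<psi> a x + h (head Q a) (vmap M a x)) (vmap M a x)"
      using e\<phi> linear_betweenD(1)[OF C1D(1)[OF \<psi> a] x] mM[OF x] by blast
    ultimately have "interleave (\<psi> a x + h (head Q a) (vmap M a x)) (vmap M a x) =
        interleave (vmap N a (h (tail Q a) x) + \<psi>' a x) (vmap M a x)" by simp
    hence "evens (interleave (\<psi> a x + h (head Q a) (vmap M a x)) (vmap M a x)) =
        evens (interleave (vmap N a (h (tail Q a) x) + \<psi>' a x) (vmap M a x))" by simp
    thus ?thesis using a x by (simp add: diff_map_def algebra_simps)
  qed
  moreover have "\<psi>' a x - \<psi> a x = diff_map h a x" if "a \<notin> arcs Q \<or> x \<notin> vsp M (tail Q a)" for a x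
    using that C1D(2,3)[OF \<psi>] C1D(2,3)[OF \<psi>'] by (cases "a \<in> arcs Q") (auto simp: diff_map_def)
  ultimately have "\<psi>' - \<psi> = diff_map h" by (intro ext) (metis fun_diff_def)
  hence "\<psi> - \<psi>' = diff_map 0 - diff_map h"
    using diff_map_diff[OF zero_C0 zero_C0] by (simp add: algebra_simps)
  also have "\<dots> = diff_map (0 - h)" by (rule diff_map_diff[OF zero_C0 h, symmetric])
  finally show "\<psi> - \<psi>' \<in> diff_map ` C0" using C0_diff[OF zero_C0 h] by blast
next
  assume "\<psi> - \<psi>' \<in> diff_map ` C0"
  then obtain h where h: "h \<in> C0" and d: "\<psi> - \<psi>' = diff_map h" by blast
  note lh = C0D(1)[OF h]
  note mh = linear_betweenD(1)[OF lh]
  \<comment> \<open>The minus sign is due to the direction: here \<psi> - \<psi>' is the coboundary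
    of h.\<close>
  define \<phi> where "\<phi> i z = (if evens z \<in> vsp N i \<and> odds z \<in> vsp M i then interleave (evens z - h i (odds z)) (odds z) else 0)" for i z
  have p: "\<psi> a x - \<psi>' a x = h (head Q a) (vmap M a x) - vmap N a (h (tail Q a) x)"
    if "a \<in> arcs Q" "x \<in> vsp M (tail Q a)" for a x
    using that d by (metis diff_map_def fun_diff_def)
  have "\<phi> \<in> Hom Q (ext_rep \<psi>) (ext_rep \<psi>')"
  proof (rule HomI)
    show "linear_between (vsp (ext_rep \<psi>) i) (vsp (ext_rep \<psi>') i) (\<phi> i)" for i
    proof (rule linear_betweenI)
      fix z assume z: "z \<in> vsp (ext_rep \<psi>) i"
      show "\<phi> i z \<in> vsp (ext_rep \<psi>') i" using z mh cN(2) by (simp add: \<phi>_def)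
      show "\<phi> i (z + w) = \<phi> i z + \<phi> i w" if "w \<in> vsp (ext_rep \<psi>) i" for w
        using z that cM(1) cN(1) linear_betweenD(2)[OF lh]
        by (simp add: \<phi>_def algebra_simps flip: interleave_add)
      show "\<phi> i (vscale c z) = vscale c (\<phi> i z)" for c
        using z cM(3) cN(3) linear_betweenD(3)[OF lh]
        by (simp add: \<phi>_def vs.scale_right_diff_distrib flip: interleave_vscale)
    qed
    show "\<phi> i z = 0" if "z \<notin> vsp (ext_rep \<psi>) i" for i z using that by (auto simp: \<phi>_def)
    show "\<phi> (head Q a) (vmap (ext_rep \<psi>) a z) = vmap (ext_rep \<psi>') a (\<phi> (tail Q a) z)"
      if a: "a \<in> arcs Q" and z: "z \<in> vsp (ext_rep \<psi>) (tail Q a)" for a z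
    proof -
      note mM = linear_betweenD(1)[OF lM[OF a]] and mN = linear_betweenD(1)[OF lN[OF a]]
      have zz: "evens z \<in> vsp N (tail Q a)" "odds z \<in> vsp M (tail Q a)" using z by simp_all
      have p': "\<psi> a (odds z) = h (head Q a) (vmap M a (odds z)) - vmap N a (h (tail Q a) (odds z)) + \<psi>' a (odds z)"
        unfolding p[OF a zz(2), symmetric] by simp
      have "vmap N a (evens z) + \<psi> a (odds z) - h (head Q a) (vmap M a (odds z)) =
          vmap N a (evens z - h (tail Q a) (odds z)) + \<psi>' a (odds z)"
        unfolding p' linear_between_diff[OF fN lN[OF a] zz(1) mh[OF zz(2)]] by simp
      thus ?thesis
        using zz mM mN linear_betweenD(1)[OF C1D(1)[OF \<psi> a]] cN(1) by (simp add: \<phi>_def)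
    qed
  qed
  moreover have "bij_betw (\<phi> i) (vsp (ext_rep \<psi>) i) (vsp (ext_rep \<psi>') i)" for i
    by (rule bij_betw_byWitness[where f' = "\<lambda>z. interleave (evens z + h i (odds z)) (odds z)"])
      (use mh cN in \<open>auto simp: \<phi>_def\<close>)
  moreover have "\<phi> i (ext_inj i x) = ext_inj i x" if "x \<in> vsp N i" for i x
    using that fsub_0[OF fM] linear_between_0[OF fM lh] by (simp add: \<phi>_def ext_inj_def)
  moreover have "ext_proj i (\<phi> i z) = ext_proj i z" if "z \<in> vsp (ext_rep \<psi>) i" for i z
    using that mh cN(2) by (simp add: \<phi>_def ext_proj_def)
  ultimately show "(ext_ses \<psi>, ext_ses \<psi>') \<in> ses_equiv Q M N"
    using ext_ses_short_exact[OF \<psi>] ext_ses_short_exact[OF \<psi>'] unfolding ext_ses_def ses_equiv_iff Iso_def by blast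
qed

text \<open>Sending \<psi> to its extension class is onto, and its fibres are the cosets of the
  coboundaries. Counting cosets suffices, so no addition of extension classes has to be
  introduced.\<close>

lemma card_C1_eq: "card C1 = card (Ext1 Q M N) * card (diff_map ` C0)"
proof -
  let ?cl = "\<lambda>\<psi>. ses_equiv Q M N `` {ext_ses \<psi>}"
  have eq: "?cl \<psi> = ?cl \<psi>' \<longleftrightarrow> \<psi> - \<psi>' \<in> diff_map ` C0" if "\<psi> \<in> C1" "\<psi>' \<in> C1" for \<psi> \<psi>'
    using eq_equiv_class_iff[OF equiv_ses_equiv ext_ses_short_exact[OF that(1)] ext_ses_short_exact[OF that(2)]]
      ext_ses_equiv_iff[OF that] by simp
  have im: "?cl ` C1 = Ext1 Q M N"
  proof (rule subset_antisym; rule subsetI)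
    fix c assume "c \<in> ?cl ` C1"
    thus "c \<in> Ext1 Q M N" using ext_ses_short_exact unfolding Ext1_def by (auto intro: quotientI)
  next
    fix c assume "c \<in> Ext1 Q M N"
    then obtain s where s: "s \<in> short_exact Q M N" "c = ses_equiv Q M N `` {s}" unfolding Ext1_def by (rule quotientE)
    obtain E f g where sE: "s = (E, f, g)" by (cases s)
    obtain \<psi> where \<psi>: "\<psi> \<in> C1" "(ext_ses \<psi>, s) \<in> ses_equiv Q M N"
      using ext_ses_surj s(1) unfolding sE by blast
    have "?cl \<psi> = c" using equiv_class_eq[OF equiv_ses_equiv \<psi>(2)] s(2) by simp
    thus "c \<in> ?cl ` C1" using \<psi>(1) by blast
  qed
  have "card C1 = (\<Sum>\<psi>\<in>C1. 1)" by simp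
  also have "\<dots> = (\<Sum>c\<in>?cl ` C1. \<Sum>\<psi>\<in>{\<psi> \<in> C1. ?cl \<psi> = c}. 1)" by (rule sum.image_gen[OF finite_C1])
  also have "\<dots> = (\<Sum>c\<in>?cl ` C1. card (diff_map ` C0))"
  proof (rule sum.cong[OF refl])
    fix c assume "c \<in> ?cl ` C1"
    then obtain \<psi>0 where \<psi>0: "\<psi>0 \<in> C1" "c = ?cl \<psi>0" by blast
    have "bij_betw (\<lambda>\<psi>. \<psi> - \<psi>0) {\<psi> \<in> C1. ?cl \<psi> = c} (diff_map ` C0)"
    proof (rule bij_betw_byWitness[where f' = "\<lambda>\<psi>. \<psi> + \<psi>0"])
      show "(\<lambda>\<psi>. \<psi> - \<psi>0) ` {\<psi> \<in> C1. ?cl \<psi> = c} \<subseteq> diff_map ` C0"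
        using eq \<psi>0 by blast
      show "(\<lambda>\<psi>. \<psi> + \<psi>0) ` (diff_map ` C0) \<subseteq> {\<psi> \<in> C1. ?cl \<psi> = c}"
      proof (rule image_subsetI)
        fix \<psi> assume \<psi>: "\<psi> \<in> diff_map ` C0"
        hence "\<psi> \<in> C1" using diff_map_C1 by blast
        hence "\<psi> - (0 - \<psi>0) \<in> C1" using C1_diff zero_C1 \<psi>0(1) by blast
        hence 1: "\<psi> + \<psi>0 \<in> C1" by simp
        have "?cl (\<psi> + \<psi>0) = c" unfolding \<psi>0(2) eq[OF 1 \<psi>0(1)] using \<psi> by simp
        thus "\<psi> + \<psi>0 \<in> {\<psi> \<in> C1. ?cl \<psi> = c}" using 1 by simp
      qed
    qed auto
    thus "(\<Sum>\<psi>\<in>{\<psi> \<in> C1. ?cl \<psi> = c}. 1) = card (diff_map ` C0)" by (simp add: bij_betw_same_card)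
  qed
  finally show ?thesis by (simp add: im)
qed

text \<open>Counting along the two-term complex gives |Ext^1| |C0| = |C1| |Hom|. This shows at the
  same time that |Ext^1| is a power of q, so that the description in \<open>ext_dim\<close> has a
  solution.\<close>

lemma hom_dim_minus_ext_dim:
  "int (hom_dim Q M N) - int (ext_dim Q M N) = form (mat 1 - A_mat Q) (dimv M) (dimv N)"
proof -
  let ?q = "CARD('k)"
  define x0 where "x0 = (\<Sum>i\<in>UNIV. vs.dim (vsp M i) * vs.dim (vsp N i))"
  define x1 where "x1 = (\<Sum>a\<in>arcs Q. vs.dim (vsp M (tail Q a)) * vs.dim (vsp N (head Q a)))"
  let ?h = "hom_dim Q M N"
  have q: "?q > 1" by (rule CARD_field_gt_1)
  have "card (Ext1 Q M N) * card C0 = card C1 * card (Hom Q M N)"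
    unfolding card_C0_eq card_C1_eq by simp
  hence e: "card (Ext1 Q M N) * ?q ^ x0 = ?q ^ (x1 + ?h)"
    by (simp add: card_C0 card_C1 card_Hom x0_def x1_def power_add)
  \<comment> \<open>Nonemptiness gives the inequality of exponents that makes the subtraction of
    natural numbers in \<open>x1 + ?h - x0\<close> exact.\<close>
  have "card (Ext1 Q M N) \<noteq> 0" using e q by (metis mult_is_0 not_one_less_zero power_not_zero)
  hence "?q ^ x0 \<le> ?q ^ (x1 + ?h)" using e by (metis le_square less_one mult_le_mono1 nat_mult_1 not_le)
  hence le: "x0 \<le> x1 + ?h" using q power_increasing_iff by blast
  hence "?q ^ (x1 + ?h) = ?q ^ (x1 + ?h - x0) * ?q ^ x0" by (simp flip: power_add)
  hence c: "card (Ext1 Q M N) = ?q ^ (x1 + ?h - x0)" using e q by simp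
  have "ext_dim Q M N = x1 + ?h - x0"
    unfolding ext_dim_def c using q by (intro the_equality) simp_all
  moreover have "form (mat 1) (dimv M) (dimv N) = int x0"
    by (simp add: form_eq_sum_mult x0_def dimv_def sdim_def)
  moreover have "form (A_mat Q) (dimv M) (dimv N) = int x1"
    by (simp add: form_A_mat finite_arcs x1_def dimv_def sdim_def)
  ultimately show ?thesis using le by (simp add: form_diff_mat)
qed

end

section \<open>The Euler form on the dimension vectors of a subrepresentation and its
  quotient\<close>

lemma fsub_complement_dim:
  fixes V :: "(nat \<Rightarrow> 'k::field) set"
  assumes V: "fsub V" and U: "vs.subspace U" "U \<subseteq> V"
  obtains C :: "(nat \<Rightarrow> 'k) set" where "fsub C" "vs.dim C = vs.dim V - vs.dim U"
proof -
  obtain B1 where B1: "B1 \<subseteq> U" "vs.independent B1" "vs.span B1 = U" "finite B1" "card B1 = vs.dim U"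
    using fsub_basis[OF fsub_subspace[OF V U]] .
  have "B1 \<subseteq> V" using B1(1) U(2) by blast
  then obtain B where B: "B1 \<subseteq> B" "B \<subseteq> V" "vs.independent B" "vs.span B = V" "finite B" "card B = vs.dim V"
    using fsub_extend_basis[OF V _ B1(2)] by blast
  show ?thesis
  proof (rule that)
    show "fsub (vs.span (B - B1))"
      using fsub_subspace[OF V vs.subspace_span] B(4) by (metis Diff_subset vs.span_mono)
    have "vs.independent (B - B1)" using B(3) vs.independent_mono by blast
    hence "vs.dim (vs.span (B - B1)) = card (B - B1)" by (rule vs.dim_span_eq_card_independent)
    thus "vs.dim (vs.span (B - B1)) = vs.dim V - vs.dim U" using B B1 by (simp add: card_Diff_subset)
  qed
qed

lemma zero_rep_reps:
  fixes W :: "'n::finite \<Rightarrow> (nat \<Rightarrow> 'k::{field,finite}) set"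
  assumes "\<And>i. fsub (W i)"
  shows "\<lparr>vsp = W, vmap = (\<lambda>_ _. 0)\<rparr> \<in> reps Q"
  using assms fsub_0 unfolding reps_def
  by (auto simp: fd_space_iff_fsub vs.scale_zero_right intro!: linear_betweenI)

text \<open>A definite description over all pairs with given dimension vectors is determined only if
  such a pair exists. Zero maps on the U_i and on complements of the U_i in the V_i supply
  one.\<close>

lemma (in quiver_rep) euler_sdim:
  assumes U: "U \<in> submodules Q M"
  shows "euler TYPE('k) Q (sdim U) (dimv M - sdim U) = form P_mat (sdim U) (dimv M - sdim U)"
proof -
  have Us: "vs.subspace (U i)" "U i \<subseteq> V i" for i using U by (auto simp: submodules_def)
  have "\<forall>i. \<exists>C :: (nat \<Rightarrow> 'k) set. fsub C \<and> vs.dim C = dV i - vs.dim (U i)" using fsub_complement_dim[OF fsub_V Us] by metis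
  then obtain C :: "'n \<Rightarrow> (nat \<Rightarrow> 'k) set" where C: "\<And>i. fsub (C i)" "\<And>i. vs.dim (C i) = dV i - vs.dim (U i)" by metis
  define M' N' :: "('n, 'a, 'k) qrep" where "M' = \<lparr>vsp = U, vmap = (\<lambda>_ _. 0)\<rparr>" and "N' = \<lparr>vsp = C, vmap = (\<lambda>_ _. 0)\<rparr>"
  have M': "M' \<in> reps Q" and N': "N' \<in> reps Q"
    unfolding M'_def N'_def by (rule zero_rep_reps, use fsub_subspace[OF fsub_V Us] C(1) in blast)+
  have dM': "dimv M' = sdim U" by (simp add: dimv_def M'_def)
  have "vs.dim (U i) \<le> dV i" for i by (rule fsub_dim_mono[OF fsub_V Us(2,1)])
  hence dN': "dimv N' = dimv M - sdim U"
    by (simp add: dimv_def N'_def sdim_def C(2) vec_eq_iff of_nat_diff)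
  have "int (hom_dim Q X Y) - int (ext_dim Q X Y) = form P_mat (dimv X) (dimv Y)"
    if "X \<in> reps Q" "Y \<in> reps Q" for X Y :: "('n, 'a, 'k) qrep"
  proof -
    interpret rep_pair Q X Y using that by unfold_locales
    show ?thesis by (rule hom_dim_minus_ext_dim)
  qed
  thus ?thesis
    unfolding euler_def using M' N' dM' dN' by (intro the_equality) metis+
qed

section \<open>One-step mutations of the initial seed\<close>

lemma form_scale_left: "form L (k *s x) y = k * form L x y"
  by (simp add: form_def sum_distrib_left mult_ac)

lemma form_scale_right: "form L x (k *s y) = k * form L x y"
  by (simp add: form_def sum_distrib_left mult_ac)

lemma matrix_mult_axis: "C *v axis j 1 = (\<chi> i. (C :: int ^ 'n::finite ^ 'n) $ i $ j)"
proof -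
  have "(C *v axis j 1) $ i = (\<Sum>k\<in>UNIV. if k = j then C $ i $ k else 0)" for i
    unfolding matrix_vector_mult_def vec_lambda_beta by (rule sum.cong) (auto simp: axis_def)
  thus ?thesis by (simp add: vec_eq_iff)
qed

lemma form_axis: "form L (axis i 1) (axis j 1) = L $ i $ j"
proof -
  have "form L (axis i 1) (axis j 1) = form (mat 1) (axis i 1) (L *v axis j 1)"
    by (simp add: form_mat_1_mult_right)
  also have "\<dots> = L $ i $ j" by (simp add: form_mat_1_axis matrix_mult_axis)
  finally show ?thesis .
qed

definition strip :: "'n::finite \<Rightarrow> int ^ 'n \<Rightarrow> int ^ 'n" where
  "strip p x = (\<chi> i. if i = p then 0 else x $ i)"

lemma strip_add: "strip p (x + y) = strip p x + strip p y"
  by (simp add: strip_def vec_eq_iff)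

lemma strip_component [simp]: "strip p x $ p = 0"
  by (simp add: strip_def)

text \<open>Away from column p the matrix E agrees with the identity, so it fixes the coordinates
  other than p and replaces e_p by its column p.\<close>

lemma E_mat_mult_vec:
  "E_mat B p *v x = strip p x + x $ p *s (E_mat B p *v axis p 1)"
proof -
  have "(E_mat B p *v x) $ i = (strip p x + x $ p *s (E_mat B p *v axis p 1)) $ i" for i
  proof -
    have "(E_mat B p *v x) $ i = (\<Sum>j\<in>UNIV. (if j = p then E_mat B p $ i $ p * x $ p else 0)
        + (if j = i then (if i = p then 0 else x $ i) else 0))"
      unfolding matrix_vector_mult_def vec_lambda_beta
      by (intro sum.cong refl) (auto simp: E_mat_def)
    also have "\<dots> = E_mat B p $ i $ p * x $ p + (if i = p then 0 else x $ i)"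
      by (simp add: sum.distrib)
    finally show ?thesis by (simp add: strip_def matrix_mult_axis)
  qed
  thus ?thesis by (simp add: vec_eq_iff)
qed

lemma cluster_variableI:
  "(M, L', B') \<in> seeds F \<iota> v L B \<Longrightarrow> M (axis i 1) \<in> cluster_variables F \<iota> v L B"
  unfolding cluster_variables_def by blast

locale quantum_cluster = compatible_pair Q L + fin_digraph Q
  for Q :: "('n::finite, 'a) pre_digraph" and L :: "int ^ 'n ^ 'n" +
  fixes v :: real and F :: "'f ring" (structure) and \<iota> :: "(int ^ 'n \<Rightarrow>\<^sub>0 real) \<Rightarrow> 'f"
  assumes v_nonzero: "v \<noteq> 0"
    and acyclic_Q: "acyclic (arcs_ends Q)"
    and fractions: "skew_field_of_fractions (qtorus L v) F \<iota>"

sublocale quantum_cluster \<subseteq> F: ring F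
  using fractions by (simp add: skew_field_of_fractions_def)

context quantum_cluster
begin

abbreviation "T \<equiv> (tcarrier v :: (int ^ 'n \<Rightarrow>\<^sub>0 real) set)"

lemma carrier_qtorus: "carrier (qtorus L v) = T"
  by (simp add: qtorus_def tcarrier_def)

lemma iota_hom: "\<iota> \<in> ring_hom (qtorus L v) F"
  using fractions by (simp add: skew_field_of_fractions_def)

lemma iota_closed: "f \<in> T \<Longrightarrow> \<iota> f \<in> carrier F"
  using ring_hom_closed[OF iota_hom] by (simp add: carrier_qtorus)

lemma iota_mult: "f \<in> T \<Longrightarrow> g \<in> T \<Longrightarrow> \<iota> (qtorus_mult L v f g) = \<iota> f \<otimes> \<iota> g"
  using ring_hom_mult[OF iota_hom, unfolded carrier_qtorus, of f g] by (simp add: qtorus_def)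

lemma iota_add: "f \<in> T \<Longrightarrow> g \<in> T \<Longrightarrow> \<iota> (f + g) = \<iota> f \<oplus> \<iota> g"
  using ring_hom_add[OF iota_hom, unfolded carrier_qtorus, of f g] by (simp add: qtorus_def)

lemma iota_one: "\<iota> (Poly_Mapping.single 0 1) = \<one>"
  using ring_hom_one[OF iota_hom] by (simp add: qtorus_def)

lemma zero_T: "0 \<in> T"
  using tcarrier_single[OF coeff_ring_0, of 0] by simp

lemma iota_zero: "\<iota> 0 = \<zero>"
proof -
  have "\<iota> 0 \<oplus> \<iota> 0 = \<iota> 0" using iota_add[OF zero_T zero_T] by simp
  thus ?thesis using iota_closed[OF zero_T] by (metis F.add.r_cancel_one)
qed

lemma Units_F: "Units F = carrier F - {\<zero>}"
  using fractions by (simp add: skew_field_of_fractions_def)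

lemma iota_Units: "f \<in> T \<Longrightarrow> f \<noteq> 0 \<Longrightarrow> \<iota> f \<in> Units F"
proof -
  assume f: "f \<in> T" "f \<noteq> 0"
  have "inj_on \<iota> T" using fractions by (simp add: skew_field_of_fractions_def carrier_qtorus)
  hence "\<iota> f \<noteq> \<zero>" using f zero_T iota_zero by (metis inj_onD)
  thus ?thesis using iota_closed[OF f(1)] by (simp add: Units_F)
qed

text \<open>The element v^n X^c of F. Keeping the power of v as an integer argument reduces
  identities between monomials to integer arithmetic on exponents.\<close>

definition X :: "int ^ 'n \<Rightarrow> int \<Rightarrow> 'f" where
  "X c n = \<iota> (Poly_Mapping.single c (v powi n))"

lemma single_T: "Poly_Mapping.single c (v powi n) \<in> T"
  by (intro tcarrier_single coeff_ring_powi)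

lemma single_1_T: "Poly_Mapping.single c 1 \<in> T"
  by (intro tcarrier_single coeff_ring_1)

lemma X_Units: "X c n \<in> Units F"
proof -
  have "Poly_Mapping.single c (v powi n) \<noteq> (0 :: int ^ 'n \<Rightarrow>\<^sub>0 real)"
    using v_nonzero by (metis lookup_single_eq lookup_zero power_int_eq_0_iff)
  thus ?thesis unfolding X_def by (rule iota_Units[OF single_T])
qed

lemma X_closed: "X c n \<in> carrier F"
  using X_Units F.Units_closed by blast

lemma X_mult: "X c n \<otimes> X d m = X (c + d) (n + m + form L c d)"
  unfolding X_def iota_mult[OF single_T single_T, symmetric] qtorus_mult_single
  using v_nonzero by (simp add: power_int_add)

lemma X_0_0: "X 0 0 = \<one>"
  by (simp only: X_def power_int_0_right iota_one)

section \<open>The seed obtained from the initial one by mutation in a fixed direction p\<close>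

context
  fixes p :: 'n
begin

definition w1 :: "int ^ 'n" where "w1 = A_mat Q *v axis p 1 - axis p 1"
definition w2 :: "int ^ 'n" where "w2 = R_mat Q *v axis p 1 - axis p 1"
definition mutated :: 'f where "mutated = X w1 0 \<oplus> X w2 0"

lemma w1_w2: "w1 = w2 + B_mat Q *v axis p 1"
  by (simp add: w1_def w2_def B_mat_eq matrix_vector_mult_diff_rdistrib)

lemma mutated_eq_iota: "mutated = \<iota> (Poly_Mapping.single w1 1 + Poly_Mapping.single w2 1)"
  by (simp add: mutated_def X_def iota_add single_1_T)

lemma mutated_Units: "mutated \<in> Units F"
proof -
  \<comment> \<open>The coefficient is 1 or 2, according to whether \<open>w2\<close> differs from
    \<open>w1\<close>; it is nonzero in both cases.\<close>
  have "Poly_Mapping.lookup (Poly_Mapping.single w1 1 + Poly_Mapping.single w2 (1::real)) w1 \<noteq> 0"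
    by (simp add: lookup_add lookup_single when_def)
  hence "Poly_Mapping.single w1 1 + Poly_Mapping.single w2 (1::real) \<noteq> 0" by (metis lookup_zero)
  thus ?thesis unfolding mutated_eq_iota by (intro iota_Units tcarrier_add single_1_T)
qed

text \<open>The difference of \<open>w1\<close> and \<open>w2\<close> is B e_p, which \<Lambda>
  pairs with a to the p-th coordinate of a. Hence both summands of x'_p commute with X^a up to the
  same power of v, and so does x'_p itself.\<close>

lemma form_w1: "a $ p = 0 \<Longrightarrow> form L w1 a = form L w2 a"
  by (simp add: w1_w2 form_add_left form_L_B_left form_mat_1_commute[of "axis p 1"] form_mat_1_axis)

lemma mutated_X_commute:
  assumes "a $ p = 0"
  shows "mutated \<otimes> X a n = X a (n - 2 * form L a w2) \<otimes> mutated"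
proof -
  have e: "form L a w1 = form L a w2" using form_w1[OF assms] form_L_swap by metis
  have "mutated \<otimes> X a n = X w1 0 \<otimes> X a n \<oplus> X w2 0 \<otimes> X a n"
    unfolding mutated_def by (rule F.l_distr) (rule X_closed)+
  also have "\<dots> = X (a + w1) (n - form L a w2) \<oplus> X (a + w2) (n - form L a w2)"
    using form_w1[OF assms] form_L_swap[of w2 a] by (simp add: X_mult add.commute)
  also have "\<dots> = X a (n - 2 * form L a w2) \<otimes> X w1 0 \<oplus> X a (n - 2 * form L a w2) \<otimes> X w2 0"
    by (simp add: X_mult e)
  also have "\<dots> = X a (n - 2 * form L a w2) \<otimes> mutated"
    unfolding mutated_def by (rule F.r_distr[symmetric]) (rule X_closed)+
  finally show ?thesis .
qed

text \<open>The group of units provides all integer powers of x'_p together with their power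
  laws.\<close>

interpretation G: group "units_of F"
  by (rule F.units_group)

lemma mutated_G: "mutated \<in> carrier (units_of F)" and X_G: "X a n \<in> carrier (units_of F)"
  using mutated_Units X_Units by (simp_all add: units_of_carrier)

abbreviation mutated_pow :: "int \<Rightarrow> 'f" where "mutated_pow k \<equiv> mutated [^]\<^bsub>units_of F\<^esub> k"

lemma mutated_pow_closed: "mutated_pow k \<in> Units F"
  using G.int_pow_closed[OF mutated_G] by (simp add: units_of_carrier)

lemma mutated_pow_add: "mutated_pow (j + k) = mutated_pow j \<otimes> mutated_pow k"
  using G.int_pow_mult[OF mutated_G] by (simp add: units_of_mult)

lemma mutated_pow_X_commute:
  assumes a: "a $ p = 0"
  shows "mutated_pow k \<otimes> X a n = X a (n - 2 * k * form L a w2) \<otimes> mutated_pow k"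
proof (induction k arbitrary: n rule: int_induct[where k = 0])
  case base
  show ?case using X_closed by (simp add: units_of_one)
next
  case (step1 k)
  have step: "mutated_pow (k + 1) = mutated \<otimes> mutated_pow k"
    using mutated_pow_add[of 1 k] G.int_pow_1[OF mutated_G] by (simp add: add.commute)
  note c = F.Units_closed[OF mutated_Units] F.Units_closed[OF mutated_pow_closed] X_closed
  have "mutated_pow (k + 1) \<otimes> X a n = mutated \<otimes> (mutated_pow k \<otimes> X a n)" unfolding step using c by (simp add: F.m_assoc)
  also have "\<dots> = (mutated \<otimes> X a (n - 2 * k * form L a w2)) \<otimes> mutated_pow k"
    unfolding step1.IH using c by (simp add: F.m_assoc)
  also have "\<dots> = X a (n - 2 * k * form L a w2 - 2 * form L a w2) \<otimes> mutated_pow (k + 1)"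
    unfolding mutated_X_commute[OF a] step using c by (simp add: F.m_assoc)
  finally show ?case by (simp add: algebra_simps)
next
  case (step2 k)
  have step: "mutated_pow k = mutated \<otimes> mutated_pow (k - 1)"
    using mutated_pow_add[of 1 "k - 1"] G.int_pow_1[OF mutated_G] by simp
  note c = F.Units_closed[OF mutated_Units] F.Units_closed[OF mutated_pow_closed] X_closed
  \<comment> \<open>For the downward step the claim is multiplied by x'_p on the left, where it
    follows from the case k; the unit x'_p is cancelled at the end.\<close>
  have "mutated \<otimes> (mutated_pow (k - 1) \<otimes> X a n) = mutated_pow k \<otimes> X a n" unfolding step using c by (simp add: F.m_assoc)
  also have "\<dots> = X a (n - 2 * k * form L a w2) \<otimes> mutated_pow k" by (rule step2.IH)
  also have "\<dots> = (X a (n - 2 * (k - 1) * form L a w2 - 2 * form L a w2) \<otimes> mutated) \<otimes> mutated_pow (k - 1)"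
    unfolding step using c by (simp add: F.m_assoc algebra_simps)
  also have "\<dots> = mutated \<otimes> (X a (n - 2 * (k - 1) * form L a w2) \<otimes> mutated_pow (k - 1))"
    unfolding mutated_X_commute[OF a, symmetric] using c by (simp add: F.m_assoc)
  finally show ?case
    using F.Units_l_cancel[OF mutated_Units] c by simp
qed

text \<open>With a the coordinates of x away from p and k that at p, any frame for the mutated form
  \<Lambda>' satisfies M'(x) = v^(-\<Lambda>'(a, k e_p)) M'(a) M'(e_p)^k. Since E e_p = w2, the
  exponent is -k \<Lambda>(a, w2), which leaves no choice for the normalisation.\<close>

definition frame :: "int ^ 'n \<Rightarrow> 'f" where
  "frame x = X (strip p x) (- (x $ p * form L (strip p x) w2)) \<otimes> mutated_pow (x $ p)"

definition L' :: "int ^ 'n ^ 'n" where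
  "L' = transpose (E_mat (B_mat Q) p) ** L ** E_mat (B_mat Q) p"

lemma no_2_cycle: "arrow_count Q i j = 0 \<or> arrow_count Q j i = 0"
proof (rule ccontr)
  assume *: "\<not> ?thesis"
  have e: "(k, l) \<in> arcs_ends Q" if "arrow_count Q k l \<noteq> 0" for k l :: 'n
  proof -
    have "{a \<in> arcs Q. tail Q a = k \<and> head Q a = l} \<noteq> {}"
      using that unfolding arrow_count_def by (metis card.empty)
    thus ?thesis by (auto simp: arcs_ends_def arc_to_ends_def)
  qed
  have "(i, j) \<in> arcs_ends Q" "(j, i) \<in> arcs_ends Q" using e * by blast+
  hence "(i, i) \<in> (arcs_ends Q)\<^sup>+" by (rule trancl_into_trancl[OF r_into_trancl])
  thus False using acyclic_Q by (simp add: acyclic_def)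
qed

text \<open>Without 2-cycles at most one of the two arrow counts in an entry of B is nonzero, so the
  positive and the negative part of the entry are these counts themselves.\<close>

lemma max_B_mat:
  "max (B_mat Q $ i $ p) 0 = A_mat Q $ i $ p" "max (- B_mat Q $ i $ p) 0 = R_mat Q $ i $ p"
  using no_2_cycle[of i p] by (auto simp: B_mat_def R_mat_def transpose_def)

lemma w1_eq: "(\<chi> i. max (B_mat Q $ i $ p) 0) - axis p 1 = w1"
  and w2_eq: "(\<chi> i. max (- B_mat Q $ i $ p) 0) - axis p 1 = w2"
  by (simp_all add: w1_def w2_def max_B_mat matrix_mult_axis vec_eq_iff del: transpose_matrix_vector)

text \<open>E is built from the negative parts of B, so its column p is the exponent of the second
  summand of the exchange relation. The absence of loops makes the diagonal entry equal to -1 on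
  both sides.\<close>

lemma E_mat_axis: "E_mat (B_mat Q) p *v axis p 1 = w2"
proof -
  have "arrow_count Q p p = 0" using no_2_cycle[of p p] by simp
  hence "R_mat Q $ p $ p = 0" by (simp add: R_mat_def)
  thus ?thesis
    unfolding w2_def matrix_mult_axis
    by (simp add: vec_eq_iff E_mat_def max_B_mat max.commute[of 0] axis_def)
qed

lemma form_L': "form L' x x' = form L (strip p x) (strip p x') + x' $ p * form L (strip p x) w2
    - x $ p * form L (strip p x') w2"
proof -
  have "form L' x x' = form L (E_mat (B_mat Q) p *v x) (E_mat (B_mat Q) p *v x')"
    unfolding L'_def by (simp add: form_mult_vec_left form_mult_vec_right matrix_mul_assoc)
  also have "\<dots> = form L (strip p x + x $ p *s w2) (strip p x' + x' $ p *s w2)"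
    using E_mat_mult_vec[of "B_mat Q" p] unfolding E_mat_axis by simp
  also have "\<dots> = form L (strip p x) (strip p x') + x' $ p * form L (strip p x) w2
    + x $ p * form L w2 (strip p x') + x $ p * (x' $ p * form L w2 w2)"
    by (simp add: form_add_left form_add_right form_scale_left form_scale_right algebra_simps)
  also have "form L w2 w2 = 0" using form_L_swap[of w2 w2] by simp
  finally show ?thesis using form_L_swap[of w2 "strip p x'"] by simp
qed

lemma transpose_L': "transpose L' = - L'"
proof -
  have "form L' (axis j 1) (axis i 1) = - form L' (axis i 1) (axis j 1)" for i j
    unfolding form_L' using form_L_swap[of "strip p (axis j 1)" "strip p (axis i 1)"] by linarith
  hence "L' $ j $ i = - L' $ i $ j" for i j unfolding form_axis .
  thus ?thesis unfolding vec_eq_iff transpose_def vec_lambda_beta uminus_vec_def by blast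
qed

text \<open>Moving the k-th power of x'_p past X^b costs -2 k \<Lambda>(b, w2) in the exponent of v.
  One half is the term of \<Lambda>' at (x, x') with this shape, the other half goes into the
  normalising power of \<open>frame (x + x')\<close>.\<close>

lemma frame_mult: "frame x \<otimes> frame x' = \<iota> (Poly_Mapping.single 0 (v powi form L' x x')) \<otimes> frame (x + x')"
proof -
  let ?a = "strip p x" and ?b = "strip p x'" and ?k = "x $ p" and ?l = "x' $ p"
  note c = F.Units_closed[OF mutated_pow_closed] X_closed
  have "frame x \<otimes> frame x' = X ?a (- (?k * form L ?a w2)) \<otimes> (mutated_pow ?k \<otimes> X ?b (- (?l * form L ?b w2))) \<otimes> mutated_pow ?l"
    unfolding frame_def using c by (simp add: F.m_assoc)
  also have "\<dots> = X ?a (- (?k * form L ?a w2)) \<otimes> X ?b (- (?l * form L ?b w2) - 2 * ?k * form L ?b w2) \<otimes> (mutated_pow ?k \<otimes> mutated_pow ?l)"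
    unfolding mutated_pow_X_commute[OF strip_component] using c by (simp add: F.m_assoc)
  also have "\<dots> = X (?a + ?b) (- (?k * form L ?a w2) + (- (?l * form L ?b w2) - 2 * ?k * form L ?b w2) + form L ?a ?b)
      \<otimes> mutated_pow (?k + ?l)"
    by (simp only: X_mult mutated_pow_add)
  also have "- (?k * form L ?a w2) + (- (?l * form L ?b w2) - 2 * ?k * form L ?b w2) + form L ?a ?b
      = form L' x x' + - ((?k + ?l) * form L (?a + ?b) w2) + form L 0 (?a + ?b)"
    by (simp add: form_L' form_add_left algebra_simps)
  also have "X (?a + ?b) (form L' x x' + - ((?k + ?l) * form L (?a + ?b) w2) + form L 0 (?a + ?b))
      = X 0 (form L' x x') \<otimes> X (?a + ?b) (- ((?k + ?l) * form L (?a + ?b) w2))"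
    unfolding X_mult by simp
  also have "X 0 (form L' x x') \<otimes> X (?a + ?b) (- ((?k + ?l) * form L (?a + ?b) w2)) \<otimes> mutated_pow (?k + ?l)
      = X 0 (form L' x x') \<otimes> frame (x + x')"
    unfolding frame_def using c by (simp add: F.m_assoc strip_add)
  finally show ?thesis unfolding X_def[of 0] .
qed

lemma frame_axis_other: "i \<noteq> p \<Longrightarrow> frame (axis i 1) = \<iota> (Poly_Mapping.single (axis i 1) 1)"
proof -
  assume i: "i \<noteq> p"
  hence "strip p (axis i 1) = axis i 1" "axis i 1 $ p = (0 :: int)" by (auto simp: strip_def axis_def vec_eq_iff)
  thus ?thesis using X_closed[of "axis i 1" 0] by (simp add: frame_def units_of_one X_def)
qed

lemma frame_axis: "frame (axis p 1) = mutated"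
proof -
  have "strip p (axis p 1) = 0" "axis p 1 $ p = (1 :: int)" by (auto simp: strip_def axis_def vec_eq_iff)
  thus ?thesis using F.Units_closed[OF mutated_Units] G.int_pow_1[OF mutated_G] by (simp add: frame_def X_0_0)
qed

lemma toric_frame_frame: "toric_frame F \<iota> v L' frame"
  unfolding toric_frame_def
proof (intro conjI allI)
  show "transpose L' = - L'" by (rule transpose_L')
  show "frame c \<in> carrier F - {\<zero>}" for c
    unfolding Units_F[symmetric] frame_def by (intro F.Units_m_closed X_Units mutated_pow_closed)
  have "strip p 0 = 0" by (simp add: strip_def vec_eq_iff)
  thus "frame 0 = \<one>" by (simp add: frame_def X_0_0 units_of_one)
  show "frame c \<otimes> frame d = \<iota> (Poly_Mapping.single 0 (v powi form L' c d)) \<otimes> frame (c + d)" for c d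
    by (rule frame_mult)
qed

text \<open>\<open>is_mutation\<close> characterises the new seed without asserting that it exists,
  so x'_p becomes a cluster variable only by exhibiting a full toric frame for the mutated
  form.\<close>

lemma mutated_cluster_variable: "mutated \<in> cluster_variables F \<iota> v L (B_mat Q)"
proof -
  have "is_mutation F \<iota> v p ((\<lambda>c. \<iota> (Poly_Mapping.single c 1)), L, B_mat Q) (frame, L', mutate_mat p (B_mat Q))"
    unfolding is_mutation_def
    using toric_frame_frame frame_axis_other frame_axis
    by (simp add: L'_def w1_eq w2_eq mutated_def X_def)
  hence "(frame, L', mutate_mat p (B_mat Q)) \<in> seeds F \<iota> v L (B_mat Q)"
    by (rule seeds.mutation[OF seeds.initial])
  from cluster_variableI[OF this, of p] show ?thesis unfolding frame_axis .
qed

end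

section \<open>The preimage of the quantum cluster algebra in the quantum torus\<close>

definition preimage :: "(int ^ 'n \<Rightarrow>\<^sub>0 real) set" where
  "preimage = {f \<in> T. \<iota> f \<in> quantum_cluster_algebra F \<iota> v L (B_mat Q)}"

lemma preimage_add: "f \<in> preimage \<Longrightarrow> g \<in> preimage \<Longrightarrow> f + g \<in> preimage"
  unfolding preimage_def quantum_cluster_algebra_def
  by (simp add: tcarrier_add iota_add generate_ring.eng_add)

lemma preimage_mult: "f \<in> preimage \<Longrightarrow> g \<in> preimage \<Longrightarrow> qtorus_mult L v f g \<in> preimage"
  unfolding preimage_def quantum_cluster_algebra_def
  by (simp add: tcarrier_mult v_nonzero iota_mult generate_ring.eng_mult)

lemma preimage_scalar: "r \<in> coeff_ring v \<Longrightarrow> Poly_Mapping.single 0 r \<in> preimage"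
  unfolding preimage_def quantum_cluster_algebra_def
  by (auto intro: tcarrier_single generate_ring.incl)

lemma preimage_var: "Poly_Mapping.single (axis i 1) 1 \<in> preimage"
proof -
  have "\<iota> (Poly_Mapping.single (axis i 1) 1) \<in> cluster_variables F \<iota> v L (B_mat Q)"
    using cluster_variableI[OF seeds.initial] by blast
  thus ?thesis unfolding preimage_def quantum_cluster_algebra_def
    by (auto intro: single_1_T generate_ring.incl)
qed

lemma preimage_mutated: "Poly_Mapping.single (- ((mat 1 - A_mat Q) *v axis j 1)) 1
    + Poly_Mapping.single (- (B_mat Q *v axis j 1) - (mat 1 - A_mat Q) *v axis j 1) 1 \<in> preimage"
proof -
  have "- ((mat 1 - A_mat Q) *v axis j 1) = w1 j" "- (B_mat Q *v axis j 1) - (mat 1 - A_mat Q) *v axis j 1 = w2 j"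
    by (simp_all add: w1_def w2_def B_mat_eq matrix_vector_mult_diff_rdistrib del: transpose_matrix_vector)
  moreover have "\<iota> (Poly_Mapping.single (w1 j) 1 + Poly_Mapping.single (w2 j) 1) \<in> cluster_variables F \<iota> v L (B_mat Q)"
    using mutated_cluster_variable unfolding mutated_eq_iota .
  ultimately show ?thesis unfolding preimage_def quantum_cluster_algebra_def
    by (auto intro: tcarrier_add single_1_T generate_ring.incl)
qed

lemma preimage_sum: "(\<And>i. i \<in> I \<Longrightarrow> f i \<in> preimage) \<Longrightarrow> sum f I \<in> preimage"
  by (induction I rule: infinite_finite_induct) (use preimage_scalar[OF coeff_ring_0] preimage_add in auto)

lemma quantum_character_preimage:
  fixes M :: "('n, 'a, 'k::{field,finite}) qrep"
  assumes "v\<^sup>2 = real CARD('k)" "M \<in> reps Q"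
  shows "quantum_character Q v M \<in> preimage"
proof -
  interpret quiver_rep Q M by unfold_locales (rule assms)
  interpret lower_bound Q M L v preimage
    by unfold_locales (use assms(1) acyclic_Q preimage_add preimage_mult preimage_scalar preimage_var preimage_mutated in auto)
  show ?thesis by (rule quantum_character_mem) (rule euler_sdim)
qed

end

text \<open>An isomorphism class is nonempty because isomorphism is reflexive, so the choice made by
  \<open>obj\<close> does pick a member.\<close>

lemma obj_reps:
  fixes C :: "('n, 'a, 'k::{field,finite}) qrep set"
  assumes "C \<in> isoclasses Q"
  shows "obj C \<in> reps Q"
proof -
  obtain M where M: "M \<in> reps Q" "C = {(M, N). M \<in> reps Q \<and> N \<in> reps Q \<and> Iso Q M N \<noteq> {}} `` {M}"
    using assms unfolding isoclasses_def by (rule quotientE)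
  have "M \<in> C" using M Iso_refl[OF M(1)] by auto
  hence "obj C \<in> C" unfolding obj_def by (rule someI)
  thus ?thesis using M by auto
qed

theorem corollary4p6:
  fixes Q :: "('n::finite, 'a) pre_digraph"
    and \<Lambda> :: "int ^ 'n ^ 'n"
    and v :: real
    and F :: "'f ring"
    and \<iota> :: "(int ^ 'n \<Rightarrow>\<^sub>0 real) \<Rightarrow> 'f"
  assumes "v\<^sup>2 = real CARD('k)"
    and "fin_digraph Q" and "verts Q = UNIV"
    and "acyclic (arcs_ends Q)"
    and "bipartite_quiver Q"
    and "full_rank (B_mat Q)"
    and "transpose \<Lambda> = - \<Lambda>"
    and "\<Lambda> ** (- B_mat Q) = mat 1"
    and "skew_field_of_fractions (qtorus \<Lambda> v) F \<iota>"
  shows "\<iota> ` Psi Q v `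
           carrier (dual_hall_algebra Q \<Lambda> v :: (('n, 'a, 'k::{field,finite}) qrep set \<Rightarrow>\<^sub>0 real) ring)
         \<subseteq> quantum_cluster_algebra F \<iota> v \<Lambda> (B_mat Q)"
proof -
  interpret fin_digraph Q by (rule assms)
  interpret quantum_cluster Q \<Lambda> v F \<iota>
    by unfold_locales (use assms in auto)
  \<comment> \<open>An element of the Hall algebra is a finite combination of basis elements over
    the coefficient ring, so membership reduces to that of single characters.\<close>
  have "Psi Q v f \<in> preimage"
    if f: "f \<in> carrier (dual_hall_algebra Q \<Lambda> v :: (('n, 'a, 'k) qrep set \<Rightarrow>\<^sub>0 real) ring)" for f
    unfolding Psi_def
  proof (rule preimage_sum)
    fix C assume C: "C \<in> Poly_Mapping.keys f"
    have "C \<in> isoclasses Q" using f C by (auto simp: dual_hall_algebra_def)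
    hence "quantum_character Q v (obj C) \<in> preimage" by (intro quantum_character_preimage assms(1) obj_reps)
    moreover have "Poly_Mapping.lookup f C \<in> coeff_ring v" using f by (auto simp: dual_hall_algebra_def)
    moreover have "Poly_Mapping.lookup f C \<noteq> 0" using C by (simp add: in_keys_iff)
    ultimately show "Poly_Mapping.map ((*) (Poly_Mapping.lookup f C)) (quantum_character Q v (obj C)) \<in> preimage"
      using preimage_mult preimage_scalar qtorus_mult_scalar_eq_map by metis
  qed
  thus ?thesis by (auto simp: preimage_def)
qed

end
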